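(* Let $\mathfrak{k}$ be a field and $q\in\mathfrak{k}$, $q\ne0$. For every braided vector space $(V,\hat R)$ over $\mathfrak{k}$, the operator $T(\hat R)=T_q(\hat R)\in\mathrm{End}(T(V)\otimes T(V))$ defined in the context is a solution of the Yang--Baxter equation $$T(\hat R)_1T(\hat R)_2T(\hat R)_1=T(\hat R)_2T(\hat R)_1T(\hat R)_2\quad\text{on } T(V)^{\otimes 3},$$ where $T(\hat R)_1=T(\hat R)\otimes\mathrm{id}$ and $T(\hat R)_2=\mathrm{id}\otimes T(\hat R)$. Moreover, the correspondence $\hat R\rightsquigarrow T(\hat R)$ is functorial: if $(V,\hat R)$ and $(V',\hat R')$ are braided vector spaces over $\mathfrak{k}$ and $f\in\mathrm{Hom}(V,V')$ satisfies $(f\otimes f)\hat R=\hat R'(f\otimes f)$, then the map $T(f):T(V)\to T(V')$, whose restriction to $V^{\otimes k}$ is $f^{\otimes k}$ for every $k\ge 0$, satisfies $$(T(f)\otimes T(f))\,T(\hat R)=T(\hat R')\,(T(f)\otimes T(f)).$$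
   Context: A braided vector space is a vector space $V$ over $\mathfrak{k}$ with an invertible $\hat R\in\mathrm{Aut}(V\otimes V)$ satisfying the Yang--Baxter equation $\hat R_1\hat R_2\hat R_1=\hat R_2\hat R_1\hat R_2$ on $V^{\otimes3}$, with $\hat R_1=\hat R\otimes\mathrm{id}$, $\hat R_2=\mathrm{id}\otimes\hat R$. Put $T(V)=\bigoplus_{k\ge0}V^{\otimes k}$. Braid groups: $B_{n+1}$ is generated by $\sigma_1,\dots,\sigma_n$ with relations $\sigma_i\sigma_j\sigma_i=\sigma_j\sigma_i\sigma_j$ if $|i-j|=1$ and $\sigma_i\sigma_j=\sigma_j\sigma_i$ if $|i-j|>1$; $B_0,B_1$ are trivial; $B_n\subset B_{n+1}$ via $\sigma_i\mapsto\sigma_i$, and $B_\infty=\varinjlim B_n$. For $\ell\in\mathbb{Z}_{\ge0}$, $w\mapsto w^{\uparrow\ell}$ is the (linearly extended) endomorphism of $B_\infty$ with $\sigma_i\mapsto\sigma_{i+\ell}$. $\beta_{k,l}\in B_{k+l}$ ($k,l\ge0$): $\beta_{k,l}=(\sigma_k\sigma_{k+1}\cdots\sigma_{k+l-1})(\sigma_{k-1}\sigma_k\cdots\sigma_{k+l-2})\cdots(\sigma_1\sigma_2\cdots\sigma_l)$, with $\beta_{k,0}=\beta_{0,l}=1$; in particular $\beta_{k,1}=\sigma_k\cdots\sigma_1$. Braid shuffle elements $S_{m,n}\in\mathfrak{k}B_{m+n}$ (integers $m,n$, $m+n\ge0$): $S_{0,0}=1$; $S_{m,n}=0$ if $m<0$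 or $n<0$; for $m,n\ge0$, $m+n\ge1$, $S_{m,n}=S_{m-1,n}+S_{m,n-1}\beta_{m,1}^{\uparrow n-1}$ (the second term is $0$ when $n=0$). Braid Pochhammer symbols: $P_{k,n}(x,y)=(x-\beta_{k,1}y)(x-\beta_{k+1,1}y)\cdots(x-\beta_{k+n-1,1}y)$, $P_{k,0}=1$; $p_{k,n}:=P_{k,n}(1,q^{-2})$. For $a,b,c\ge0$ with $c\le b$: $A(a,b;c):=q^{1-a-c}\,S_{b-c,c}^{\uparrow a}\,\beta_{a,c}\,p_{a,b-c}^{\uparrow c}\in\mathfrak{k}B_{a+b}$. Local representation: $\rho_{q\hat R}:\mathfrak{k}B_n\to\mathrm{End}(V^{\otimes n})$ is the algebra homomorphism sending $\sigma_i$ to $q\hat R_i$, where $\hat R_i=\mathrm{id}_V^{\otimes(i-1)}\otimes\hat R\otimes\mathrm{id}_V^{\otimes(n-i-1)}$. Definition of $T(\hat R)$: identify $V^{\otimes k}\otimes V^{\otimes l}$ canonically with $V^{\otimes(k+l)}$. For $u\in T(V)\otimes T(V)$ let $u_{(k,l)}$ denote its component in $V^{\otimes k}\otimes V^{\otimes l}$. Then $T(\hat R)$ is the linear operator with $$(T(\hat R)u)_{(b,c)}=\sum_{k=0}^{c}\rho_{q\hat R}\big(A(b,c;k)\big)\,u_{(k,\,b+c-k)}\qquad(b,c\ge0).$$ This is the operator form of the exchange rule $x_{[b]}\,y_{[c]}^{\uparrow b}=\sum_{k=0}^c\rho_{q\hat R}(A(b,c;k))\,y_{[k]}\,x_{[b+c-k]}^{\uparrow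 k}$, where $x_{[m]}$, $y_{[m]}$ denote the components in $V^{\otimes m}$ of tensors $x,y$ and $\uparrow k$ shifts the copies of $V$ in which the tensor lives by $k$. *)

theory Defs
  imports Complex_Main "HOL-Library.Poly_Mapping" "HOL-Library.Function_Algebras"
begin

section \<open>Vector spaces and tensor powers\<close>

text \<open>
  A vector space over the field \<open>'k\<close> is a subspace \<open>carr V\<close> of some type \<open>'v\<close> that is a
  vector space under \<open>smul V\<close> (possibly the whole type).  A carrier is needed because tensor
  powers and tensor algebras depend on \<open>V\<close> and hence are not types.  Operators are total
  functions of which only the restriction to the carrier matters.
\<close>

record ('k, 'v) lspace =
  smul :: "'k \<Rightarrow> 'v \<Rightarrow> 'v"
  carr :: "'v set"

definition vspace :: "('k::field, 'v::ab_group_add) lspace \<Rightarrow> bool" where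
  "vspace V \<longleftrightarrow> vector_space (smul V) \<and> module.subspace (smul V) (carr V)"

definition linear_map ::
  "('k::field, 'v::ab_group_add) lspace \<Rightarrow> ('k, 'w::ab_group_add) lspace \<Rightarrow> ('v \<Rightarrow> 'w) \<Rightarrow> bool" where
  "linear_map V W f \<longleftrightarrow>
     (\<forall>x\<in>carr V. f x \<in> carr W) \<and>
     (\<forall>x\<in>carr V. \<forall>y\<in>carr V. f (x + y) = f x + f y) \<and>
     (\<forall>c. \<forall>x\<in>carr V. f (smul V c x) = smul W c (f x))"

definition words :: "('k, 'v) lspace \<Rightarrow> 'v list set" where
  "words V = lists (carr V)"

definition nwords :: "('k, 'v) lspace \<Rightarrow> nat \<Rightarrow> 'v list set" where
  "nwords V n = {xs \<in> words V. length xs = n}"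

text \<open>
  \<open>D\<close> is \<open>words V\<close> or \<open>nwords V n\<close>; in the first case a multilinear \<open>g\<close> amounts to an
  independent choice of an \<open>n\<close>-linear map for every \<open>n\<close>.
\<close>

definition multilinear ::
  "('k::field, 'v::ab_group_add) lspace \<Rightarrow> 'v list set \<Rightarrow> ('k, 'w::ab_group_add) lspace
    \<Rightarrow> ('v list \<Rightarrow> 'w) \<Rightarrow> bool" where
  "multilinear V D W g \<longleftrightarrow>
     (\<forall>xs\<in>D. g xs \<in> carr W) \<and>
     (\<forall>xs ys. \<forall>x\<in>carr V. \<forall>y\<in>carr V. xs @ x # ys \<in> D \<longrightarrow>
        g (xs @ (x + y) # ys) = g (xs @ x # ys) + g (xs @ y # ys)) \<and>
     (\<forall>c xs ys. \<forall>x\<in>carr V. xs @ x # ys \<in> D \<longrightarrow>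
        g (xs @ smul V c x # ys) = smul W c (g (xs @ x # ys)))"

definition base_field :: "('k::field, 'k) lspace" where
  "base_field = \<lparr>smul = (*), carr = UNIV\<rparr>"

text \<open>
  Model of the tensor product: \<open>pten V [x\<^sub>1, \<dots>, x\<^sub>n]\<close>, that is \<open>x\<^sub>1 \<otimes> \<dots> \<otimes> x\<^sub>n\<close>, is the functional
  evaluating multilinear forms at \<open>(x\<^sub>1, \<dots>, x\<^sub>n)\<close>.  Over a field, multilinear forms separate the
  elements of a tensor power, so the span of these functionals is the usual tensor power; its
  universal property is lemmas \<open>lin_ext_pten\<close> and \<open>linear_map_lin_ext\<close> below.  Since forms of
  different arities are independent of one another, the sum over all \<open>n\<close> of these spans is direct.
\<close>

type_synonym ('k, 'v) ten = "('v list \<Rightarrow> 'k) \<Rightarrow> 'k"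

definition pten :: "('k::field, 'v::ab_group_add) lspace \<Rightarrow> 'v list \<Rightarrow> ('k, 'v) ten" where
  "pten V xs = (\<lambda>\<phi>. if multilinear V (words V) base_field \<phi> then \<phi> xs else 0)"

definition tscale :: "'k::field \<Rightarrow> ('k, 'v) ten \<Rightarrow> ('k, 'v) ten" where
  "tscale c t = (\<lambda>\<phi>. c * t \<phi>)"

definition tspan ::
  "('k::field, 'v::ab_group_add) lspace \<Rightarrow> 'v list set \<Rightarrow> ('k, ('k, 'v) ten) lspace" where
  "tspan V D = \<lparr>smul = tscale, carr = module.span tscale (pten V ` D)\<rparr>"

text \<open>\<open>tpow V n\<close> is the \<open>n\<close>-th tensor power of \<open>V\<close>, and \<open>tens V\<close> is \<open>T(V)\<close>.\<close>

definition tpow ::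
  "('k::field, 'v::ab_group_add) lspace \<Rightarrow> nat \<Rightarrow> ('k, ('k, 'v) ten) lspace" where
  "tpow V n = tspan V (nwords V n)"

definition tens :: "('k::field, 'v::ab_group_add) lspace \<Rightarrow> ('k, ('k, 'v) ten) lspace" where
  "tens V = tspan V (words V)"

text \<open>
  The linear map into \<open>W\<close> sending \<open>pten V xs\<close> to \<open>g xs\<close> for \<open>xs \<in> D\<close>.  The choice of the
  representing sum is immaterial when \<open>g\<close> is multilinear on \<open>D\<close>.
\<close>

definition lin_ext ::
  "('k::field, 'v::ab_group_add) lspace \<Rightarrow> 'v list set \<Rightarrow> ('k, 'w::ab_group_add) lspace
    \<Rightarrow> ('v list \<Rightarrow> 'w) \<Rightarrow> ('k, 'v) ten \<Rightarrow> 'w" where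
  "lin_ext V D W g t =
     (let f = (SOME f :: 'v list \<Rightarrow>\<^sub>0 'k. Poly_Mapping.keys f \<subseteq> D \<and>
                 t = (\<Sum>xs\<in>Poly_Mapping.keys f. tscale (Poly_Mapping.lookup f xs) (pten V xs)))
      in \<Sum>xs\<in>Poly_Mapping.keys f. smul W (Poly_Mapping.lookup f xs) (g xs))"

text \<open>The product of \<open>T(V)\<close>, which identifies \<open>V\<^bsup>\<otimes>k\<^esup> \<otimes> V\<^bsup>\<otimes>l\<^esup>\<close> with \<open>V\<^bsup>\<otimes>(k+l)\<^esup>\<close>.\<close>

definition tmul ::
  "('k::field, 'v::ab_group_add) lspace \<Rightarrow> ('k, 'v) ten \<Rightarrow> ('k, 'v) ten \<Rightarrow> ('k, 'v) ten" where
  "tmul V s t =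
     lin_ext V (words V) (tens V)
       (\<lambda>xs. lin_ext V (words V) (tens V) (\<lambda>ys. pten V (xs @ ys)) t) s"

text \<open>\<open>F \<otimes> G\<close> on \<open>V\<^bsup>\<otimes>(a+b)\<^esup>\<close>, for operators \<open>F\<close> on \<open>V\<^bsup>\<otimes>a\<^esup>\<close> and \<open>G\<close> on \<open>V\<^bsup>\<otimes>b\<^esup>\<close>.\<close>

definition op_tensor ::
  "('k::field, 'v::ab_group_add) lspace \<Rightarrow> nat \<Rightarrow> nat
    \<Rightarrow> (('k, 'v) ten \<Rightarrow> ('k, 'v) ten) \<Rightarrow> (('k, 'v) ten \<Rightarrow> ('k, 'v) ten)
    \<Rightarrow> ('k, 'v) ten \<Rightarrow> ('k, 'v) ten" where
  "op_tensor V a b F G =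
     lin_ext V (nwords V (a + b)) (tens V)
       (\<lambda>xs. tmul V (F (pten V (take a xs))) (G (pten V (drop a xs))))"

text \<open>\<open>f\<^bsup>\<otimes>n\<^esup>\<close>, and \<open>T(f)\<close>, which is \<open>f\<^bsup>\<otimes>n\<^esup>\<close> on \<open>V\<^bsup>\<otimes>n\<^esup>\<close> for every \<open>n\<close>.\<close>

definition tpow_map ::
  "('k::field, 'v::ab_group_add) lspace \<Rightarrow> ('k, 'w::ab_group_add) lspace \<Rightarrow> nat
    \<Rightarrow> ('v \<Rightarrow> 'w) \<Rightarrow> ('k, 'v) ten \<Rightarrow> ('k, 'w) ten" where
  "tpow_map V W n f = lin_ext V (nwords V n) (tpow W n) (\<lambda>xs. pten W (map f xs))"

definition tens_map ::
  "('k::field, 'v::ab_group_add) lspace \<Rightarrow> ('k, 'w::ab_group_add) lspace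
    \<Rightarrow> ('v \<Rightarrow> 'w) \<Rightarrow> ('k, 'v) ten \<Rightarrow> ('k, 'w) ten" where
  "tens_map V W f = lin_ext V (words V) (tens W) (\<lambda>xs. pten W (map f xs))"


section \<open>Braided vector spaces\<close>

definition yang_baxter ::
  "('k::field, 'v::ab_group_add) lspace \<Rightarrow> (('k, 'v) ten \<Rightarrow> ('k, 'v) ten) \<Rightarrow> bool" where
  "yang_baxter V R \<longleftrightarrow>
     (let R1 = op_tensor V 2 1 R id; R2 = op_tensor V 1 2 id R
      in \<forall>u\<in>carr (tpow V 3). R1 (R2 (R1 u)) = R2 (R1 (R2 u)))"

definition braided ::
  "('k::field, 'v::ab_group_add) lspace \<Rightarrow> (('k, 'v) ten \<Rightarrow> ('k, 'v) ten) \<Rightarrow> bool" where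
  "braided V R \<longleftrightarrow>
     vspace V \<and>
     linear_map (tpow V 2) (tpow V 2) R \<and>
     bij_betw R (carr (tpow V 2)) (carr (tpow V 2)) \<and>
     yang_baxter V R"


section \<open>The braid group on infinitely many strands\<close>

text \<open>The letter \<open>(i, True)\<close> stands for \<open>\<sigma>\<^bsub>i+1\<^esub>\<close> and \<open>(i, False)\<close> for its inverse.\<close>

inductive braid_eq :: "(nat \<times> bool) list \<Rightarrow> (nat \<times> bool) list \<Rightarrow> bool" where
  refl: "braid_eq u u"
| sym: "braid_eq u v \<Longrightarrow> braid_eq v u"
| trans: "braid_eq u v \<Longrightarrow> braid_eq v w \<Longrightarrow> braid_eq u w"
| append: "braid_eq u v \<Longrightarrow> braid_eq u' v' \<Longrightarrow> braid_eq (u @ u') (v @ v')"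
| cancel: "braid_eq [(i, b), (i, \<not> b)] []"
| braid: "j = Suc i \<or> i = Suc j \<Longrightarrow>
    braid_eq [(i, True), (j, True), (i, True)] [(j, True), (i, True), (j, True)]"
| comm: "Suc i < j \<or> Suc j < i \<Longrightarrow> braid_eq [(i, True), (j, True)] [(j, True), (i, True)]"

quotient_type braid = "(nat \<times> bool) list" / braid_eq
  morphisms rep_braid braid_of_word
  by (intro equivpI reflpI sympI transpI) (auto intro: braid_eq.intros)

definition inv_word :: "(nat \<times> bool) list \<Rightarrow> (nat \<times> bool) list" where
  "inv_word w = rev (map (\<lambda>(i, b). (i, \<not> b)) w)"

lemma braid_eq_cancel_left: "braid_eq (inv_word w @ w) []"
proof (induction w)
  case Nil
  show ?case by (simp add: inv_word_def braid_eq.refl)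
next
  case (Cons l w)
  obtain i b where l: "l = (i, b)" by (cases l)
  have "braid_eq [(i, \<not> b), (i, \<not> \<not> b)] []" by (rule braid_eq.cancel)
  then have "braid_eq ((inv_word w @ [(i, \<not> b), (i, b)]) @ w) ((inv_word w @ []) @ w)"
    by (intro braid_eq.append braid_eq.refl) auto
  then show ?case
    using Cons.IH braid_eq.trans by (auto simp: inv_word_def l)
qed

lemma braid_eq_inv_word:
  assumes "braid_eq u v" shows "braid_eq (inv_word u) (inv_word v)"
proof -
  have inv_inv: "inv_word (inv_word w) = w" for w
    by (simp add: inv_word_def rev_map o_def case_prod_unfold)
  have 1: "braid_eq (v @ inv_word v) []"
    using braid_eq_cancel_left[of "inv_word v"] by (simp add: inv_inv)
  have "braid_eq (inv_word u @ []) (inv_word u @ (v @ inv_word v))"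
    by (intro braid_eq.append braid_eq.refl braid_eq.sym[OF 1])
  moreover have "braid_eq (inv_word u @ v @ inv_word v) (inv_word u @ u @ inv_word v)"
    by (intro braid_eq.append braid_eq.refl braid_eq.sym[OF assms])
  moreover have "braid_eq ((inv_word u @ u) @ inv_word v) ([] @ inv_word v)"
    by (intro braid_eq.append braid_eq.refl braid_eq_cancel_left)
  ultimately show ?thesis
    by (auto intro: braid_eq.trans)
qed

text \<open>
  The group law is written additively, because the monoid algebra of \<open>HOL-Library.Poly_Mapping\<close>
  is formed over an additively written (not necessarily commutative) monoid.
\<close>

instantiation braid :: group_add
begin

lift_definition zero_braid :: braid is "[]" .

lift_definition plus_braid :: "braid \<Rightarrow> braid \<Rightarrow> braid" is "(@)"
  by (rule braid_eq.append)

lift_definition uminus_braid :: "braid \<Rightarrow> braid" is inv_word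
  by (rule braid_eq_inv_word)

definition minus_braid :: "braid \<Rightarrow> braid \<Rightarrow> braid" where
  "minus_braid a b = a + (- b)"

instance
proof
  fix a b c :: braid
  show "a + b + c = a + (b + c)"
    by transfer (simp add: braid_eq.refl)
  show "0 + a = a"
    by transfer (simp add: braid_eq.refl)
  show "a + 0 = a"
    by transfer (simp add: braid_eq.refl)
  show "- a + a = 0"
    by transfer (rule braid_eq_cancel_left)
  show "a + (- b) = a - b"
    by (simp add: minus_braid_def)
qed

end

type_synonym 'k braid_alg = "braid \<Rightarrow>\<^sub>0 'k"

lift_definition braid_shift :: "nat \<Rightarrow> braid \<Rightarrow> braid" is "\<lambda>l. map (\<lambda>(i, b). (i + l, b))"
proof -
  fix l and u v :: "(nat \<times> bool) list"
  assume "braid_eq u v"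
  then show "braid_eq (map (\<lambda>(i, b). (i + l, b)) u) (map (\<lambda>(i, b). (i + l, b)) v)"
    by induction (auto intro: braid_eq.intros)
qed

definition alg_shift :: "nat \<Rightarrow> 'k::field braid_alg \<Rightarrow> 'k braid_alg" where
  "alg_shift l a = (\<Sum>g\<in>Poly_Mapping.keys a. Poly_Mapping.single (braid_shift l g) (Poly_Mapping.lookup a g))"

definition scalar :: "'k::field \<Rightarrow> 'k braid_alg" where
  "scalar c = Poly_Mapping.single 0 c"

definition sigma :: "nat \<Rightarrow> 'k::field braid_alg" where  \<comment> \<open>only used for \<open>i \<ge> 1\<close>\<close>
  "sigma i = Poly_Mapping.single (braid_of_word [(i - 1, True)]) 1"

definition beta :: "nat \<Rightarrow> nat \<Rightarrow> 'k::field braid_alg" where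
  "beta k l = prod_list (map (\<lambda>j. prod_list (map sigma [j..<j + l])) (rev [1..<Suc k]))"

function shuffle_elt :: "int \<Rightarrow> int \<Rightarrow> 'k::field braid_alg" where
  "shuffle_elt m n =
     (if m < 0 \<or> n < 0 then 0
      else if m = 0 \<and> n = 0 then 1
      else shuffle_elt (m - 1) n + shuffle_elt m (n - 1) * alg_shift (nat (n - 1)) (beta (nat m) 1))"
  by auto
termination by (relation "measure (\<lambda>(m, n). nat (m + n))") auto

declare shuffle_elt.simps [simp del]

definition braid_poch :: "nat \<Rightarrow> nat \<Rightarrow> 'k \<Rightarrow> 'k \<Rightarrow> 'k::field braid_alg" where
  "braid_poch k n x y = prod_list (map (\<lambda>j. scalar x - beta j 1 * scalar y) [k..<k + n])"

definition exch_coeff :: "'k \<Rightarrow> nat \<Rightarrow> nat \<Rightarrow> nat \<Rightarrow> 'k::field braid_alg" where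
  "exch_coeff q a b c =
     scalar (q powi (1 - int a - int c)) * alg_shift a (shuffle_elt (int b - int c) (int c)) *
     beta a c * alg_shift c (braid_poch a (b - c) 1 (q powi (- 2)))"


section \<open>The local representation\<close>

text \<open>\<open>q \<cdot> (id\<^bsup>\<otimes>i\<^esup> \<otimes> R \<otimes> id\<^bsup>\<otimes>(n-i-2)\<^esup>)\<close>, the image of \<open>\<sigma>\<^bsub>i+1\<^esub>\<close>.\<close>

definition sigma_op ::
  "'k \<Rightarrow> ('k::field, 'v::ab_group_add) lspace \<Rightarrow> (('k, 'v) ten \<Rightarrow> ('k, 'v) ten) \<Rightarrow> nat
    \<Rightarrow> nat \<Rightarrow> ('k, 'v) ten \<Rightarrow> ('k, 'v) ten" where
  "sigma_op q V R n i u =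
     tscale q (op_tensor V i (n - i) id (op_tensor V 2 (n - i - 2) R id) u)"

definition letter_op ::
  "'k \<Rightarrow> ('k::field, 'v::ab_group_add) lspace \<Rightarrow> (('k, 'v) ten \<Rightarrow> ('k, 'v) ten) \<Rightarrow> nat
    \<Rightarrow> nat \<times> bool \<Rightarrow> ('k, 'v) ten \<Rightarrow> ('k, 'v) ten" where
  "letter_op q V R n =
     (\<lambda>(i, b). if b then sigma_op q V R n i
               else inv_into (carr (tpow V n)) (sigma_op q V R n i))"

text \<open>\<open>B\<^sub>n\<close> is the subgroup generated by \<open>\<sigma>\<^sub>1, \<dots>, \<sigma>\<^bsub>n-1\<^esub>\<close>, so its elements are given by these words.\<close>

definition strand_words :: "nat \<Rightarrow> (nat \<times> bool) list set" where
  "strand_words n = {w. \<forall>(i, b)\<in>set w. Suc i < n}"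

text \<open>
  The algebra homomorphism from the group algebra of \<open>B\<^sub>n\<close> to the endomorphisms of \<open>V\<^bsup>\<otimes>n\<^esup>\<close>.
  For a braided vector space, words in \<open>strand_words n\<close> that represent the same braid act in
  the same way.
\<close>

definition braid_op ::
  "'k \<Rightarrow> ('k::field, 'v::ab_group_add) lspace \<Rightarrow> (('k, 'v) ten \<Rightarrow> ('k, 'v) ten) \<Rightarrow> nat
    \<Rightarrow> braid \<Rightarrow> ('k, 'v) ten \<Rightarrow> ('k, 'v) ten" where
  "braid_op q V R n g =
     foldr (\<lambda>l F. letter_op q V R n l \<circ> F)
       (SOME w. w \<in> strand_words n \<and> braid_of_word w = g) id"

definition local_rep ::
  "'k \<Rightarrow> ('k::field, 'v::ab_group_add) lspace \<Rightarrow> (('k, 'v) ten \<Rightarrow> ('k, 'v) ten) \<Rightarrow> nat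
    \<Rightarrow> 'k braid_alg \<Rightarrow> ('k, 'v) ten \<Rightarrow> ('k, 'v) ten" where
  "local_rep q V R n a u = (\<Sum>g\<in>Poly_Mapping.keys a. tscale (Poly_Mapping.lookup a g) (braid_op q V R n g u))"


section \<open>The operator \<open>T(R)\<close>\<close>

text \<open>
  \<open>T(V) \<otimes> T(V)\<close> is \<open>tpow (tens V) 2\<close>.  \<open>hom_part V k\<close> is the projection of \<open>T(V)\<close> onto
  \<open>V\<^bsup>\<otimes>k\<^esup>\<close>, \<open>bi_part V k l\<close> is \<open>u \<mapsto> u\<^bsub>(k,l)\<^esub>\<close>, read as an element of \<open>V\<^bsup>\<otimes>(k+l)\<^esup>\<close>, and \<open>bi_incl V b c\<close>
  sends \<open>V\<^bsup>\<otimes>(b+c)\<^esup>\<close> back to the component \<open>(b,c)\<close> of \<open>T(V) \<otimes> T(V)\<close>.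
\<close>

definition hom_part ::
  "('k::field, 'v::ab_group_add) lspace \<Rightarrow> nat \<Rightarrow> ('k, 'v) ten \<Rightarrow> ('k, 'v) ten" where
  "hom_part V k =
     lin_ext V (words V) (tens V) (\<lambda>xs. if length xs = k then pten V xs else 0)"

definition bi_part ::
  "('k::field, 'v::ab_group_add) lspace \<Rightarrow> nat \<Rightarrow> nat \<Rightarrow> ('k, ('k, 'v) ten) ten \<Rightarrow> ('k, 'v) ten" where
  "bi_part V k l =
     lin_ext (tens V) (nwords (tens V) 2) (tens V)
       (\<lambda>xs. tmul V (hom_part V k (xs ! 0)) (hom_part V l (xs ! 1)))"

definition bi_incl ::
  "('k::field, 'v::ab_group_add) lspace \<Rightarrow> nat \<Rightarrow> nat \<Rightarrow> ('k, 'v) ten \<Rightarrow> ('k, ('k, 'v) ten) ten" where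
  "bi_incl V b c =
     lin_ext V (nwords V (b + c)) (tpow (tens V) 2)
       (\<lambda>xs. pten (tens V) [pten V (take b xs), pten V (drop b xs)])"

definition T_op ::
  "'k \<Rightarrow> ('k::field, 'v::ab_group_add) lspace \<Rightarrow> (('k, 'v) ten \<Rightarrow> ('k, 'v) ten)
    \<Rightarrow> ('k, ('k, 'v) ten) ten \<Rightarrow> ('k, ('k, 'v) ten) ten" where
  "T_op q V R u =
     Sum_any (\<lambda>(b, c). bi_incl V b c
       (\<Sum>k\<le>c. local_rep q V R (b + c) (exch_coeff q b c k) (bi_part V k (b + c - k) u)))"


section \<open>The universal property of the tensor powers\<close>

lemma vector_space_tscale: "vector_space (tscale :: 'k::field \<Rightarrow> ('k, 'v) ten \<Rightarrow> _)"
  by unfold_locales (auto simp: tscale_def fun_eq_iff algebra_simps)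

lemma words_exchange:
  assumes "D = words V \<or> D = nwords V n" "x \<in> carr V" "y \<in> carr V"
  shows "xs @ x # ys \<in> D \<longleftrightarrow> xs @ y # ys \<in> D"
  using assms by (auto simp: words_def nwords_def)

lemma sum_fun_apply: "sum f A x = (\<Sum>a\<in>A. f a x)"
  for f :: "'a \<Rightarrow> 'b \<Rightarrow> 'c::comm_monoid_add"
  by (induction A rule: infinite_finite_induct) auto

lemma multilinear_wd:
  fixes V :: "('k::field, 'v::ab_group_add) lspace"
    and W :: "('k, 'w::ab_group_add) lspace"
  assumes V: "vspace V" and W: "vspace W"
    and D: "D = words V \<or> D = nwords V n"
    and g: "multilinear V D W g"
    and X: "X \<subseteq> D"
    and zero: "(\<Sum>xs\<in>X. tscale (c xs) (pten V xs)) = 0"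
  shows "(\<Sum>xs\<in>X. smul W (c xs) (g xs)) = 0"
proof (rule ccontr)
  define w where "w = (\<Sum>xs\<in>X. smul W (c xs) (g xs))"
  assume "(\<Sum>xs\<in>X. smul W (c xs) (g xs)) \<noteq> 0"
  then have "w \<noteq> 0" by (simp add: w_def)
  interpret W: vector_space "smul W" using W by (simp add: vspace_def)
  interpret V: vector_space "smul V" using V by (simp add: vspace_def)
  interpret K: vector_space "(*) :: 'k \<Rightarrow> 'k \<Rightarrow> 'k"
    by unfold_locales (auto simp: algebra_simps)
  interpret WK: vector_space_pair "smul W" "(*) :: 'k \<Rightarrow> 'k \<Rightarrow> 'k" ..
  have "W.independent {w}" using \<open>w \<noteq> 0\<close> by simp
  from WK.linear_independent_extend[OF this, of "\<lambda>_. 1"]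
  obtain h where h: "Vector_Spaces.linear (smul W) (*) h" and hw: "h w = 1" by auto
  interpret h: Vector_Spaces.linear "smul W" "(*)" h by (rule h)
  have sub: "V.subspace (carr V)" using V by (simp add: vspace_def)
  define \<phi> where "\<phi> = (\<lambda>xs. if xs \<in> D then h (g xs) else 0)"
  have \<phi>: "multilinear V (words V) base_field \<phi>"
    unfolding multilinear_def
  proof (intro conjI ballI allI impI)
    fix xs ys x y
    assume x: "x \<in> carr V" and y: "y \<in> carr V" and "xs @ x # ys \<in> words V"
    have "x + y \<in> carr V" using sub x y by (rule V.subspace_add)
    note ex = words_exchange[OF D x y] words_exchange[OF D x this]
    show "\<phi> (xs @ (x + y) # ys) = \<phi> (xs @ x # ys) + \<phi> (xs @ y # ys)"
      using g ex x y unfolding multilinear_def \<phi>_def by (simp add: h.add)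
  next
    fix c xs ys x
    assume x: "x \<in> carr V" and "xs @ x # ys \<in> words V"
    have "smul V c x \<in> carr V" using sub x by (rule V.subspace_scale)
    note ex = words_exchange[OF D x this]
    show "\<phi> (xs @ smul V c x # ys) = smul base_field c (\<phi> (xs @ x # ys))"
      using g ex x unfolding multilinear_def \<phi>_def by (simp add: h.scale base_field_def)
  qed (simp add: base_field_def)
  have "0 = (\<Sum>xs\<in>X. tscale (c xs) (pten V xs)) \<phi>" by (simp add: zero)
  also have "\<dots> = (\<Sum>xs\<in>X. c xs * \<phi> xs)"
    using \<phi> by (simp add: sum_fun_apply tscale_def pten_def)
  also have "\<dots> = (\<Sum>xs\<in>X. c xs * h (g xs))"
    using X by (intro sum.cong) (auto simp: \<phi>_def)
  also have "\<dots> = h w" by (simp add: w_def h.sum h.scale)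
  finally show False using hw by simp
qed

lemma lin_ext_sum:
  fixes V :: "('k::field, 'v::ab_group_add) lspace"
    and W :: "('k, 'w::ab_group_add) lspace"
  assumes V: "vspace V" and W: "vspace W"
    and D: "D = words V \<or> D = nwords V n"
    and g: "multilinear V D W g"
    and X: "finite X" "X \<subseteq> D"
  shows "lin_ext V D W g (\<Sum>xs\<in>X. tscale (c xs) (pten V xs)) = (\<Sum>xs\<in>X. smul W (c xs) (g xs))"
proof -
  interpret W: vector_space "smul W" using W by (simp add: vspace_def)
  interpret T: vector_space "tscale :: 'k \<Rightarrow> ('k, 'v) ten \<Rightarrow> _" by (rule vector_space_tscale)
  define t where "t = (\<Sum>xs\<in>X. tscale (c xs) (pten V xs))"
  define P where "P = (\<lambda>f :: 'v list \<Rightarrow>\<^sub>0 'k. Poly_Mapping.keys f \<subseteq> D \<and>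
    t = (\<Sum>xs\<in>Poly_Mapping.keys f. tscale (Poly_Mapping.lookup f xs) (pten V xs)))"
  have "\<exists>f. P f"
  proof -
    define f where "f = Abs_poly_mapping (\<lambda>xs. if xs \<in> X then c xs else 0)"
    have lk: "Poly_Mapping.lookup f xs = (if xs \<in> X then c xs else 0)" for xs
      unfolding f_def using X by (subst lookup_Abs_poly_mapping) auto
    have ks: "Poly_Mapping.keys f \<subseteq> X" by (auto simp: in_keys_iff lk split: if_splits)
    have "t = (\<Sum>xs\<in>Poly_Mapping.keys f. tscale (Poly_Mapping.lookup f xs) (pten V xs))"
      unfolding t_def using ks X
      by (intro sum.mono_neutral_cong_right) (auto simp: lk in_keys_iff)
    with ks X show ?thesis unfolding P_def by blast
  qed
  then have "P (SOME f. P f)" by (rule someI_ex)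
  then obtain f where f: "f = (SOME f. P f)" and ks: "Poly_Mapping.keys f \<subseteq> D"
    and t: "t = (\<Sum>xs\<in>Poly_Mapping.keys f. tscale (Poly_Mapping.lookup f xs) (pten V xs))"
    unfolding P_def by blast
  let ?l = "Poly_Mapping.lookup f"
  let ?Y = "X \<union> Poly_Mapping.keys f"
  let ?d = "\<lambda>xs. (if xs \<in> X then c xs else 0) - ?l xs"
  have t1: "t = (\<Sum>xs\<in>?Y. tscale (if xs \<in> X then c xs else 0) (pten V xs))"
    unfolding t_def using X by (intro sum.mono_neutral_cong_left) auto
  have t2: "t = (\<Sum>xs\<in>?Y. tscale (?l xs) (pten V xs))"
    unfolding t using X by (intro sum.mono_neutral_cong_left) (auto simp: in_keys_iff)
  have "(\<Sum>xs\<in>?Y. tscale (?d xs) (pten V xs)) = t - t"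
    by (subst t1, subst t2) (simp add: T.scale_left_diff_distrib sum_subtractf)
  then have "(\<Sum>xs\<in>?Y. smul W (?d xs) (g xs)) = 0"
    using X ks by (intro multilinear_wd[OF V W D g]) auto
  then have "(\<Sum>xs\<in>?Y. smul W (?l xs) (g xs)) =
      (\<Sum>xs\<in>?Y. smul W (if xs \<in> X then c xs else 0) (g xs))"
    by (simp add: W.scale_left_diff_distrib sum_subtractf)
  also have "\<dots> = (\<Sum>xs\<in>X. smul W (c xs) (g xs))"
    using X by (intro sum.mono_neutral_cong_right) auto
  also have "(\<Sum>xs\<in>?Y. smul W (?l xs) (g xs)) =
      (\<Sum>xs\<in>Poly_Mapping.keys f. smul W (?l xs) (g xs))"
    using X by (intro sum.mono_neutral_cong_right) (auto simp: in_keys_iff)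
  finally have "(\<Sum>xs\<in>Poly_Mapping.keys f. smul W (?l xs) (g xs)) =
      (\<Sum>xs\<in>X. smul W (c xs) (g xs))" .
  moreover have "lin_ext V D W g t = (\<Sum>xs\<in>Poly_Mapping.keys f. smul W (?l xs) (g xs))"
    unfolding lin_ext_def Let_def f P_def by simp
  ultimately show ?thesis by (simp add: t_def)
qed

lemma tspan_explicit:
  fixes V :: "('k::field, 'v::ab_group_add) lspace"
  assumes "t \<in> carr (tspan V D)"
  obtains X c where "finite X" "X \<subseteq> D" "t = (\<Sum>xs\<in>X. tscale (c xs) (pten V xs))"
proof -
  interpret T: vector_space "tscale :: 'k \<Rightarrow> ('k, 'v) ten \<Rightarrow> _" by (rule vector_space_tscale)
  from assms obtain B r where B: "finite B" "B \<subseteq> pten V ` D" and t: "t = (\<Sum>b\<in>B. tscale (r b) b)"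
    unfolding tspan_def T.span_explicit by auto
  from B obtain X where X: "X \<subseteq> D" "inj_on (pten V) X" "B = pten V ` X"
    by (meson subset_image_inj)
  with B have "finite X" by (simp add: finite_image_iff)
  moreover have "t = (\<Sum>xs\<in>X. tscale (r (pten V xs)) (pten V xs))"
    using X by (simp add: t sum.reindex)
  ultimately show thesis using X that[of X "\<lambda>xs. r (pten V xs)"] by blast
qed

theorem multilinear_pten:
  fixes V :: "('k::field, 'v::ab_group_add) lspace"
  assumes "vspace V" "D = words V \<or> D = nwords V n"
  shows "multilinear V D (tspan V D) (pten V)"
proof -
  interpret T: vector_space "tscale :: 'k \<Rightarrow> ('k, 'v) ten \<Rightarrow> _" by (rule vector_space_tscale)
  have "D \<subseteq> words V" using assms by (auto simp: nwords_def)
  then show ?thesis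
    unfolding multilinear_def[of V D "tspan V D"]
  proof (intro conjI ballI allI impI)
    fix xs assume "xs \<in> D"
    then show "pten V xs \<in> carr (tspan V D)" by (auto simp: tspan_def intro: T.span_base)
  qed (auto simp: tspan_def pten_def tscale_def multilinear_def base_field_def fun_eq_iff)
qed

theorem lin_ext_pten:
  fixes V :: "('k::field, 'v::ab_group_add) lspace"
    and W :: "('k, 'w::ab_group_add) lspace"
  assumes "vspace V" "vspace W" "D = words V \<or> D = nwords V n" "multilinear V D W g" "xs \<in> D"
  shows "lin_ext V D W g (pten V xs) = g xs"
proof -
  interpret W: vector_space "smul W" using assms by (simp add: vspace_def)
  interpret T: vector_space "tscale :: 'k \<Rightarrow> ('k, 'v) ten \<Rightarrow> _" by (rule vector_space_tscale)
  show ?thesis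
    using lin_ext_sum[OF assms(1-4), of "{xs}" "\<lambda>_. 1"] assms(5) by simp
qed

theorem linear_map_lin_ext:
  fixes V :: "('k::field, 'v::ab_group_add) lspace"
    and W :: "('k, 'w::ab_group_add) lspace"
  assumes "vspace V" "vspace W" "D = words V \<or> D = nwords V n" "multilinear V D W g"
  shows "linear_map (tspan V D) W (lin_ext V D W g)"
  unfolding linear_map_def
proof (intro conjI ballI allI)
  interpret W: vector_space "smul W" using assms by (simp add: vspace_def)
  interpret T: vector_space "tscale :: 'k \<Rightarrow> ('k, 'v) ten \<Rightarrow> _" by (rule vector_space_tscale)
  have sub: "W.subspace (carr W)" using assms by (simp add: vspace_def)
  note L = lin_ext_sum[OF assms]
  {
    fix t assume "t \<in> carr (tspan V D)"
    then obtain X c where X: "finite X" "X \<subseteq> D" and t: "t = (\<Sum>xs\<in>X. tscale (c xs) (pten V xs))"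
      by (rule tspan_explicit)
    show "lin_ext V D W g t \<in> carr W"
      unfolding t L[OF X] using X assms(4) sub
      by (intro W.subspace_sum W.subspace_scale) (auto simp: multilinear_def)
    fix a
    have "smul (tspan V D) a t = (\<Sum>xs\<in>X. tscale (a * c xs) (pten V xs))"
      by (simp add: t tspan_def T.scale_sum_right)
    then show "lin_ext V D W g (smul (tspan V D) a t) = smul W a (lin_ext V D W g t)"
      by (simp add: t L[OF X] W.scale_sum_right)
  }
  fix s t assume s_in: "s \<in> carr (tspan V D)" and t_in: "t \<in> carr (tspan V D)"
  from s_in obtain X c where X: "finite X" "X \<subseteq> D"
    and s: "s = (\<Sum>xs\<in>X. tscale (c xs) (pten V xs))"
    by (rule tspan_explicit)
  from t_in obtain Y d where Y: "finite Y" "Y \<subseteq> D"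
    and t: "t = (\<Sum>xs\<in>Y. tscale (d xs) (pten V xs))"
    by (rule tspan_explicit)
  have XY: "finite (X \<union> Y)" "X \<union> Y \<subseteq> D" using X Y by auto
  define c' where "c' xs = (if xs \<in> X then c xs else 0)" for xs
  define d' where "d' xs = (if xs \<in> Y then d xs else 0)" for xs
  have s': "s = (\<Sum>xs\<in>X \<union> Y. tscale (c' xs) (pten V xs))"
    unfolding s using XY by (intro sum.mono_neutral_cong_left) (auto simp: c'_def)
  have t': "t = (\<Sum>xs\<in>X \<union> Y. tscale (d' xs) (pten V xs))"
    unfolding t using XY by (intro sum.mono_neutral_cong_left) (auto simp: d'_def)
  have "s + t = (\<Sum>xs\<in>X \<union> Y. tscale (c' xs + d' xs) (pten V xs))"
    by (simp add: s' t' T.scale_left_distrib sum.distrib)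
  then show "lin_ext V D W g (s + t) = lin_ext V D W g s + lin_ext V D W g t"
    unfolding s' t' by (simp add: L[OF XY] W.scale_left_distrib sum.distrib)
qed

end

theory Submission
  imports Defs
begin

text \<open>
  The operator \<open>T(R)\<close> has the shape of a universal R-matrix.  Write \<open>W\<close> for \<open>T(V)\<close>.  Read from
  right to left, \<open>A(a,b;c)\<close> takes a word of \<open>c\<close> letters followed by one of \<open>a + b - c\<close> letters, lets
  the Pochhammer symbol split the second word into \<open>a\<close> and \<open>b - c\<close> letters (a lowering operator \<open>E\<close>
  on \<open>W\<close>), carries the first word past the \<open>a\<close> letters that stay, and shuffles the \<open>b - c\<close> letters
  onto it (a raising operator).  So \<open>T(R)\<close> is a flip composed with a sum of raising operators on one
  factor times lowering operators on the other.

  On the component \<open>V\<^bsup>\<otimes>i\<^esup> \<otimes> V\<^bsup>\<otimes>j\<^esup> \<otimes> V\<^bsup>\<otimes>l\<^esup>\<close> of \<open>W\<^bsup>\<otimes>3\<^esup>\<close> the operators \<open>T(R)\<^sub>1\<close> and \<open>T(R)\<^sub>2\<close> act by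
  elements of the braid group algebra and their shifts (\<open>T1_tri\<close>, \<open>T2_tri\<close>), so the Yang--Baxter
  equation follows from a family of identities in that algebra, \<open>exch_coeff_ybe\<close>.  Both sides of
  these identities have a normal form (\<open>exch_left_term\<close>, \<open>exch_right_term\<close>), obtained by sliding
  braids through crossings of cables, from associativity of the shuffle product (\<open>merge_assoc\<close>) and
  from \<open>p\<^bsub>a,m+n\<^esub> = p\<^bsub>a,m\<^esub> p\<^bsub>a+m,n\<^esub>\<close>.  The first input word and the Pochhammer symbol of the third one
  then stand outside, in the same way on both sides.

  What remains is \<open>twisted_sum_eq_cut_sum\<close>, a formula for \<open>E\<close> on a shuffle product \<open>j \<cdot> r\<close> of two
  words.  Let \<open>\<Delta>\<close> be deconcatenation, and let \<open>c \<triangleright> F\<close> mean that the word \<open>c\<close> crosses the first part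
  of \<open>F\<close> and is shuffled onto the second one.  A q-binomial identity (\<open>poch_unit\<close>) says that
  \<open>\<Sum> t\<^bsup>|c|\<^esup> c \<triangleright> E(w') = \<Delta>(w)\<close>, summed over all ways to cut \<open>w\<close> into \<open>c\<close> and \<open>w'\<close>, where
  \<open>t = q\<^bsup>-2\<^esup>\<close>.  The term with empty \<open>c\<close> is \<open>E(w)\<close> itself, so this equation determines \<open>E\<close>
  recursively.  Since \<open>\<Delta>\<close> is multiplicative for the shuffle product (\<open>merge_cut\<close>), the sum
  \<open>\<Sum> t\<^bsup>|c|\<^esup> c \<triangleright> E(j \<cdot> r')\<close>, over the cuts of \<open>r\<close> into \<open>c\<close> and \<open>r'\<close> and with \<open>c\<close> carried past \<open>j\<close>
  first, and \<open>E(j) \<Delta>(r)\<close> satisfy the same recursion in \<open>j\<close>: both are turned into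
  \<open>\<Delta>(j) \<Delta>(r)\<close>.  Hence they agree.

  Two points concern the operators.  The local representation chooses a word in the generators of
  \<open>B\<^sub>n\<close>, while equality of braids is tested in the limit group; independence of the choice is shown
  by adding strands that carry a fixed nonzero vector (\<open>act_braid_eq\<close>).  Functoriality holds because
  \<open>T(f)\<close> intertwines every generator and its inverse, hence the whole local representation.
\<close>

section \<open>The braid group algebra\<close>

text \<open>
  Long products in the braid group algebra are kept nested to the right.  The next three lemmas
  turn an identity between short products into one that applies in the middle of a long product.
\<close>

lemma mult_eq_assoc:
  fixes x :: "'a::semigroup_mult"
  assumes "x * y = z * w" shows "x * (y * u) = z * (w * u)"
  using assms by (simp flip: mult.assoc)

lemma mult_eq_assoc1:
  fixes x :: "'a::semigroup_mult"
  assumes "x * y = z" shows "x * (y * u) = z * u"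
  using assms by (simp flip: mult.assoc)

lemma mult_eq_assoc2:
  fixes x :: "'a::semigroup_mult"
  assumes "x = y * z" shows "x * u = y * (z * u)"
  using assms by (simp add: mult.assoc)

lemma braid_shift_add: "braid_shift l (g + h) = braid_shift l g + braid_shift l h"
  by transfer (simp add: braid_eq.refl)

lemma braid_shift_0: "braid_shift 0 g = g"
  by transfer (simp add: braid_eq.refl case_prod_unfold)

lemma braid_shift_zero: "braid_shift l 0 = 0"
  by transfer (simp add: braid_eq.refl)

lemma braid_shift_shift: "braid_shift l (braid_shift m g) = braid_shift (l + m) g"
proof (transfer)
  fix l m :: nat and g :: "(nat \<times> bool) list"
  have "map (\<lambda>(i, b). (i + l, b)) (map (\<lambda>(i, b). (i + m, b)) g) = map (\<lambda>(i, b). (i + (l + m), b)) g"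
    by auto
  then show "braid_eq (map (\<lambda>(i, b). (i + l, b)) (map (\<lambda>(i, b). (i + m, b)) g)) (map (\<lambda>(i, b). (i + (l + m), b)) g)"
    by (simp only: braid_eq.refl)
qed

abbreviation shift :: "nat \<Rightarrow> 'k::field braid_alg \<Rightarrow> 'k braid_alg" where
  "shift \<equiv> alg_shift"

lemma alg_shift_superset:
  assumes "finite X" "Poly_Mapping.keys a \<subseteq> X"
  shows "shift l a = (\<Sum>g\<in>X. Poly_Mapping.single (braid_shift l g) (Poly_Mapping.lookup a g))"
  unfolding alg_shift_def using assms
  by (intro sum.mono_neutral_left) (auto simp: in_keys_iff)

lemma alg_shift_add: "shift l (a + b) = shift l a + shift l b"
proof -
  let ?X = "Poly_Mapping.keys a \<union> Poly_Mapping.keys b"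
  show ?thesis
    using Poly_Mapping.keys_add[of a b]
    by (simp add: alg_shift_superset[of ?X] lookup_add single_add sum.distrib)
qed

lemma alg_shift_single: "shift l (Poly_Mapping.single g c) = Poly_Mapping.single (braid_shift l g) c"
  by (simp add: alg_shift_superset[of "{g}"])

lemma alg_shift_zero [simp]: "shift l 0 = 0"
  by (simp add: alg_shift_def)

lemma alg_shift_sum: "shift l (sum f A) = (\<Sum>x\<in>A. shift l (f x))"
  by (induction A rule: infinite_finite_induct) (auto simp: alg_shift_add)

lemma braid_alg_induct [case_names single sum]:
  fixes P :: "'k::field braid_alg \<Rightarrow> bool"
  assumes "\<And>g c. P (Poly_Mapping.single g c)" "\<And>a b. P a \<Longrightarrow> P b \<Longrightarrow> P (a + b)"
  shows "P a"
proof -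
  have a: "a = (\<Sum>g\<in>Poly_Mapping.keys a. Poly_Mapping.single g (Poly_Mapping.lookup a g))"
    by (rule poly_mapping_eqI) (auto simp: lookup_sum lookup_single when_def in_keys_iff)
  have "P (\<Sum>g\<in>X. Poly_Mapping.single g (f g))" for X f
    by (induction X rule: infinite_finite_induct) (use assms assms(1)[of 0 0] in auto)
  then show ?thesis by (subst a)
qed

lemma alg_shift_mult [simp]: "shift l (a * b) = shift l a * shift l b"
proof (induction a rule: braid_alg_induct)
  case (single g c)
  show ?case
    by (induction b rule: braid_alg_induct)
      (auto simp: alg_shift_single mult_single braid_shift_add alg_shift_add distrib_left)
qed (simp add: alg_shift_add distrib_right)

lemma alg_shift_scalar [simp]: "shift l (scalar c) = scalar c"
  by (simp add: scalar_def alg_shift_single braid_shift_zero)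

lemma scalar_1 [simp]: "scalar 1 = 1"
  by (simp add: scalar_def)

lemma scalar_mult: "scalar (c * d) = scalar c * scalar d"
  by (simp add: scalar_def mult_single)

lemma alg_shift_1 [simp]: "shift l 1 = 1"
  using alg_shift_scalar[of l 1] by simp

lemma alg_shift_minus: "shift l (a - b) = shift l a - shift l b"
  using alg_shift_add[of l "a - b" b] by (simp add: eq_diff_eq)

lemma alg_shift_0 [simp]: "shift 0 a = a"
  by (induction a rule: braid_alg_induct)
    (auto simp: alg_shift_single braid_shift_0 alg_shift_add)

lemma alg_shift_shift [simp]: "shift l (shift m a) = shift (l + m) a"
  by (induction a rule: braid_alg_induct)
    (auto simp: alg_shift_single braid_shift_shift alg_shift_add)

lemma alg_shift_prod_list: "shift l (prod_list xs) = prod_list (map (shift l) xs)"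
  by (induction xs) auto

lemma scalar_commute: "a * scalar c = scalar c * a"
  by (induction a rule: braid_alg_induct)
    (auto simp: scalar_def mult_single algebra_simps)

lemma alg_shift_sigma: "1 \<le> i \<Longrightarrow> shift l (sigma i) = sigma (l + i)"
  unfolding sigma_def alg_shift_single
  by (simp add: braid_shift.abs_eq add.commute)

lemma sigma_braid: "1 \<le> i \<Longrightarrow>
  sigma i * (sigma (Suc i) * sigma i) = sigma (Suc i) * (sigma i * (sigma (Suc i) :: 'k::field braid_alg))"
  using braid_eq.braid[of i "i - 1", folded braid.abs_eq_iff]
  by (simp add: sigma_def mult_single plus_braid.abs_eq)

lemma sigma_commute: "1 \<le> i \<Longrightarrow> Suc i < j \<Longrightarrow>
  sigma j * sigma i = sigma i * (sigma j :: 'k::field braid_alg)"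
  using braid_eq.comm[of "i - 1" "j - 1", folded braid.abs_eq_iff]
  by (simp add: sigma_def mult_single plus_braid.abs_eq less_diff_conv)

text \<open>
  The algebra generated by \<open>\<sigma>\<^sub>1, \<dots>, \<sigma>\<^bsub>n-1\<^esub>\<close> without their inverses.  It contains every element that
  occurs in \<open>T(R)\<close>, and commutation rules for its elements need to be checked on generators only.
\<close>

inductive_set balg :: "nat \<Rightarrow> 'k::field braid_alg set" for n where
  scalar: "scalar c \<in> balg n"
| sigma: "1 \<le> i \<Longrightarrow> i < n \<Longrightarrow> sigma i \<in> balg n"
| add: "a \<in> balg n \<Longrightarrow> b \<in> balg n \<Longrightarrow> a + b \<in> balg n"
| mult: "a \<in> balg n \<Longrightarrow> b \<in> balg n \<Longrightarrow> a * b \<in> balg n"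

lemma balg_0 [simp]: "0 \<in> balg n"
  using balg.scalar[of 0] by (simp add: scalar_def)

lemma balg_1 [simp]: "1 \<in> balg n"
  using balg.scalar[of 1] by simp

lemma balg_minus: "a \<in> balg n \<Longrightarrow> b \<in> balg n \<Longrightarrow> a - b \<in> balg n"
proof -
  assume *: "a \<in> balg n" "b \<in> balg n"
  have "scalar (-1) = (-1 :: 'a braid_alg)"
    by (simp add: scalar_def single_uminus)
  then have "a - b = a + scalar (-1) * b" by simp
  with * show ?thesis by (metis balg.intros(1,3,4))
qed

lemma balg_prod_list: "(\<And>x. x \<in> set xs \<Longrightarrow> x \<in> balg n) \<Longrightarrow> prod_list xs \<in> balg n"
  by (induction xs) (auto intro: balg.mult)

lemma balg_mono: "a \<in> balg n \<Longrightarrow> n \<le> m \<Longrightarrow> a \<in> balg m"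
  by (induction rule: balg.induct) (auto intro: balg.intros)

lemma balg_shift: "a \<in> balg n \<Longrightarrow> l + n \<le> m \<Longrightarrow> shift l a \<in> balg m"
  by (induction rule: balg.induct) (auto simp: alg_shift_add alg_shift_sigma intro: balg.intros)

lemma balg_intertwine:
  assumes "a \<in> balg n" and "\<And>i. 1 \<le> i \<Longrightarrow> i < n \<Longrightarrow> u * shift k (sigma i) = shift l (sigma i) * u"
  shows "u * shift k a = shift l a * u"
  using assms(1)
proof induction
  case (mult a b)
  then show ?case by (simp add: mult_eq_assoc[OF mult.IH(1)] mult.assoc)
qed (use assms(2) in \<open>auto simp: scalar_commute[of u] alg_shift_add distrib_left distrib_right\<close>)

lemma balg_far_commute:
  assumes "a \<in> balg n" "b \<in> balg m" "n \<le> l"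
  shows "a * shift l b = shift l b * a"
  using assms(2)
proof induction
  case (sigma i)
  have "sigma (l + i) * shift 0 a = shift 0 a * sigma (l + i)"
    using assms sigma by (intro balg_intertwine[OF assms(1)]) (auto intro: sigma_commute)
  with sigma show ?case by (simp add: alg_shift_sigma)
next
  case (mult c d)
  then show ?case by (simp add: mult_eq_assoc[OF mult.IH(1)] mult.assoc)
qed (auto simp: scalar_commute[of a] alg_shift_add distrib_left distrib_right)

section \<open>Crossings of two cables\<close>

lemma beta_0_left [simp]: "beta 0 l = 1"
  by (simp add: beta_def)

lemma beta_0_right [simp]: "beta k 0 = 1"
  by (induction k) (simp_all add: beta_def)

lemma beta_1_left: "beta 1 l = prod_list (map sigma [1..<Suc l])"
  by (simp add: beta_def)

lemma alg_shift_row: "shift k (prod_list (map sigma [1..<Suc l])) = prod_list (map sigma [Suc k..<Suc (k + l)])"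
proof -
  have "map (shift k) (map sigma [1..<Suc l]) = map sigma [Suc k..<Suc (k + l)]"
    by (rule nth_equalityI) (auto simp: alg_shift_sigma simp del: upt_Suc)
  then show ?thesis unfolding alg_shift_prod_list by (rule arg_cong)
qed

lemma beta_Suc_left: "beta (Suc k) l = shift k (beta 1 l) * beta k l"
  unfolding beta_1_left alg_shift_row by (simp add: beta_def upt_rec[of 1] del: upt_Suc) (simp)

lemma beta_1_Suc: "beta 1 (Suc l) = beta 1 l * sigma (Suc l)"
  unfolding beta_1_left by simp

lemma beta_balg: "beta k l \<in> balg (k + l)"
  unfolding beta_def
  by (rule balg_prod_list) (auto intro!: balg_prod_list balg.sigma simp del: upt_Suc)

text \<open>
  \<open>beta k l\<close> carries a cable of \<open>l\<close> strands past a cable of \<open>k\<close> strands, so that \<open>(l|k)\<close> becomes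
  \<open>(k|l)\<close>.  If either cable is divided into two, the crossing can be made in two steps; this and
  \<open>beta_add_right\<close> are the two hexagon identities.
\<close>

lemma beta_add_left: "beta (k + k') l = shift k (beta k' l) * beta k l"
proof (induction k')
  case (Suc k')
  then show ?case
    using beta_Suc_left[of "k + k'" l] by (simp add: beta_Suc_left mult.assoc del: One_nat_def)
qed simp

lemma beta_1_add: "beta 1 (l + l') = beta 1 l * shift l (beta 1 l')"
  by (induction l') (simp_all add: beta_1_Suc alg_shift_sigma mult.assoc del: One_nat_def)

lemma beta_add_right: "beta k (l + l') = beta k l * shift l (beta k l')"
proof (induction k)
  case (Suc k)
  have *: "shift (k + l) (beta 1 l') * beta k l = beta k l * shift (k + l) (beta 1 l')"
    by (rule balg_far_commute[OF beta_balg beta_balg le_refl, symmetric])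
  show ?case
    unfolding beta_Suc_left[of k] beta_1_add Suc alg_shift_mult alg_shift_shift mult.assoc
      mult_eq_assoc[OF *] by (simp add: add.commute)
qed simp

lemma beta_nat_right_1:
  assumes "1 \<le> i" "i < l" shows "beta 1 l * sigma i = sigma (Suc i) * (beta 1 l :: 'k::field braid_alg)"
  using assms(2)
proof (induction l)
  case (Suc l)
  show ?case
  proof (cases "i = l")
    case True
    then obtain m where l: "l = Suc m" using assms by (cases l) auto
    have sh: "shift (Suc m) (sigma 1) = (sigma (Suc l) :: 'k braid_alg)"
      using alg_shift_sigma[of 1 "Suc m", where ?'a = 'k] by (simp add: l)
    have "beta 1 (Suc l) * sigma i = beta 1 m * (sigma l * (sigma (Suc l) * (sigma l :: 'k braid_alg)))"
      by (simp add: beta_1_Suc True l mult.assoc del: One_nat_def)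
    also have "\<dots> = beta 1 m * (shift (Suc m) (sigma 1) * (sigma l * sigma (Suc l)))"
      unfolding sh using l by (simp add: sigma_braid)
    also have "\<dots> = shift (Suc m) (sigma 1) * beta 1 m * (sigma l * sigma (Suc l))"
      using balg_far_commute[OF beta_balg[of 1 m] balg.sigma[of 1 2], of "Suc m"]
      unfolding mult.assoc Suc_eq_plus1_left by (intro mult_eq_assoc) simp
    finally show ?thesis unfolding sh by (simp add: True beta_1_Suc l mult.assoc del: One_nat_def)
  next
    case False
    with Suc assms have "beta 1 l * sigma i = sigma (Suc i) * (beta 1 l :: 'k braid_alg)" by simp
    moreover have "sigma (Suc l) * sigma i = sigma i * (sigma (Suc l) :: 'k braid_alg)"
      using False assms Suc by (intro sigma_commute) auto
    ultimately show ?thesis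
      by (simp add: beta_1_Suc mult.assoc del: One_nat_def) (simp flip: mult.assoc)
  qed
qed simp

lemma beta_nat_left_1:
  assumes "1 \<le> i" "i < k" shows "beta k 1 * sigma (Suc i) = sigma i * (beta k 1 :: 'k::field braid_alg)"
  using assms(2)
proof (induction k)
  case (Suc k)
  have b1: "beta (Suc k) 1 = sigma (Suc k) * (beta k 1 :: 'k braid_alg)" for k
    using beta_1_Suc[of 0, where ?'a = 'k] by (simp add: beta_Suc_left[of k "Suc 0"] alg_shift_sigma)
  show ?case
  proof (cases "i = k")
    case True
    then obtain m where l: "k = Suc m" using assms by (cases k) auto
    have *: "beta m 1 * sigma (Suc k) = sigma (Suc k) * (beta m 1 :: 'k braid_alg)"
      using balg_far_commute[OF beta_balg[of m 1], of "sigma 1" 2 "Suc m"]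
      by (simp add: balg.sigma l alg_shift_sigma)
    have "beta (Suc k) 1 * sigma (Suc i) = sigma (Suc k) * (sigma k * sigma (Suc k)) * (beta m 1 :: 'k braid_alg)"
      by (simp add: b1 True l mult.assoc del: One_nat_def)
       (simp add: *[unfolded l] mult.assoc del: One_nat_def)
    also have "\<dots> = sigma k * (sigma (Suc k) * sigma k) * beta m 1"
      using l by (simp add: sigma_braid)
    finally show ?thesis by (simp add: True l b1 mult.assoc del: One_nat_def)
  next
    case False
    with Suc assms have "beta k 1 * sigma (Suc i) = sigma i * (beta k 1 :: 'k braid_alg)" by simp
    moreover have "sigma (Suc k) * sigma i = sigma i * (sigma (Suc k) :: 'k braid_alg)"
      using False assms Suc by (intro sigma_commute) auto
    ultimately show ?thesis
      by (simp add: b1 mult.assoc del: One_nat_def) (simp flip: mult.assoc)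
  qed
qed simp

text \<open>
  Naturality of the crossing: a braid on the cable of \<open>l\<close> strands may be applied before or after that
  cable passes the other one.
\<close>

lemma beta_natural_right:
  assumes "a \<in> balg l" shows "beta k l * a = shift k a * beta k l"
proof -
  have 1: "beta 1 l * shift 0 b = shift 1 b * beta 1 l" if "b \<in> balg l" for b
    using that by (rule balg_intertwine) (auto simp: beta_nat_right_1[simplified] alg_shift_sigma)
  show ?thesis
  proof (induction k)
    case (Suc k)
    have "beta (Suc k) l * a = shift k (beta 1 l * a) * beta k l"
      by (simp add: beta_Suc_left[of k] mult.assoc Suc del: One_nat_def)
    also have "\<dots> = shift (Suc k) a * beta (Suc k) l"
      using 1[OF assms] by (simp add: beta_Suc_left[of k] mult.assoc)
    finally show ?case .
  qed simp
qed

lemma beta_natural_left: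
  assumes "a \<in> balg k" shows "beta k l * shift l a = a * beta k l"
proof (induction l)
  case (Suc l)
  have 1: "beta k 1 * shift 1 b = shift 0 b * beta k 1" if "b \<in> balg k" for b
    using that by (rule balg_intertwine) (auto simp: beta_nat_left_1[simplified] alg_shift_sigma)
  have b: "beta k (Suc l) = beta k l * shift l (beta k 1)"
    using beta_add_right[of k l 1] by simp
  have "beta k (Suc l) * shift (Suc l) a = beta k l * shift l (beta k 1 * shift 1 a)"
    by (simp add: b mult.assoc)
  also have "\<dots> = a * beta k (Suc l)"
    using Suc unfolding 1[OF assms] by (simp add: b) (simp flip: mult.assoc)
  finally show ?case .
qed simp

section \<open>Shuffle elements and Pochhammer symbols\<close>

text \<open>
  \<open>merge x y\<close> is the shuffle product \<open>V\<^bsup>\<otimes>x\<^esup> \<otimes> V\<^bsup>\<otimes>y\<^esup> \<rightarrow> V\<^bsup>\<otimes>(x+y)\<^esup>\<close>.  Its arguments are those of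
  \<open>S\<^bsub>y,x\<^esub>\<close> in the order in which the two words stand.
\<close>

definition merge :: "nat \<Rightarrow> nat \<Rightarrow> 'k::field braid_alg" where
  "merge x y = shuffle_elt (int y) (int x)"

lemma merge_0_left [simp]: "merge 0 y = 1"
proof (induction y)
  case (Suc y)
  then show ?case
    by (simp add: merge_def shuffle_elt.simps[of "1 + int y"] shuffle_elt.simps[of _ "- 1"])
qed (simp add: merge_def shuffle_elt.simps)

lemma merge_0_right [simp]: "merge x 0 = 1"
proof (induction x)
  case (Suc x)
  then show ?case
    by (simp add: merge_def shuffle_elt.simps[of _ "1 + int x"] shuffle_elt.simps[of "- 1"])
qed simp

text \<open>
  The last letter of a shuffle is the last letter of the second or of the first word; in the latter
  case it has to pass the whole second word.
\<close>

lemma merge_Suc: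
  "merge (Suc x) (Suc y) = merge (Suc x) y + merge x (Suc y) * shift x (beta (Suc y) 1)"
proof -
  have "nat (1 + int y) = Suc y" by simp
  then show ?thesis
    by (simp add: merge_def shuffle_elt.simps[of "1 + int y" "1 + int x"])
qed

lemma merge_balg: "(merge x y :: 'k::field braid_alg) \<in> balg (x + y)"
proof (induction "x + y" arbitrary: x y rule: less_induct)
  case less
  show ?case
  proof (cases "x = 0 \<or> y = 0")
    case False
    then obtain x' y' where xy: "x = Suc x'" "y = Suc y'" by (meson not0_implies_Suc)
    have "(merge x y' :: 'k braid_alg) \<in> balg (x + y)" "(merge x' y :: 'k braid_alg) \<in> balg (x + y)"
      using less[of x y'] less[of x' y] by (auto simp: xy intro: balg_mono[of _ "Suc (x' + y')"])
    moreover have "shift x' (beta y 1) \<in> (balg (x + y) :: 'k braid_alg set)"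
      by (rule balg_shift[OF beta_balg]) (simp add: xy)
    ultimately show ?thesis unfolding xy merge_Suc by (intro balg.add balg.mult)
  qed auto
qed

abbreviation poch :: "nat \<Rightarrow> nat \<Rightarrow> 'k \<Rightarrow> 'k::field braid_alg" where
  "poch s n t \<equiv> braid_poch s n 1 t"

lemma braid_poch_0 [simp]: "braid_poch s 0 x y = 1"
  by (simp add: braid_poch_def)

lemma braid_poch_add: "braid_poch s (m + n) x y = braid_poch s m x y * braid_poch (s + m) n x y"
proof -
  have "[s..<s + (m + n)] = [s..<s + m] @ [s + m..<s + m + n]"
    by (metis add.assoc le_add1 upt_add_eq_append)
  then show ?thesis by (simp add: braid_poch_def)
qed

lemma braid_poch_Suc:
  "poch s (Suc n) t = poch s n t - scalar t * (poch s n t * beta (s + n) 1)"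
  using braid_poch_add[of s n 1 1 t] scalar_commute[of "poch s n t * beta (s + n) 1" t]
  by (simp add: braid_poch_def right_diff_distrib mult.assoc)

lemma braid_poch_balg: "braid_poch s n x y \<in> balg (s + n)"
  unfolding braid_poch_def
  by (rule balg_prod_list)
    (auto intro!: balg_minus balg.mult balg.scalar intro: balg_mono[OF beta_balg])

text \<open>
  Both sides are sums over the word that contributes the last letter, and the summands agree by
  induction.
\<close>

lemma merge_assoc:
  "merge (x + y) z * merge x y = merge x (y + z) * shift x (merge y z :: 'k::field braid_alg)"
proof (induction "x + y + z" arbitrary: x y z rule: less_induct)
  case less
  show ?case
  proof (cases "x = 0 \<or> y = 0 \<or> z = 0")
    case False
    then obtain x' y' z' where xyz: "x = Suc x'" "y = Suc y'" "z = Suc z'"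
      by (meson not0_implies_Suc)
    let ?w = "x' + y"
    let ?b = "shift ?w (beta z 1) :: 'k braid_alg"
    have eq: "?w = x + y'" by (simp add: xyz)
    have 1: "?b * merge x y' = merge x y' * ?b"
      by (rule balg_far_commute[OF merge_balg beta_balg, symmetric]) (simp add: eq)
    have 2: "?b * merge x' y = merge x' y * ?b"
      by (rule balg_far_commute[OF merge_balg beta_balg, symmetric]) simp
    have 3: "?b * shift x' (beta y 1) = shift x' (beta (y + z) 1)"
      by (simp add: beta_add_left)
    have 4: "shift x' (beta (y + z) 1) * shift x (merge y z) =
        shift x' (merge y z) * shift x' (beta (y + z) 1 :: 'k braid_alg)"
      using arg_cong[OF beta_natural_left[OF merge_balg[of y z], of 1], of "shift x'"]
      by (simp add: xyz)
    have "merge (x + y) z * merge x y = merge (x + y) z' * merge x y + merge ?w z * (?b * merge x y)"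
      using merge_Suc[of "x' + y" z', where ?'a = 'k] by (simp add: xyz algebra_simps)
    also have "?b * merge x y = merge x y' * ?b + merge x' y * (?b * shift x' (beta y 1))"
      unfolding xyz merge_Suc[of x' y'] distrib_left
      unfolding xyz[symmetric] mult_eq_assoc[OF 2] 1 ..
    also have "merge (x + y) z' * merge x y = merge x (y + z') * shift x (merge y z' :: 'k braid_alg)"
      using less[of x y z'] by (simp add: xyz)
    also have "merge ?w z * (merge x y' * ?b + merge x' y * (?b * shift x' (beta y 1))) =
        merge x (y' + z) * (shift x (merge y' z) * ?b) +
        merge x' (y + z) * (shift x' (merge y z) * shift x' (beta (y + z) 1))"
      using less[of x y' z] less[of x' y z] unfolding 3
      by (simp add: xyz distrib_left) (simp flip: mult.assoc)
    also have "merge x (y + z') * shift x (merge y z') +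
        (merge x (y' + z) * (shift x (merge y' z) * ?b) +
         merge x' (y + z) * (shift x' (merge y z) * shift x' (beta (y + z) 1))) =
        merge x (y + z) * shift x (merge y z)"
      using merge_Suc[of x' "y + z'", where ?'a = 'k] merge_Suc[of y' z', where ?'a = 'k] unfolding 4[symmetric]
      by (simp add: xyz alg_shift_add algebra_simps)
    finally show ?thesis .
  qed auto
qed

text \<open>
  The possible numbers of letters that a word of length \<open>j\<close> contributes to the first \<open>s\<close> letters of its
  shuffles with a word of length \<open>r\<close>.
\<close>

definition cuts :: "nat \<Rightarrow> nat \<Rightarrow> nat \<Rightarrow> nat set" where
  "cuts j r s = {i. i \<le> j \<and> i \<le> s \<and> s \<le> i + r}"

lemma finite_cuts [simp]: "finite (cuts j r s)"
  by (rule finite_subset[of _ "{..j}"]) (auto simp: cuts_def)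

text \<open>
  A letter that first passes \<open>r1 + r2\<close> letters, after which the \<open>j2\<close> letters in front of it pass the
  first \<open>r1\<close> of these, may as well pass those \<open>r1\<close> together with the \<open>j2\<close> letters and the other \<open>r2\<close>
  afterwards.
\<close>

lemma beta_row_swap:
  fixes r1 r2 :: nat
  shows "shift j1 (beta r1 j2) * shift (j1 + j2) (beta (r1 + r2) 1) =
   shift (j1 + r1 + j2) (beta r2 1) * (shift j1 (beta r1 (Suc j2)) :: 'k::field braid_alg)"
proof -
  have *: "beta r1 j2 * shift (r1 + j2) (beta r2 1) =
      shift (r1 + j2) (beta r2 1) * (beta r1 j2 :: 'k braid_alg)"
    by (rule balg_far_commute[OF beta_balg beta_balg]) simp
  have "beta r1 j2 * shift j2 (beta (r1 + r2) 1) =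
      shift (r1 + j2) (beta r2 1) * (beta r1 (j2 + 1) :: 'k braid_alg)"
    unfolding beta_add_left beta_add_right alg_shift_mult alg_shift_shift add.commute[of j2 r1]
      mult_eq_assoc[OF *] ..
  from arg_cong[OF this, of "shift j1"] show ?thesis by (simp add: add_ac)
qed

text \<open>
  Deconcatenation is multiplicative for the shuffle product: the first \<open>s\<close> letters of a shuffle are a
  shuffle of an initial piece of each word, and the rest is a shuffle of the two final pieces.  The
  recursion \<open>merge_Suc\<close> is the case of a cut just before the last letter; applied to the whole word and
  to the part after the cut it gives the general case by induction on the length.
\<close>

lemma merge_cut:
  "s \<le> j + r \<Longrightarrow> (merge j r :: 'k::field braid_alg) = (\<Sum>i\<in>cuts j r s. merge i (s - i) *
     shift s (merge (j - i) (i + r - s)) * shift i (beta (s - i) (j - i)))"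
proof (induction "j + r" arbitrary: j r rule: less_induct)
  case less
  define M :: "nat \<Rightarrow> nat \<Rightarrow> nat \<Rightarrow> 'k braid_alg" where "M j r i = merge i (s - i) * shift s (merge (j - i) (i + r - s)) *
    shift i (beta (s - i) (j - i))" for j r i
  have "merge j r = (\<Sum>i\<in>cuts j r s. M j r i)"
  proof -
    consider "s = j + r" | "r = 0" | "j = 0" | "s < j + r" "r > 0" "j > 0" using less.prems by linarith
    then show ?thesis
    proof cases
      case 1
      then have "cuts j r s = {j}" by (auto simp: cuts_def)
      then show ?thesis by (simp add: M_def 1)
    next
      case 2
      then have "cuts j r s = {s}" using less.prems by (auto simp: cuts_def)
      then show ?thesis by (simp add: M_def 2)
    next
      case 3
      then have "cuts j r s = {0}" using less.prems by (auto simp: cuts_def)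
      then show ?thesis by (simp add: M_def 3)
    next
      case 4
      then obtain j' r' where jr: "j = Suc j'" "r = Suc r'" by (meson gr0_implies_Suc)
      define X :: "'k braid_alg" where "X = shift j' (beta r 1)"
      have M: "M j r i = (if i \<in> cuts j r' s then M j r' i else 0) +
                  (if i \<in> cuts j' r s then M j' r i * X else 0)" if i: "i \<in> cuts j r s" for i
      proof -
        from i have i: "i \<le> j" "i \<le> s" "s \<le> i + r" by (auto simp: cuts_def)
        define r1 where "r1 = s - i"
        have swap: "shift i (beta r1 (j' - i)) * X =
            shift (s + (j' - i)) (beta (i + r - s) 1) * shift i (beta r1 (j - i))" if "i \<le> j'"
          using beta_row_swap[of i r1 "j' - i" "i + r - s"] that i
          by (simp add: X_def r1_def jr Suc_diff_le)
        consider "i = j" | "s = i + r" "i \<le> j'" | "i \<le> j'" "s \<le> i + r'"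
          using i jr by linarith
        then show ?thesis
        proof cases
          case 1
          then show ?thesis using 4 i by (auto simp: cuts_def M_def jr)
        next
          case 2
          then have "M j' r i * X = merge i r1 * (shift i (beta r1 (j' - i)) * X)"
            by (simp add: M_def r1_def mult.assoc)
          also have "\<dots> = M j r i" unfolding swap[OF 2(2)] using 2 by (simp add: M_def r1_def)
          finally show ?thesis using 2 by (simp add: cuts_def jr)
        next
          case 3
          define j2 r2 where "j2 = j' - i" and "r2 = i + r' - s"
          have eqs: "j - i = Suc j2" "i + r - s = Suc r2" "j' - i = j2" "i + r' - s = r2"
            using 3 by (auto simp: jr j2_def r2_def)
          have "M j' r i * X = merge i r1 * (shift s (merge j2 (Suc r2)) *
              (shift i (beta r1 (j' - i)) * X))"
            by (simp add: M_def r1_def[symmetric] eqs mult.assoc)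
          also have "\<dots> = merge i r1 * (shift s (merge j2 (Suc r2) * shift j2 (beta (Suc r2) 1)) *
              shift i (beta r1 (Suc j2)))"
            unfolding swap[OF 3(1)] by (simp add: eqs mult.assoc)
          finally have "M j r' i + M j' r i * X = M j r i"
            by (simp add: M_def r1_def[symmetric] eqs merge_Suc[of j2 r2] alg_shift_add algebra_simps)
          then show ?thesis using 3 i by (simp add: cuts_def jr)
        qed
      qed
      have sub: "cuts j r' s \<subseteq> cuts j r s" "cuts j' r s \<subseteq> cuts j r s" by (auto simp: cuts_def jr)
      have "merge j r = merge j r' + merge j' r * X" by (simp add: jr merge_Suc[of j' r'] X_def)
      also have "\<dots> = (\<Sum>i\<in>cuts j r' s. M j r' i) + (\<Sum>i\<in>cuts j' r s. M j' r i * X)"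
        using less.hyps[of j r'] less.hyps[of j' r] 4 by (simp add: jr M_def sum_distrib_right)
      also have "\<dots> = (\<Sum>i\<in>cuts j r s. M j r i)"
        using sub by (simp add: M sum.distrib sum.inter_restrict[symmetric] Int_absorb1)
      finally show ?thesis .
    qed
  qed
  then show ?case by (simp add: M_def)
qed

text \<open>
  The q-binomial identity of the introduction, \<open>\<Sum> t\<^bsup>|c|\<^esup> c \<triangleright> E(w') = \<Delta>(w)\<close> for a word \<open>w\<close> of \<open>s + n\<close>
  letters that is cut after \<open>s\<close> letters.  Passing from \<open>n\<close> to \<open>n + 1\<close>, the last factor of the
  Pochhammer symbol contributes \<open>- B c\<close> to the term of index \<open>c\<close> and the second summand of the
  shuffle recursion contributes \<open>B (c - 1)\<close>; weighted by powers of \<open>t\<close>, these cancel in the sum.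
\<close>

lemma poch_unit:
  "(\<Sum>c\<le>n. scalar (t ^ c) * (shift s (merge c (n - c)) * beta s c *
      shift c (poch s (n - c) t))) = (1 :: 'k::field braid_alg)"
proof (induction n)
  case (Suc n)
  define T :: "nat \<Rightarrow> nat \<Rightarrow> 'k braid_alg" where
    "T n c = shift s (merge c (n - c)) * beta s c * shift c (poch s (n - c) t)" for n c
  define B where "B c = T n c * shift c (beta (s + (n - c)) 1)" for c
  \<comment> \<open>the contribution of \<open>merge c (n - c)\<close>, the first summand of \<open>merge c (Suc n - c)\<close>\<close>
  have first: "shift s (merge c (n - c)) * beta s c * shift c (braid_poch s (Suc (n - c)) 1 t) =
      T n c - scalar t * B c" for c
    using scalar_commute[of "shift s (merge c (n - c)) * beta s c" t]
    by (simp add: T_def B_def braid_poch_Suc alg_shift_minus right_diff_distrib mult.assoc)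
      (simp add: mult.assoc[symmetric])
  \<comment> \<open>the contribution of the second summand of \<open>merge (Suc c) (n - c)\<close>\<close>
  have second: "shift s (merge c (n - c) * shift c (beta (n - c) 1)) * beta s (Suc c) *
      shift (Suc c) (poch s (n - c) t) = B c" if "c \<le> n" for c
  proof -
    let ?p = "poch s (n - c) t :: 'k braid_alg"
    have 1: "shift (s + c) (beta (n - c) 1) * beta s c = (beta s c :: 'k braid_alg) * shift (s + c) (beta (n - c) 1)"
      by (rule balg_far_commute[OF beta_balg beta_balg, symmetric]) simp
    have 2: "shift (s + c) (beta (n - c) 1) * shift c (beta s 1) = (shift c :: _ \<Rightarrow> 'k braid_alg) (beta (s + (n - c)) 1)"
      by (simp add: beta_add_left add.commute)
    have 3: "shift c (beta (s + (n - c)) 1) * shift (Suc c) ?p = shift c ?p * shift c (beta (s + (n - c)) 1)"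
      using arg_cong[OF beta_natural_left[OF braid_poch_balg[of s "n - c" 1 t], of 1], of "shift c"] by simp
    have b: "beta s (Suc c) = (beta s c :: 'k braid_alg) * shift c (beta s 1)" using beta_add_right[of s c 1] by simp
    have "shift s (merge c (n - c) * shift c (beta (n - c) 1)) * beta s (Suc c) * shift (Suc c) ?p
      = shift s (merge c (n - c)) * (beta s c * ((shift (s + c) (beta (n - c) 1) * shift c (beta s 1)) * shift (Suc c) ?p))"
      by (simp add: b mult.assoc mult_eq_assoc[OF 1] del: One_nat_def)
    also have "\<dots> = B c" unfolding 2 3 by (simp add: B_def T_def mult.assoc)
    finally show ?thesis .
  qed
  have T: "T (Suc n) c = (if c \<le> n then T n c - scalar t * B c else 0) + (if c = 0 then 0 else B (c - 1))"
    if "c \<le> Suc n" for c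
  proof (cases c)
    case 0
    then show ?thesis using first[of 0] by (simp add: T_def)
  next
    case (Suc c')
    show ?thesis
    proof (cases "c \<le> n")
      case True
      then have "n - c' = Suc (n - c)" "Suc n - c = Suc (n - c)" using Suc by auto
      then show ?thesis using first[of c] second[of c'] True Suc
        by (simp add: T_def merge_Suc alg_shift_add distrib_right)
    next
      case False
      then have "c' = n" using that Suc by simp
      then show ?thesis using second[of n] by (simp add: T_def Suc)
    qed
  qed
  have "(\<Sum>c\<le>Suc n. scalar (t ^ c) * T (Suc n) c) =
      (\<Sum>c\<le>Suc n. if c \<le> n then scalar (t ^ c) * T n c - scalar (t ^ Suc c) * B c else 0) +
      (\<Sum>c\<le>Suc n. if c = 0 then 0 else scalar (t ^ c) * B (c - 1))"
    unfolding sum.distrib[symmetric]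
    by (intro sum.cong) (auto simp: T algebra_simps scalar_mult[symmetric] simp flip: mult.assoc)
  also have "(\<Sum>c\<le>Suc n. if c = 0 then 0 else scalar (t ^ c) * B (c - 1)) = (\<Sum>c\<le>n. scalar (t ^ Suc c) * B c)"
    unfolding sum.atMost_Suc_shift by simp
  finally show ?case using Suc by (simp add: T_def sum_subtractf)
qed simp

lemma scalar_left_commute: "a * (scalar c * b) = scalar c * (a * b)"
  by (simp add: scalar_commute[of a] flip: mult.assoc)

section \<open>Splitting a shuffle product\<close>

text \<open>
  The two sides of the formula for \<open>E\<close> on a product of a word of \<open>j\<close> and a word of \<open>r\<close> letters, in the
  component whose first part has \<open>s\<close> letters.  In \<open>twisted_sum\<close>, the first \<open>i\<close> letters of the second
  word pass the first word, the product of what is left is split by a Pochhammer symbol, and the \<open>i\<close>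
  letters are shuffled onto the second part.  In \<open>cut_sum\<close>, the first word is split by a Pochhammer
  symbol, the second one is cut, and corresponding parts are multiplied.
\<close>

definition twisted_sum :: "'k::field \<Rightarrow> nat \<Rightarrow> nat \<Rightarrow> nat \<Rightarrow> 'k braid_alg" where
  "twisted_sum t j r s = (\<Sum>i\<le>min r (j + r - s). scalar (t ^ i) *
     (shift s (merge i (j + r - s - i)) * beta s i *
      shift i (poch s (j + r - s - i) t * merge j (r - i)) * beta i j))"

definition cut_sum :: "'k::field \<Rightarrow> nat \<Rightarrow> nat \<Rightarrow> nat \<Rightarrow> 'k braid_alg" where
  "cut_sum t j r s = (\<Sum>i\<in>cuts j r s. merge i (s - i) * shift s (merge (j - i) (i + r - s)) *
     shift i (beta (s - i) (j - i)) * poch i (j - i) t)"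

text \<open>
  Two words acting successively by \<open>\<triangleright>\<close> act like their shuffle product, since \<open>merge\<close> is associative
  and natural with respect to crossings.
\<close>

lemma twisted_term:
  fixes P :: "'k::field braid_alg"
  assumes "P \<in> balg k"
  shows "shift s (merge i (r1 + m)) * beta s i *
      shift i (shift s (merge r1 m) * beta s r1 * shift r1 (P * merge j2 r2) * beta r1 j2) =
    shift s (merge (i + r1) m) * beta s (i + r1) * shift (i + r1) P *
      (merge i r1 * shift (i + r1) (merge j2 r2) * shift i (beta r1 j2))"
proof -
  define M1 M2 M3 :: "'k braid_alg" where
    "M1 = shift s (merge i (r1 + m))" and
    "M2 = shift (i + s) (merge r1 m)" and
    "M3 = shift (i + r1) (merge j2 r2)"
  define Q where "Q = shift (i + r1) P"
  define B B1 B2 B3 N1 N2 N3 :: "'k braid_alg" where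
    "B = shift i (beta r1 j2)" and
    "B1 = beta s i" and
    "B2 = shift i (beta s r1)" and
    "B3 = beta s (i + r1)" and
    "N1 = shift s (merge (i + r1) m)" and
    "N2 = shift s (merge i r1)" and
    "N3 = merge i r1"
  have 1: "B1 * M2 = M2 * B1"
    unfolding B1_def M2_def by (rule balg_far_commute[OF beta_balg merge_balg]) simp
  have 2: "M1 * M2 = N1 * N2"
    using arg_cong[OF merge_assoc[of i r1 m, where ?'k = 'k], of "shift s"]
    by (simp add: M1_def M2_def N1_def N2_def add.commute)
  have 3: "B1 * B2 = B3" by (simp add: B1_def B2_def B3_def beta_add_right)
  have 4: "N2 * B3 = B3 * N3"
    unfolding N2_def B3_def N3_def by (rule beta_natural_right[OF merge_balg, symmetric])
  have 5: "N3 * Q = Q * N3"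
    unfolding N3_def Q_def by (rule balg_far_commute[OF merge_balg assms]) simp
  have "M1 * (B1 * (M2 * (B2 * (Q * (M3 * B))))) = N1 * (B3 * (Q * (N3 * (M3 * B))))"
    unfolding mult_eq_assoc[OF 1] mult_eq_assoc[OF 2] mult_eq_assoc1[OF 3]
      mult_eq_assoc[OF 4] mult_eq_assoc[OF 5] ..
  then show ?thesis
    by (simp add: M1_def M2_def M3_def Q_def B_def B1_def B2_def B3_def N1_def N2_def N3_def mult.assoc)
qed

text \<open>
  A word that acts by \<open>\<triangleright>\<close> on a product of two splittings may act on the splitting of the first word
  alone, because it is shuffled onto the second part from the left.
\<close>

lemma cut_term:
  fixes P :: "'k::field braid_alg"
  shows "shift (j1 + r1) (merge i (j2 + r2)) * beta (j1 + r1) i *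
      shift i (merge j1 r1 * shift (j1 + r1) (merge j2 r2) * shift j1 (beta r1 j2) * P) =
    merge j1 r1 * shift (j1 + r1) (merge (i + j2) r2) * shift j1 (beta r1 (i + j2)) *
      (shift j1 (merge i j2) * beta j1 i * shift i P)"
proof -
  let ?s = "j1 + r1"
  define M0 B0 M1 M1' M2 B :: "'k braid_alg" where
    "M0 = shift ?s (merge i (j2 + r2))" and
    "B0 = beta ?s i" and
    "M1 = merge j1 r1" and
    "M1' = shift i (merge j1 r1)" and
    "M2 = shift (i + ?s) (merge j2 r2)" and
    "B = shift (i + j1) (beta r1 j2)"
  define Q where "Q = shift i P"
  define N1 N2 N3 B1 B2 B3 :: "'k braid_alg" where
    "N1 = shift ?s (merge (i + j2) r2)" and
    "N2 = shift ?s (merge i j2)" and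
    "N3 = shift j1 (merge i j2)" and
    "B1 = shift j1 (beta r1 i)" and
    "B2 = beta j1 i" and
    "B3 = shift j1 (beta r1 (i + j2))"
  have 1: "B0 * M1' = M1 * B0"
    unfolding B0_def M1_def M1'_def by (rule beta_natural_left[OF merge_balg])
  have 2: "B0 * M2 = M2 * B0"
    unfolding B0_def M2_def by (rule balg_far_commute[OF beta_balg merge_balg]) simp
  have 3: "M0 * M1 = M1 * M0"
    unfolding M0_def M1_def by (rule balg_far_commute[OF merge_balg merge_balg, symmetric]) simp
  have 4: "M0 * M2 = N1 * N2"
    using arg_cong[OF merge_assoc[of i j2 r2, where ?'k = 'k], of "shift ?s"]
    by (simp add: M0_def M2_def N1_def N2_def add.commute)
  have 5: "B0 = B1 * B2" by (simp add: B0_def B1_def B2_def beta_add_left)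
  have 6: "B2 * B = B * B2"
    unfolding B2_def B_def by (rule balg_far_commute[OF beta_balg beta_balg]) simp
  have 7: "B1 * B = B3" by (simp add: B1_def B_def B3_def beta_add_right add.commute)
  have 8: "N2 * B3 = B3 * N3"
    using arg_cong[OF beta_natural_right[OF merge_balg[of i j2, where ?'k = 'k], of r1], of "shift j1"]
    by (simp add: N2_def B3_def N3_def)
  have "M0 * (B0 * (M1' * (M2 * (B * Q)))) = M1 * (N1 * (B3 * (N3 * (B2 * Q))))"
    unfolding mult_eq_assoc[OF 1] mult_eq_assoc[OF 2] mult_eq_assoc[OF 3] mult_eq_assoc[OF 4]
    unfolding mult_eq_assoc2[OF 5] mult_eq_assoc[OF 6] mult_eq_assoc1[OF 7] mult_eq_assoc[OF 8] ..
  then show ?thesis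
    by (simp add: M0_def M1_def M1'_def M2_def Q_def B_def B0_def B1_def B2_def B3_def N1_def N2_def
        N3_def mult.assoc)
qed

text \<open>
  If the initial letters of the first word also act by \<open>\<triangleright>\<close>, then by \<open>twisted_term\<close> the words that act
  are the shuffle products of an initial piece of each word.  By \<open>merge_cut\<close> these are the initial
  pieces of the product of the two words, and \<open>poch_unit\<close> applies to that product.
\<close>

lemma convolve_twisted_sum:
  fixes t :: "'k::field"
  assumes "s \<le> j + r"
  shows "(\<Sum>i\<le>min j (j + r - s). scalar (t ^ i) * (shift s (merge i (j + r - s - i)) * beta s i *
    shift i (twisted_sum t (j - i) r s))) = merge j r"
proof -
  define N where "N = j + r - s"
  define F :: "nat \<Rightarrow> 'k braid_alg" where
    "F c = shift s (merge c (N - c)) * beta s c * shift c (poch s (N - c) t)" for c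
  define G :: "nat \<Rightarrow> nat \<Rightarrow> 'k braid_alg" where
    "G i c = merge i (c - i) * shift c (merge (j - i) (i + r - c)) * shift i (beta (c - i) (j - i))" for i c
  have "scalar (t ^ i) * (shift s (merge i (N - i)) * beta s i * shift i (twisted_sum t (j - i) r s))
      = (\<Sum>r1\<le>min r (N - i). scalar (t ^ (i + r1)) * (F (i + r1) * G i (i + r1)))" if "i \<le> min j N" for i
  proof -
    have N: "j - i + r - s = N - i" using that by (simp add: N_def)
    have "scalar (t ^ i) * (shift s (merge i (N - i)) * beta s i * shift i (scalar (t ^ r1) *
        (shift s (merge r1 (N - i - r1)) * beta s r1 *
        shift r1 (poch s (N - i - r1) t * merge (j - i) (r - r1)) * beta r1 (j - i)))) =
        scalar (t ^ (i + r1)) * (F (i + r1) * G i (i + r1))" if "r1 \<le> min r (N - i)" for r1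
    proof -
      let ?A = "shift s (merge i (N - i)) * beta s i :: 'k braid_alg"
      let ?Y = "shift s (merge r1 (N - i - r1)) * beta s r1 *
        shift r1 (poch s (N - i - r1) t * merge (j - i) (r - r1)) * beta r1 (j - i)"
      have eqs: "r1 + (N - i - r1) = N - i" "N - i - r1 = N - (i + r1)" "i + r1 - i = r1"
        "i + r - (i + r1) = r - r1"
        using that by auto
      have "?A * shift i ?Y = F (i + r1) * G i (i + r1)"
        unfolding F_def G_def eqs(3,4)
        using twisted_term[OF braid_poch_balg[of s "N - i - r1" 1 t], of s i r1 "N - i - r1" "j - i" "r - r1"]
        unfolding eqs(1) unfolding eqs(2) .
      then show ?thesis
        by (simp only: alg_shift_mult[of i "scalar (t ^ r1)"] alg_shift_scalar
            scalar_left_commute[of ?A] power_add scalar_mult mult.assoc[of "scalar _"])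
    qed
    then show ?thesis
      unfolding twisted_sum_def N alg_shift_sum sum_distrib_left by (intro sum.cong) auto
  qed
  then have "(\<Sum>i\<le>min j N. scalar (t ^ i) * (shift s (merge i (N - i)) * beta s i *
    shift i (twisted_sum t (j - i) r s))) =
    (\<Sum>i\<le>min j N. \<Sum>r1\<le>min r (N - i). scalar (t ^ (i + r1)) * (F (i + r1) * G i (i + r1)))"
    by (intro sum.cong) auto
  also have "\<dots> = (\<Sum>(i, r1)\<in>(SIGMA i:{..min j N}. {..min r (N - i)}). scalar (t ^ (i + r1)) * (F (i + r1) * G i (i + r1)))"
    by (subst sum.Sigma) auto
  also have "\<dots> = (\<Sum>(c, i)\<in>(SIGMA c:{..N}. cuts j r c). scalar (t ^ c) * (F c * G i c))"
    by (rule sum.reindex_bij_witness[of _ "\<lambda>(c, i). (i, c - i)" "\<lambda>(i, r1). (i + r1, i)"])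
      (auto simp: cuts_def N_def)
  also have "\<dots> = (\<Sum>c\<le>N. \<Sum>i\<in>cuts j r c. scalar (t ^ c) * (F c * G i c))"
    by (subst sum.Sigma) auto
  also have "\<dots> = (\<Sum>c\<le>N. scalar (t ^ c) * F c * merge j r)"
  proof (rule sum.cong[OF HOL.refl])
    fix c assume "c \<in> {..N}"
    then have "merge j r = (\<Sum>i\<in>cuts j r c. G i c)"
      unfolding G_def by (intro merge_cut) (use assms in \<open>auto simp: N_def\<close>)
    then show "(\<Sum>i\<in>cuts j r c. scalar (t ^ c) * (F c * G i c)) = scalar (t ^ c) * F c * merge j r"
      by (simp add: sum_distrib_left mult.assoc)
  qed
  also have "\<dots> = merge j r"
    using poch_unit[where n = N and s = s and t = t] by (simp add: F_def flip: sum_distrib_right)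
  finally show ?thesis by (simp add: N_def)
qed

text \<open>
  Here \<open>poch_unit\<close> applies to the first word only and turns its splitting into a cut; then \<open>merge_cut\<close>
  puts the pieces of the two words together again.
\<close>

lemma convolve_cut_sum:
  fixes t :: "'k::field"
  assumes "s \<le> j + r"
  shows "(\<Sum>i\<le>min j (j + r - s). scalar (t ^ i) * (shift s (merge i (j + r - s - i)) * beta s i *
    shift i (cut_sum t (j - i) r s))) = merge j r"
proof -
  define N where "N = j + r - s"
  define H :: "nat \<Rightarrow> 'k braid_alg" where
    "H j1 = merge j1 (s - j1) * shift s (merge (j - j1) (j1 + r - s)) * shift j1 (beta (s - j1) (j - j1))" for j1
  define U :: "nat \<Rightarrow> nat \<Rightarrow> 'k braid_alg" where
    "U j1 i = shift j1 (merge i (j - j1 - i)) * beta j1 i * shift i (poch j1 (j - j1 - i) t)" for j1 i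
  have "scalar (t ^ i) * (shift s (merge i (N - i)) * beta s i * shift i (cut_sum t (j - i) r s))
      = (\<Sum>j1\<in>cuts (j - i) r s. H j1 * (scalar (t ^ i) * U j1 i))" if "i \<le> min j N" for i
  proof -
    have "scalar (t ^ i) * (shift s (merge i (N - i)) * beta s i * shift i
        (merge j1 (s - j1) * shift s (merge (j - i - j1) (j1 + r - s)) *
         shift j1 (beta (s - j1) (j - i - j1)) * poch j1 (j - i - j1) t)) =
        H j1 * (scalar (t ^ i) * U j1 i)" if j1: "j1 \<in> cuts (j - i) r s" for j1
    proof -
      have eqs: "N - i = (j - i - j1) + (j1 + r - s)" "s = j1 + (s - j1)" "i + (j - i - j1) = j - j1"
        "j - i - j1 = j - j1 - i"
        using j1 \<open>i \<le> min j N\<close> by (auto simp: cuts_def N_def)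
      show ?thesis
        using cut_term[of j1 "s - j1" i "j - i - j1" "j1 + r - s" "poch j1 (j - i - j1) t"]
        unfolding eqs(2)[symmetric] eqs(1)[symmetric] eqs(3)
        by (simp only: H_def U_def scalar_left_commute eqs(4))
    qed
    then show ?thesis
      unfolding cut_sum_def alg_shift_sum sum_distrib_left by (intro sum.cong) auto
  qed
  then have "(\<Sum>i\<le>min j N. scalar (t ^ i) * (shift s (merge i (N - i)) * beta s i *
    shift i (cut_sum t (j - i) r s))) =
    (\<Sum>i\<le>min j N. \<Sum>j1\<in>cuts (j - i) r s. H j1 * (scalar (t ^ i) * U j1 i))"
    by (intro sum.cong) auto
  also have "\<dots> = (\<Sum>(i, j1)\<in>(SIGMA i:{..min j N}. cuts (j - i) r s). H j1 * (scalar (t ^ i) * U j1 i))"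
    by (subst sum.Sigma) auto
  also have "\<dots> = (\<Sum>(j1, i)\<in>(SIGMA j1:cuts j r s. {..j - j1}). H j1 * (scalar (t ^ i) * U j1 i))"
    by (rule sum.reindex_bij_witness[of _ "\<lambda>(j1, i). (i, j1)" "\<lambda>(i, j1). (j1, i)"])
      (use assms in \<open>auto simp: cuts_def N_def\<close>)
  also have "\<dots> = (\<Sum>j1\<in>cuts j r s. \<Sum>i\<le>j - j1. H j1 * (scalar (t ^ i) * U j1 i))"
    by (subst sum.Sigma) auto
  also have "\<dots> = (\<Sum>j1\<in>cuts j r s. H j1)"
  proof -
    have "(\<Sum>i\<le>j - j1. scalar (t ^ i) * U j1 i) = 1" for j1
      unfolding U_def by (rule poch_unit)
    then show ?thesis by (simp flip: sum_distrib_left)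
  qed
  also have "\<dots> = merge j r"
    unfolding H_def by (rule merge_cut[OF assms, symmetric])
  finally show ?thesis by (simp add: N_def)
qed

text \<open>
  The term \<open>i = 0\<close> of the sums in the two preceding lemmas is the sum in question, and the other terms
  involve shorter first words.
\<close>

theorem twisted_sum_eq_cut_sum: "s \<le> j + r \<Longrightarrow> twisted_sum t j r s = cut_sum t j r s"
proof (induction j rule: less_induct)
  case (less j)
  let ?S = "\<lambda>Z. \<Sum>i\<le>min j (j + r - s). scalar (t ^ i) *
    (shift s (merge i (j + r - s - i)) * beta s i * shift i (Z t (j - i) r s))"
  let ?S' = "\<lambda>Z. \<Sum>i\<in>{..min j (j + r - s)} - {0}. scalar (t ^ i) *
    (shift s (merge i (j + r - s - i)) * beta s i * shift i (Z t (j - i) r s))"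
  have S: "?S Z = Z t j r s + ?S' Z" for Z
    by (subst sum.remove[of _ 0]) auto
  have "?S' twisted_sum = ?S' cut_sum"
  proof (rule sum.cong[OF HOL.refl])
    fix i assume "i \<in> {..min j (j + r - s)} - {0}"
    then have "twisted_sum t (j - i) r s = cut_sum t (j - i) r s"
      using less.prems by (intro less.IH) auto
    then show "scalar (t ^ i) * (shift s (merge i (j + r - s - i)) * beta s i *
          shift i (twisted_sum t (j - i) r s)) =
        scalar (t ^ i) * (shift s (merge i (j + r - s - i)) * beta s i *
          shift i (cut_sum t (j - i) r s))"
      by simp
  qed
  moreover have "?S twisted_sum = ?S cut_sum"
    using convolve_twisted_sum[OF less.prems, of t] convolve_cut_sum[OF less.prems, of t] by simp
  ultimately show ?case unfolding S by simp
qed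

section \<open>The Yang--Baxter equation in the braid group algebra\<close>

text \<open>
  \<open>A(a,b;c)\<close> without its power of \<open>q\<close>, and with an arbitrary scalar \<open>t\<close> in place of \<open>q\<^bsup>-2\<^esup>\<close>.
\<close>

definition exch_core :: "'k::field \<Rightarrow> nat \<Rightarrow> nat \<Rightarrow> nat \<Rightarrow> 'k braid_alg" where
  "exch_core t a b c = shift a (merge c (b - c)) * beta a c * shift c (poch a (b - c) t)"

lemma exch_coeff_eq:
  "c \<le> b \<Longrightarrow> exch_coeff q a b c =
    scalar (q powi (1 - int a - int c)) * exch_core (q powi (- 2)) a b c"
  by (simp add: exch_coeff_def exch_core_def merge_def of_nat_diff mult.assoc)

lemma exch_balg: "c \<le> b \<Longrightarrow> exch_core t a b c \<in> balg (a + b)"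
  unfolding exch_core_def
  by (intro balg.mult balg_shift[OF merge_balg] balg_shift[OF braid_poch_balg] balg_mono[OF beta_balg])
    auto

lemma exch_coeff_balg: "c \<le> b \<Longrightarrow> exch_coeff q a b c \<in> balg (a + b)"
  by (simp add: exch_coeff_eq balg.mult balg.scalar exch_balg)

text \<open>
  Normal form of one term on the left of \<open>exch_ybe_main\<close>.  The word of \<open>j = j1 + j2\<close> letters is
  split into \<open>j1\<close> and \<open>j2\<close>, the third word successively into \<open>a\<close>, \<open>r1\<close> and \<open>r2\<close> letters.  In the normal form the third
  word is first divided by \<open>p\<^bsub>a,r1+r2\<^esub>\<close>, the middle word passes its first \<open>a\<close> letters, then a term of
  \<open>cut_sum\<close> is applied, and at the end the word of \<open>i\<close> letters passes everything and is shuffled onto the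
  last part.
\<close>

lemma exch_left_term:
  fixes t :: "'k::field"
  shows "exch_core t a (j1 + r1) j1 * shift j1 (exch_core t (a + r1) (i + j2 + r2) (i + j2)) *
      exch_core t j1 (i + j2) i =
    shift (a + j1 + r1) (merge i (j2 + r2)) * beta (a + j1 + r1) i *
      shift i (shift a (merge j1 r1 * shift (j1 + r1) (merge j2 r2) *
        shift j1 (beta r1 j2) * poch j1 j2 t) * beta a (j1 + j2)) *
      shift (i + (j1 + j2)) (poch a (r1 + r2) t)"
proof -
  define u1 u2 u3 u4 u5 u6 u7 u8 u9 w3 w :: "'k braid_alg" where
    "u1 = shift a (merge j1 r1)" and
    "u2 = beta a j1" and
    "u3 = shift j1 (poch a r1 t)" and
    "u4 = shift (j1 + (a + r1)) (merge (i + j2) r2)" and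
    "u5 = shift j1 (beta (a + r1) (i + j2))" and
    "u6 = shift (j1 + (i + j2)) (poch (a + r1) r2 t)" and
    "u7 = shift j1 (merge i j2)" and
    "u8 = beta j1 i" and
    "u9 = shift i (poch j1 j2 t)" and
    "w3 = shift (j1 + (i + j2)) (poch a r1 t)" and
    "w = shift (j1 + (i + j2)) (poch a (r1 + r2) t)"
  \<comment> \<open>the two Pochhammer symbols of the third word meet, and their product leaves to the right\<close>
  have s1: "u3 * u4 = u4 * u3"
    unfolding u3_def u4_def alg_shift_shift[symmetric, of j1 "a + r1"] alg_shift_mult[symmetric]
    by (rule arg_cong[of _ _ "alg_shift _"], rule balg_far_commute[OF braid_poch_balg merge_balg]) simp
  have s2: "u3 * u5 = u5 * w3"
    unfolding u3_def u5_def w3_def alg_shift_shift[symmetric, of j1 "i + j2"] alg_shift_mult[symmetric]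
    by (intro arg_cong[of _ _ "alg_shift _"] beta_natural_left[OF braid_poch_balg, symmetric])
  have s3: "w3 * u6 = w"
    by (simp add: w3_def u6_def w_def braid_poch_add)
  have s4: "w * u7 = u7 * w"
    unfolding w_def u7_def
    by (rule balg_far_commute[OF balg_shift[OF merge_balg] braid_poch_balg, symmetric]) auto
  have s5: "w * u8 = u8 * w"
    unfolding w_def u8_def
    by (rule balg_far_commute[OF beta_balg braid_poch_balg, symmetric]) auto
  have s6: "w * u9 = u9 * w"
    unfolding w_def u9_def
    by (rule balg_far_commute[OF balg_shift[OF braid_poch_balg] braid_poch_balg, symmetric]) auto
  let ?b = "j1 + (a + r1)"
  define v0 v1 v2 x0 x1 x2 :: "'k braid_alg" where
    "v0 = shift ?b (merge i j2)" and
    "v1 = shift ?b (merge i (j2 + r2))" and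
    "v2 = shift (?b + i) (merge j2 r2)" and
    "x0 = shift j1 (beta (a + r1) i)" and
    "x1 = beta ?b i" and
    "x2 = shift (j1 + i) (beta (a + r1) j2)"
  \<comment> \<open>the shuffle of the \<open>i\<close> with the \<open>j2\<close> letters is delayed, which permits reassociating\<close>
  have s7: "u5 * u7 = v0 * u5"
    unfolding u5_def u7_def v0_def alg_shift_shift[symmetric, of j1 "a + r1"] alg_shift_mult[symmetric]
    by (intro arg_cong[of _ _ "alg_shift _"] beta_natural_right[OF merge_balg])
  have s8: "u4 * v0 = v1 * v2"
    unfolding u4_def v0_def v1_def v2_def alg_shift_shift[symmetric, of ?b i] alg_shift_mult[symmetric]
      merge_assoc ..
  have s9: "u5 = x0 * x2"
    by (simp add: u5_def x0_def x2_def beta_add_right)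
  have s10: "x2 * u8 = u8 * x2"
    unfolding x2_def u8_def by (rule balg_far_commute[OF beta_balg beta_balg, symmetric]) simp
  have s11: "x0 * u8 = x1"
    by (simp add: x0_def x1_def u8_def beta_add_left)
  \<comment> \<open>the words of \<open>i\<close> and of \<open>j1\<close> letters do not interact, so the former can act last\<close>
  have s12: "u2 * v1 = v1 * u2"
    unfolding u2_def v1_def by (rule balg_far_commute[OF beta_balg merge_balg]) simp
  have s13: "u1 * v1 = v1 * u1"
    unfolding u1_def v1_def by (rule balg_far_commute[OF balg_shift[OF merge_balg] merge_balg]) auto
  have s14: "v2 * x1 = x1 * v2"
    unfolding v2_def x1_def by (rule balg_far_commute[OF beta_balg merge_balg, symmetric]) simp
  define y1 where "y1 = shift i u1"
  define y2 where "y2 = shift i u2"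
  have s15: "u2 * x1 = x1 * y2"
    unfolding x1_def y2_def u2_def
    by (rule beta_natural_left[symmetric]) (rule balg_mono[OF beta_balg], simp)
  have s16: "u1 * x1 = x1 * y1"
    unfolding x1_def y1_def u1_def
    by (rule beta_natural_left[symmetric]) (rule balg_shift[OF merge_balg], simp)
  define z1 z2 z3 z4 :: "'k braid_alg" where
    "z1 = shift (i + j1 + a) (beta r1 j2)" and
    "z2 = shift (j1 + i) (beta a j2)" and
    "z3 = shift i (beta a (j1 + j2))" and
    "z4 = shift (i + a) (poch j1 j2 t)"
  \<comment> \<open>the crossings with the \<open>a\<close> letters are collected into one\<close>
  have s17: "x2 = z1 * z2"
    by (simp add: x2_def z1_def z2_def beta_add_left add_ac)
  have s18: "y2 * v2 = v2 * y2"
    unfolding y2_def v2_def u2_def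
    by (rule balg_far_commute[OF balg_shift[OF beta_balg] merge_balg]) auto
  have s19: "y2 * z1 = z1 * y2"
    unfolding y2_def z1_def u2_def
    by (rule balg_far_commute[OF balg_shift[OF beta_balg] beta_balg]) auto
  have s20: "y2 * z2 = z3"
    by (simp add: y2_def u2_def z2_def z3_def beta_add_right add_ac)
  have s21: "z3 * u9 = z4 * z3"
    unfolding z3_def u9_def z4_def alg_shift_shift[symmetric] alg_shift_mult[symmetric]
    by (intro arg_cong[of _ _ "alg_shift _"] beta_natural_right[OF braid_poch_balg])
  have "u1 * (u2 * (u3 * (u4 * (u5 * (u6 * (u7 * (u8 * u9))))))) =
      v1 * (x1 * (y1 * (v2 * (z1 * (z4 * (z3 * w))))))"
    unfolding mult_eq_assoc[OF s1] mult_eq_assoc[OF s2] mult_eq_assoc1[OF s3]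
      mult_eq_assoc[OF s4] mult_eq_assoc[OF s5] s6
    unfolding mult_eq_assoc[OF s7] mult_eq_assoc[OF s8]
    unfolding mult_eq_assoc2[OF s9] mult_eq_assoc[OF s10] mult_eq_assoc1[OF s11]
      mult_eq_assoc[OF s12] mult_eq_assoc[OF s13] mult_eq_assoc[OF s14]
      mult_eq_assoc[OF s15] mult_eq_assoc[OF s16]
    unfolding mult_eq_assoc2[OF s17] mult_eq_assoc[OF s18] mult_eq_assoc[OF s19]
      mult_eq_assoc1[OF s20] mult_eq_assoc[OF s21] ..
  then show ?thesis
    by (simp add: exch_core_def u1_def u2_def u3_def u4_def u5_def u6_def u7_def u8_def u9_def w_def
        v1_def v2_def x1_def y1_def z1_def z3_def z4_def mult.assoc add_ac)
qed

text \<open>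
  Normal form of one term on the right of \<open>exch_ybe_main\<close>, where \<open>r1 = k - i\<close> and \<open>m = c - k\<close>.
  It differs from \<open>exch_left_term\<close> only by a term of \<open>twisted_sum\<close> in place of one of \<open>cut_sum\<close>.
\<close>

lemma exch_right_term:
  fixes t :: "'k::field"
  assumes bm: "b + m = j + r2"
  shows "shift a (exch_core t b (i + r1 + m) (i + r1)) * exch_core t a (i + r1) i *
      shift i (exch_core t (a + r1) (j + r2) j) =
    shift (a + b) (merge i (r1 + m)) * beta (a + b) i *
      shift i (shift a (shift b (merge r1 m) * beta b r1 *
        shift r1 (poch b m t * merge j r2) * beta r1 j) * beta a j) *
      shift (i + j) (poch a (r1 + r2) t)"
proof -
  define u1 u2 u3 u4 u5 u6 u7 u8 u9 w3 w v0 v1 v2 y1 y2 x1 z1 z2 :: "'k braid_alg" where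
    "u1 = shift (a + b) (merge (i + r1) m)" and
    "u2 = shift a (beta b (i + r1))" and
    "u3 = shift (a + (i + r1)) (poch b m t)" and
    "u4 = shift a (merge i r1)" and
    "u5 = beta a i" and
    "u6 = shift i (poch a r1 t)" and
    "u7 = shift (i + (a + r1)) (merge j r2)" and
    "u8 = shift i (beta (a + r1) j)" and
    "u9 = shift (i + j) (poch (a + r1) r2 t)" and
    "w3 = shift (i + j) (poch a r1 t)" and
    "w = shift (i + j) (poch a (r1 + r2) t)" and
    "v0 = shift (a + b) (merge i r1)" and
    "v1 = shift (a + b) (merge i (r1 + m))" and
    "v2 = shift (a + b + i) (merge r1 m)" and
    "y1 = shift a (beta b i)" and
    "y2 = shift (i + a) (beta b r1)" and
    "x1 = beta (a + b) i" and
    "z1 = shift (i + a) (beta r1 j)" and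
    "z2 = shift i (beta a j)"
  \<comment> \<open>the two Pochhammer symbols of the third word meet, and their product leaves to the right\<close>
  have s1: "u6 * u7 = u7 * u6"
    unfolding u6_def u7_def alg_shift_shift[symmetric, of i "a + r1"] alg_shift_mult[symmetric]
    by (rule arg_cong[of _ _ "alg_shift _"], rule balg_far_commute[OF braid_poch_balg merge_balg]) simp
  have s2: "u6 * u8 = u8 * w3"
    unfolding u6_def u8_def w3_def alg_shift_shift[symmetric] alg_shift_mult[symmetric]
    by (intro arg_cong[of _ _ "alg_shift _"] beta_natural_left[OF braid_poch_balg, symmetric])
  have s3: "w3 * u9 = w"
    by (simp add: w3_def u9_def w_def braid_poch_add)
  \<comment> \<open>the shuffle of the \<open>i\<close> with the \<open>r1\<close> letters is delayed, which permits reassociating\<close>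
  have s4: "u3 * u4 = u4 * u3"
    unfolding u3_def u4_def alg_shift_shift[symmetric, of a "i + r1"] alg_shift_mult[symmetric]
    by (intro arg_cong[of _ _ "alg_shift _"] balg_far_commute[OF merge_balg braid_poch_balg, symmetric]) simp
  have s5: "u2 * u4 = v0 * u2"
    unfolding u2_def u4_def v0_def alg_shift_shift[symmetric] alg_shift_mult[symmetric]
    by (intro arg_cong[of _ _ "alg_shift _"] beta_natural_right[OF merge_balg])
  have s6: "u1 * v0 = v1 * v2"
    unfolding u1_def v0_def v1_def v2_def alg_shift_shift[symmetric, of "a + b" i]
      alg_shift_mult[symmetric] merge_assoc ..
  \<comment> \<open>the word of \<open>i\<close> letters acts last\<close>
  have s7: "u2 = y1 * y2"
    by (simp add: u2_def y1_def y2_def beta_add_right add.commute)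
  have s8: "u3 * u5 = u5 * u3"
    unfolding u3_def u5_def
    by (rule balg_far_commute[OF beta_balg braid_poch_balg, symmetric]) simp
  have s9: "y2 * u5 = u5 * y2"
    unfolding y2_def u5_def
    by (rule balg_far_commute[OF beta_balg beta_balg, symmetric]) simp
  have s10: "y1 * u5 = x1"
    by (simp add: y1_def u5_def x1_def beta_add_left)
  have s11: "v2 * x1 = x1 * v2"
    unfolding v2_def x1_def by (rule balg_far_commute[OF beta_balg merge_balg, symmetric]) simp
  have s12: "u8 = z1 * z2"
    by (simp add: u8_def z1_def z2_def beta_add_left)
  have "u1 * (u2 * (u3 * (u4 * (u5 * (u6 * (u7 * (u8 * u9))))))) =
      v1 * (x1 * (v2 * (y2 * (u3 * (u7 * (z1 * (z2 * w)))))))"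
    unfolding mult_eq_assoc[OF s1] mult_eq_assoc[OF s2] s3
    unfolding mult_eq_assoc[OF s4] mult_eq_assoc[OF s5] mult_eq_assoc[OF s6]
    unfolding mult_eq_assoc2[OF s7] mult_eq_assoc[OF s8] mult_eq_assoc[OF s9]
      mult_eq_assoc1[OF s10] mult_eq_assoc[OF s11] mult_eq_assoc2[OF s12] ..
  then show ?thesis
    by (simp add: exch_core_def u1_def u2_def u3_def u4_def u5_def u6_def u7_def u8_def u9_def w_def
        v1_def v2_def x1_def y2_def z1_def z2_def mult.assoc add_ac)
qed

lemma scalar_prod3: "scalar x * a * shift l (scalar y * b) * (scalar z * c) =
   scalar (x * y * z) * (a * shift l b * c)"
  unfolding alg_shift_mult alg_shift_scalar scalar_mult mult.assoc
    scalar_left_commute[of "shift l b"] scalar_left_commute[of a] ..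

text \<open>
  The outer factors of the two normal forms do not depend on the summation index, so the two sides
  differ by \<open>twisted_sum\<close> against \<open>cut_sum\<close> in the middle (the map \<open>W\<close> adds the outer factors).
\<close>

lemma exch_ybe_main:
  fixes t :: "'k::field"
  assumes ic: "i \<le> c" and bc: "b + c = i + j + r"
  shows "(\<Sum>m\<in>{m. i \<le> m \<and> m \<le> c \<and> m \<le> i + j \<and> i + j \<le> m + b}.
      exch_core t a b (i + j - m) * shift (i + j - m) (exch_core t (a + b - (i + j - m)) c m) * exch_core t (i + j - m) m i) =
    (\<Sum>k\<in>{k. i \<le> k \<and> k \<le> c \<and> j + k \<le> b + c}. scalar (t ^ (k - i)) *
      (shift a (exch_core t b c k) * exch_core t a k i * shift i (exch_core t (a + k - i) (b + c - k) j)))"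
    (is "?L = ?R")
proof -
  define pre post :: "'k braid_alg" where
    "pre = shift (a + b) (merge i (c - i)) * beta (a + b) i" and
    "post = shift (i + j) (poch a r t)"
  define W where "W x = pre * shift i (shift a x * beta a j) * post" for x
  have W_sum: "W (sum f A) = (\<Sum>x\<in>A. W (f x))" for f :: "nat \<Rightarrow> 'k braid_alg" and A
    by (simp add: W_def alg_shift_sum sum_distrib_left sum_distrib_right)
  have W_scalar: "W (scalar c * x) = scalar c * W x" for c x
    unfolding W_def alg_shift_mult alg_shift_scalar mult.assoc scalar_left_commute[of pre] ..
  have "?L = (\<Sum>j1\<in>cuts j r b. exch_core t a b j1 *
      shift j1 (exch_core t (a + b - j1) c (i + j - j1)) * exch_core t j1 (i + j - j1) i)"
    by (rule sum.reindex_bij_witness[of _ "\<lambda>j1. i + j - j1" "\<lambda>m. i + j - m"])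
      (use bc in \<open>auto simp: cuts_def\<close>)
  also have "\<dots> = W (cut_sum t j r b)"
    unfolding cut_sum_def W_sum
  proof (rule sum.cong[OF HOL.refl])
    fix j1 assume "j1 \<in> cuts j r b"
    then have j1: "j1 \<le> j" "j1 \<le> b" "b \<le> j1 + r" by (auto simp: cuts_def)
    define j2 r1 r2 where "j2 = j - j1" and "r1 = b - j1" and "r2 = j1 + r - b"
    have eqs: "j = j1 + j2" "b = j1 + r1" "r = r1 + r2" "i + j - j1 = i + j2" "a + b - j1 = a + r1"
        "c = i + j2 + r2" "c - i = j2 + r2"
      using j1 bc by (auto simp: j2_def r1_def r2_def)
    have "exch_core t a b j1 * shift j1 (exch_core t (a + b - j1) c (i + j - j1)) * exch_core t j1 (i + j - j1) i
      = W (merge j1 r1 * shift b (merge j2 r2) * shift j1 (beta r1 j2) * poch j1 j2 t)"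
      using exch_left_term[where a = a and i = i and ?j1.0 = j1 and ?r1.0 = r1 and ?j2.0 = j2 and ?r2.0 = r2 and t = t]
      unfolding W_def pre_def post_def eqs(4,5,7) unfolding eqs(1,2,3,6) by (simp only: add.assoc)
    then show "exch_core t a b j1 * shift j1 (exch_core t (a + b - j1) c (i + j - j1)) * exch_core t j1 (i + j - j1) i
      = W (merge j1 (b - j1) * shift b (merge (j - j1) (j1 + r - b)) *
           shift j1 (beta (b - j1) (j - j1)) * poch j1 (j - j1) t)"
      by (simp only: j2_def r1_def r2_def)
  qed
  also have "\<dots> = W (twisted_sum t j r b)"
    using ic bc by (subst twisted_sum_eq_cut_sum) auto
  also have "\<dots> = (\<Sum>r1\<le>min r (j + r - b). scalar (t ^ r1) *
      (shift a (exch_core t b c (i + r1)) * exch_core t a (i + r1) i * shift i (exch_core t (a + r1) (b + c - (i + r1)) j)))"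
    unfolding twisted_sum_def W_sum W_scalar
  proof (rule sum.cong[OF HOL.refl])
    fix r1 assume "r1 \<in> {..min r (j + r - b)}"
    then have r1: "r1 \<le> r" "r1 \<le> j + r - b" by auto
    define r2 m where "r2 = r - r1" and "m = j + r - b - r1"
    have eqs: "r = r1 + r2" "c = i + r1 + m" "b + c - (i + r1) = j + r2" "c - i = r1 + m"
      and bm: "b + m = j + r2"
      using r1 bc ic by (auto simp: r2_def m_def)
    have "shift a (exch_core t b c (i + r1)) * exch_core t a (i + r1) i *
        shift i (exch_core t (a + r1) (b + c - (i + r1)) j) =
      W (shift b (merge r1 m) * beta b r1 * shift r1 (poch b m t * merge j r2) * beta r1 j)"
      using exch_right_term[OF bm, where a = a and i = i and ?r1.0 = r1 and t = t]
      unfolding W_def pre_def post_def eqs(3,4) unfolding eqs(1,2) .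
    then show "scalar (t ^ r1) * W (shift b (merge r1 (j + r - b - r1)) * beta b r1 *
         shift r1 (poch b (j + r - b - r1) t * merge j (r - r1)) * beta r1 j) =
      scalar (t ^ r1) * (shift a (exch_core t b c (i + r1)) * exch_core t a (i + r1) i *
        shift i (exch_core t (a + r1) (b + c - (i + r1)) j))"
      by (simp only: r2_def m_def)
  qed
  also have "\<dots> = ?R"
    by (rule sum.reindex_bij_witness[of _ "\<lambda>k. k - i" "\<lambda>r1. i + r1"]) (use bc ic in auto)
  finally show ?thesis .
qed

text \<open>
  The powers of \<open>q\<close> multiply to a constant in every term on the left, and to that constant times
  \<open>q\<^bsup>-2(k-i)\<^esup>\<close> on the right; the factor \<open>q\<^bsup>-2(k-i)\<^esup>\<close> is the weight \<open>t\<^bsup>|c|\<^esup>\<close> of \<open>twisted_sum\<close>.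
\<close>

theorem exch_coeff_ybe:
  fixes q :: "'k::field"
  assumes q: "q \<noteq> 0"
  shows "(\<Sum>m\<in>{m. i \<le> m \<and> m \<le> c \<and> m \<le> i + j \<and> i + j \<le> m + b}.
      exch_coeff q a b (i + j - m) * shift (i + j - m) (exch_coeff q (a + b - (i + j - m)) c m) *
      exch_coeff q (i + j - m) m i) =
    (\<Sum>k\<in>{k. i \<le> k \<and> k \<le> c \<and> j + k \<le> b + c}.
      shift a (exch_coeff q b c k) * exch_coeff q a k i *
      shift i (exch_coeff q (a + k - i) (b + c - k) j))"
    (is "sum ?l ?A = sum ?r ?B")
proof (cases "i \<le> c \<and> i + j \<le> b + c")
  case False
  then have "?A = {}" "?B = {}" by auto
  then show ?thesis by (simp only: sum.empty)
next
  case True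
  then obtain r where r: "b + c = i + j + r" by (metis le_add_diff_inverse)
  define t where "t = q powi (- 2)"
  define u where "u = q powi (3 - 2 * int a - int b - 2 * int i - int j)"
  have l: "?l m = scalar u * (exch_core t a b (i + j - m) *
      shift (i + j - m) (exch_core t (a + b - (i + j - m)) c m) * exch_core t (i + j - m) m i)" if "m \<in> ?A" for m
  proof -
    have "q powi (1 - int a - int (i + j - m)) * q powi (1 - int (a + b - (i + j - m)) - int m) *
        q powi (1 - int (i + j - m) - int i) = u"
      unfolding u_def using that q by (simp add: power_int_add[symmetric] of_nat_diff algebra_simps)
    moreover have "i + j - m \<le> b" "m \<le> c" "i \<le> m" using that by auto
    ultimately show ?thesis
      by (simp only: exch_coeff_eq scalar_prod3 t_def)
  qed
  have scalar_prod: "shift a (scalar x * X) * (scalar y * Y) * shift i (scalar z * Z) =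
      scalar (x * y * z) * (shift a X * Y * shift i Z)" for x y z and X Y Z :: "'k braid_alg"
    unfolding alg_shift_mult alg_shift_scalar scalar_mult mult.assoc
      scalar_left_commute[of Y] scalar_left_commute[of "shift a X"] ..
  have r': "?r k = scalar u * (scalar (t ^ (k - i)) * (shift a (exch_core t b c k) * exch_core t a k i *
      shift i (exch_core t (a + k - i) (b + c - k) j)))" if "k \<in> ?B" for k
  proof -
    have "t ^ (k - i) = q powi (- 2 * int (k - i))"
      using power_int_mult[of q "- 2" "int (k - i)"] by (simp add: t_def)
    then have "q powi (1 - int b - int k) * q powi (1 - int a - int i) *
        q powi (1 - int (a + k - i) - int j) = u * t ^ (k - i)"
      unfolding u_def using that q by (simp add: power_int_add[symmetric] of_nat_diff algebra_simps)
    moreover have "k \<le> c" "i \<le> k" "j \<le> b + c - k" using that by auto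
    ultimately show ?thesis
      unfolding mult.assoc[of "scalar u", symmetric] scalar_mult[symmetric]
      by (simp only: exch_coeff_eq scalar_prod t_def)
  qed
  show ?thesis
    using exch_ybe_main[OF conjunct1[OF True] r, where t = t and a = a]
    by (simp only: l r' sum_distrib_left[symmetric] cong: sum.cong)
qed

section \<open>Tensor powers and linear maps\<close>

interpretation ten: vector_space "tscale :: 'k::field \<Rightarrow> ('k, 'v) ten \<Rightarrow> _"
  by (rule vector_space_tscale)

abbreviation pow :: "('k::field, 'v::ab_group_add) lspace \<Rightarrow> nat \<Rightarrow> ('k, 'v) ten set" where
  "pow V n \<equiv> carr (tpow V n)"

lemma vspace_tspan: "vspace (tspan V D)"
  by (simp add: vspace_def tspan_def vector_space_tscale)

lemma vspace_tpow: "vspace (tpow V n)" and vspace_tens: "vspace (tens V)"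
  by (simp_all add: tpow_def tens_def vspace_tspan)

lemma smul_tspan [simp]: "smul (tspan V D) = tscale" "smul (tpow V n) = tscale" "smul (tens V) = tscale"
  by (simp_all add: tpow_def tens_def tspan_def)

lemma subspace_tspan: "ten.subspace (carr (tspan V D))"
  by (simp add: tspan_def)

lemma tspan_closed:
  "0 \<in> carr (tspan V D)"
  "s \<in> carr (tspan V D) \<Longrightarrow> t \<in> carr (tspan V D) \<Longrightarrow> s + t \<in> carr (tspan V D)"
  "s \<in> carr (tspan V D) \<Longrightarrow> tscale c s \<in> carr (tspan V D)"
  "(\<And>x. x \<in> A \<Longrightarrow> f x \<in> carr (tspan V D)) \<Longrightarrow> sum f A \<in> carr (tspan V D)"
  by (intro ten.subspace_0 ten.subspace_add ten.subspace_scale ten.subspace_sum subspace_tspan; assumption)+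

lemmas tpow_closed = tspan_closed[where V = V and D = "nwords V n" for V n, folded tpow_def]
lemmas tens_closed = tspan_closed[where V = V and D = "words V" for V, folded tens_def]

lemma pten_tspan: "xs \<in> D \<Longrightarrow> pten V xs \<in> carr (tspan V D)"
  by (simp add: tspan_def ten.span_base)

lemma pten_tpow: "xs \<in> nwords V n \<Longrightarrow> pten V xs \<in> pow V n"
  and pten_tens: "xs \<in> words V \<Longrightarrow> pten V xs \<in> carr (tens V)"
  by (simp_all add: tpow_def tens_def pten_tspan)

lemma tpow_tens: "u \<in> pow V n \<Longrightarrow> u \<in> carr (tens V)"
proof -
  assume "u \<in> pow V n"
  moreover have "ten.span (pten V ` nwords V n) \<subseteq> ten.span (pten V ` words V)"
    by (rule ten.span_mono) (auto simp: nwords_def)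
  ultimately show ?thesis by (auto simp: tpow_def tens_def tspan_def)
qed

lemma tspan_induct [consumes 1, case_names pten zero add scale]:
  assumes "u \<in> carr (tspan V D)" "\<And>xs. xs \<in> D \<Longrightarrow> P (pten V xs)" "P 0"
    "\<And>s t. s \<in> carr (tspan V D) \<Longrightarrow> t \<in> carr (tspan V D) \<Longrightarrow> P s \<Longrightarrow> P t \<Longrightarrow> P (s + t)"
    "\<And>c s. s \<in> carr (tspan V D) \<Longrightarrow> P s \<Longrightarrow> P (tscale c s)"
  shows "P u"
proof -
  have "u \<in> ten.span (pten V ` D)" using assms(1) by (simp add: tspan_def)
  then have "u \<in> carr (tspan V D) \<and> P u"
  proof (induction rule: ten.span_induct_alt)
    case base
    then show ?case using assms tspan_closed by blast
  next
    case (step c x y)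
    then obtain xs where x: "x = pten V xs" "xs \<in> D" by blast
    have "tscale c x \<in> carr (tspan V D)" "P (tscale c x)"
      using x assms(2) assms(5)[OF pten_tspan] by (auto intro: tspan_closed pten_tspan)
    with step show ?case using assms(4) tspan_closed(2) by blast
  qed
  then show ?thesis ..
qed

lemmas tpow_induct = tspan_induct[where V = V and D = "nwords V n" for V n, folded tpow_def,
    consumes 1, case_names pten zero add scale]
lemmas tens_induct = tspan_induct[where V = V and D = "words V" for V, folded tens_def,
    consumes 1, case_names pten zero add scale]

lemma linear_mapI:
  assumes "\<And>x. x \<in> carr A \<Longrightarrow> f x \<in> carr B"
    "\<And>x y. x \<in> carr A \<Longrightarrow> y \<in> carr A \<Longrightarrow> f (x + y) = f x + f y"
    "\<And>c x. x \<in> carr A \<Longrightarrow> f (smul A c x) = smul B c (f x)"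
  shows "linear_map A B f"
  using assms by (simp add: linear_map_def)

lemma linear_mapD:
  assumes "linear_map A B f"
  shows "x \<in> carr A \<Longrightarrow> f x \<in> carr B"
    "x \<in> carr A \<Longrightarrow> y \<in> carr A \<Longrightarrow> f (x + y) = f x + f y"
    "x \<in> carr A \<Longrightarrow> f (smul A c x) = smul B c (f x)"
  using assms by (simp_all add: linear_map_def)

lemma vspace_closed:
  assumes "vspace A"
  shows "0 \<in> carr A" "x \<in> carr A \<Longrightarrow> y \<in> carr A \<Longrightarrow> x + y \<in> carr A"
    "x \<in> carr A \<Longrightarrow> smul A c x \<in> carr A"
proof -
  interpret vector_space "smul A" using assms by (simp add: vspace_def)
  have "subspace (carr A)" using assms by (simp add: vspace_def)
  then show "0 \<in> carr A" "x \<in> carr A \<Longrightarrow> y \<in> carr A \<Longrightarrow> x + y \<in> carr A"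
    "x \<in> carr A \<Longrightarrow> smul A c x \<in> carr A"
    by (auto intro: subspace_0 subspace_add subspace_scale)
qed

lemma linear_map_0:
  assumes "linear_map A B f" "vspace A" shows "f 0 = 0"
  using linear_mapD(2)[OF assms(1), of 0 0] vspace_closed(1)[OF assms(2)] by simp

lemma linear_map_sum:
  assumes "linear_map A B f" "vspace A" "\<And>x. x \<in> X \<Longrightarrow> g x \<in> carr A"
  shows "f (\<Sum>x\<in>X. g x) = (\<Sum>x\<in>X. f (g x))"
proof -
  have "f (\<Sum>x\<in>X. g x) = (\<Sum>x\<in>X. f (g x)) \<and> (\<Sum>x\<in>X. g x) \<in> carr A"
    using assms(3)
    by (induction X rule: infinite_finite_induct)
      (auto simp: linear_map_0[OF assms(1,2)] linear_mapD(2)[OF assms(1)] vspace_closed[OF assms(2)])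
  then show ?thesis ..
qed

lemma linear_map_comp: "linear_map A B f \<Longrightarrow> linear_map B C g \<Longrightarrow> linear_map A C (\<lambda>x. g (f x))"
  by (simp add: linear_map_def)

lemma linear_map_id: "linear_map A A id" "linear_map A A (\<lambda>x. x)"
  by (simp_all add: linear_map_def)

lemma linear_map_zero: "vspace B \<Longrightarrow> linear_map A B (\<lambda>_. 0)"
proof -
  assume B: "vspace B"
  interpret vector_space "smul B" using B by (simp add: vspace_def)
  show ?thesis by (rule linear_mapI) (auto simp: vspace_closed[OF B])
qed

lemma linear_map_plus:
  assumes "linear_map A B f" "linear_map A B g" "vspace B"
  shows "linear_map A B (\<lambda>x. f x + g x)"
proof -
  interpret vector_space "smul B" using assms by (simp add: vspace_def)
  show ?thesis
    using assms by (intro linear_mapI) (auto simp: linear_map_def vspace_closed scale_right_distrib)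
qed

lemma linear_map_scale:
  assumes "linear_map A B f" "vspace B"
  shows "linear_map A B (\<lambda>x. smul B c (f x))"
proof -
  interpret vector_space "smul B" using assms by (simp add: vspace_def)
  show ?thesis
    using assms
    by (intro linear_mapI)
      (auto simp: linear_map_def vspace_closed scale_right_distrib mult.commute)
qed

lemma linear_map_sum_fun:
  assumes "\<And>i. i \<in> I \<Longrightarrow> linear_map A B (f i)" "vspace B"
  shows "linear_map A B (\<lambda>x. \<Sum>i\<in>I. f i x)"
  using assms(1)
  by (induction I rule: infinite_finite_induct)
    (auto intro!: linear_map_zero linear_map_plus assms(2))

lemma linear_map_cong:
  assumes "linear_map A B f" "\<And>x. x \<in> carr A \<Longrightarrow> g x = f x" "vspace A"
  shows "linear_map A B g"
  using assms by (auto simp: linear_map_def vspace_closed)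

lemma linear_map_into_tens: "linear_map A (tpow V n) f \<Longrightarrow> linear_map A (tens V) f"
  by (auto simp: linear_map_def tpow_tens)

lemma linear_map_from_tens: "linear_map (tens V) W f \<Longrightarrow> linear_map (tpow V n) W f"
  by (auto simp: linear_map_def tpow_tens)

lemma linear_map_eqI:
  assumes "linear_map (tspan V D) W f" "linear_map (tspan V D) W g"
    "\<And>xs. xs \<in> D \<Longrightarrow> f (pten V xs) = g (pten V xs)" "u \<in> carr (tspan V D)"
  shows "f u = g u"
  using assms(4)
proof (induction rule: tspan_induct)
  case zero
  show ?case by (simp only: linear_map_0[OF assms(1) vspace_tspan] linear_map_0[OF assms(2) vspace_tspan])
next
  case (add s t)
  then show ?case by (simp only: linear_mapD(2)[OF assms(1)] linear_mapD(2)[OF assms(2)])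
next
  case (scale c s)
  then show ?case using linear_mapD(3)[OF assms(1), of s c] linear_mapD(3)[OF assms(2), of s c] by simp
qed (rule assms(3))

lemmas tpow_eqI = linear_map_eqI[where V = V and D = "nwords V n" for V n, folded tpow_def]
lemmas tens_eqI = linear_map_eqI[where V = V and D = "words V" for V, folded tens_def]

lemma linear_map_range:
  assumes "linear_map (tspan V D) W f" "\<And>xs. xs \<in> D \<Longrightarrow> f (pten V xs) \<in> carr W'"
    "vspace W'" "smul W' = smul W"
  shows "linear_map (tspan V D) W' f"
proof (rule linear_mapI)
  fix u assume "u \<in> carr (tspan V D)"
  then show "f u \<in> carr W'"
  proof (induction rule: tspan_induct)
    case zero
    show ?case by (simp only: linear_map_0[OF assms(1) vspace_tspan] vspace_closed(1)[OF assms(3)])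
  next
    case (add s t)
    then show ?case by (simp only: linear_mapD(2)[OF assms(1)] vspace_closed(2)[OF assms(3)])
  next
    case (scale c s)
    then show ?case
      using linear_mapD(3)[OF assms(1), of s c] vspace_closed(3)[OF assms(3), of "f s" c]
      by (simp add: assms(4))
  qed (rule assms(2))
qed (use assms in \<open>auto simp: linear_map_def\<close>)

definition bilinear_map where
  "bilinear_map A B W f \<longleftrightarrow> (\<forall>s\<in>carr A. linear_map B W (f s)) \<and> (\<forall>t\<in>carr B. linear_map A W (\<lambda>s. f s t))"

lemma bilinear_mapD:
  assumes "bilinear_map A B W f"
  shows "s \<in> carr A \<Longrightarrow> linear_map B W (f s)" "t \<in> carr B \<Longrightarrow> linear_map A W (\<lambda>s. f s t)"
  using assms by (simp_all add: bilinear_map_def)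

lemma bilinear_map_comp:
  assumes "bilinear_map A B W f" "linear_map A' A F" "linear_map B' B G"
  shows "bilinear_map A' B' W (\<lambda>s t. f (F s) (G t))"
  using assms linear_mapD(1)[OF assms(2)] linear_mapD(1)[OF assms(3)]
  unfolding bilinear_map_def
  by (auto intro: linear_map_comp[of B' B _ W] linear_map_comp[of A' A _ W "\<lambda>s. f s (G t)" for t])

section \<open>The product of the tensor algebra\<close>

lemma words_append [simp]: "xs @ ys \<in> words V \<longleftrightarrow> xs \<in> words V \<and> ys \<in> words V"
  by (auto simp: words_def)

lemma words_Cons [simp]: "x # ys \<in> words V \<longleftrightarrow> x \<in> carr V \<and> ys \<in> words V"
  by (auto simp: words_def)

lemma words_Nil [simp]: "[] \<in> words V"
  by (auto simp: words_def)

lemma nwords_words: "xs \<in> nwords V n \<Longrightarrow> xs \<in> words V"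
  by (simp add: nwords_def)

text \<open>
  Multilinearity is linearity in each slot, so that multilinear maps can be composed with linear ones.
\<close>

lemma multilinearI:
  assumes V: "vspace V" and D: "D = words V \<or> D = nwords V n"
    and g: "\<And>xs. xs \<in> D \<Longrightarrow> g xs \<in> carr W"
    and lin: "\<And>us vs. (\<And>x. x \<in> carr V \<Longrightarrow> us @ x # vs \<in> D) \<Longrightarrow> linear_map V W (\<lambda>x. g (us @ x # vs))"
  shows "multilinear V D W g"
  unfolding multilinear_def
proof (intro conjI ballI allI impI)
  fix us vs x y assume x: "x \<in> carr V" and y: "y \<in> carr V" and "us @ x # vs \<in> D"
  then have "linear_map V W (\<lambda>x. g (us @ x # vs))" using words_exchange[OF D x] by (intro lin) blast
  from linear_mapD(2)[OF this x y] show "g (us @ (x + y) # vs) = g (us @ x # vs) + g (us @ y # vs)" .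
next
  fix c us vs x assume x: "x \<in> carr V" and "us @ x # vs \<in> D"
  then have "linear_map V W (\<lambda>x. g (us @ x # vs))" using words_exchange[OF D x] by (intro lin) blast
  from linear_mapD(3)[OF this x] show "g (us @ smul V c x # vs) = smul W c (g (us @ x # vs))" .
qed (rule g)

lemma linear_pten_slot:
  assumes V: "vspace V" and D: "D = words V \<or> D = nwords V n"
    and w: "\<And>x. x \<in> carr V \<Longrightarrow> us @ x # vs \<in> D"
  shows "linear_map V (tspan V D) (\<lambda>x. pten V (us @ x # vs))"
  using multilinear_pten[OF V D] w unfolding multilinear_def by (intro linear_mapI) blast+

lemmas linear_pten_tpow = linear_pten_slot[OF _ disjI2[OF HOL.refl], folded tpow_def]
lemmas linear_pten_tens = linear_pten_slot[OF _ disjI1[OF HOL.refl], folded tens_def]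

lemma multilinear_append_left:
  assumes "vspace V" "xs \<in> words V"
  shows "multilinear V (words V) (tens V) (\<lambda>ys. pten V (xs @ ys))"
  using assms linear_pten_tens[of V "xs @ us" for us] by (intro multilinearI) (auto intro: pten_tens)

lemma linear_append_left:
  assumes "vspace V" "xs \<in> words V"
  shows "linear_map (tens V) (tens V) (lin_ext V (words V) (tens V) (\<lambda>ys. pten V (xs @ ys)))"
  using linear_map_lin_ext[OF assms(1) vspace_tens _ multilinear_append_left[OF assms]]
  by (simp add: tens_def)

lemma append_left_pten:
  assumes "vspace V" "xs \<in> words V" "ys \<in> words V"
  shows "lin_ext V (words V) (tens V) (\<lambda>ys. pten V (xs @ ys)) (pten V ys) = pten V (xs @ ys)"
  by (rule lin_ext_pten[OF assms(1) vspace_tens _ multilinear_append_left]) (use assms in auto)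

lemma multilinear_append:
  assumes V: "vspace V" and t: "t \<in> carr (tens V)"
  shows "multilinear V (words V) (tens V) (\<lambda>xs. lin_ext V (words V) (tens V) (\<lambda>ys. pten V (xs @ ys)) t)"
proof (rule multilinearI[OF V disjI1[OF HOL.refl]])
  let ?L = "\<lambda>xs. lin_ext V (words V) (tens V) (\<lambda>ys. pten V (xs @ ys))"
  note L = linear_append_left[OF V]
  fix us vs assume w: "\<And>x. x \<in> carr V \<Longrightarrow> us @ x # vs \<in> words V"
  note cong = linear_map_cong[OF _ _ V]
  show "linear_map V (tens V) (\<lambda>x. ?L (us @ x # vs) t)"
    using t
  proof (induction rule: tens_induct)
    case (pten zs)
    then show ?case
      using w append_left_pten[OF V w pten] by (intro cong[OF linear_pten_tens[OF V, of us "vs @ zs"]]) auto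
  next
    case zero
    show ?case
      by (rule cong[OF linear_map_zero[OF vspace_tens]]) (rule linear_map_0[OF L[OF w] vspace_tens])
  next
    case (add s t)
    show ?case
      by (rule cong[OF linear_map_plus[OF add(3,4) vspace_tens]]) (rule linear_mapD(2)[OF L[OF w] add(1,2)])
  next
    case (scale c s)
    show ?case
      using linear_mapD(3)[OF L[OF w] scale(1)]
      by (intro cong[OF linear_map_scale[OF scale(2) vspace_tens, where c = c]]) simp
  qed
qed (rule linear_mapD(1)[OF linear_append_left[OF V] t])

lemma tmul_bilinear:
  assumes V: "vspace V"
  shows "bilinear_map (tens V) (tens V) (tens V) (tmul V)"
proof -
  have lin1: "linear_map (tens V) (tens V) (\<lambda>s. tmul V s t)" if "t \<in> carr (tens V)" for t
    using linear_map_lin_ext[OF V vspace_tens _ multilinear_append[OF V that]]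
    by (simp add: tens_def[of V] tmul_def[abs_def])
  have p: "tmul V (pten V xs) t = lin_ext V (words V) (tens V) (\<lambda>ys. pten V (xs @ ys)) t"
    if "xs \<in> words V" "t \<in> carr (tens V)" for xs t
    unfolding tmul_def
    by (rule lin_ext_pten[OF V vspace_tens _ multilinear_append[OF V that(2)] that(1)]) simp
  have "linear_map (tens V) (tens V) (tmul V s)" if s: "s \<in> carr (tens V)" for s
  proof (rule linear_mapI)
    fix t t' assume t: "t \<in> carr (tens V)" "t' \<in> carr (tens V)"
    show "tmul V s (t + t') = tmul V s t + tmul V s t'"
      by (rule tens_eqI[OF lin1 linear_map_plus[OF lin1 lin1 vspace_tens] _ s])
        (use t in \<open>auto simp: p tens_closed linear_mapD(2)[OF linear_append_left[OF V]]\<close>)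
  next
    fix c t assume t: "t \<in> carr (tens V)"
    show "tmul V s (smul (tens V) c t) = smul (tens V) c (tmul V s t)"
      by (rule tens_eqI[OF lin1 linear_map_scale[OF lin1 vspace_tens] _ s])
        (use t linear_mapD(3)[OF linear_append_left[OF V]] in \<open>auto simp: p tens_closed\<close>)
  qed (rule linear_mapD(1)[OF lin1 s])
  with lin1 show ?thesis by (simp add: bilinear_map_def)
qed

lemma tmul_pten:
  assumes V: "vspace V" "xs \<in> words V" "ys \<in> words V"
  shows "tmul V (pten V xs) (pten V ys) = pten V (xs @ ys)"
proof -
  have t: "pten V ys \<in> carr (tens V)" using assms by (intro pten_tens)
  have "tmul V (pten V xs) (pten V ys) = lin_ext V (words V) (tens V) (\<lambda>ys. pten V (xs @ ys)) (pten V ys)"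
    unfolding tmul_def
    by (rule lin_ext_pten[OF V(1) vspace_tens _ multilinear_append[OF V(1) t] V(2)]) simp
  then show ?thesis by (simp add: append_left_pten assms)
qed

lemma tmul_tens:
  "vspace V \<Longrightarrow> s \<in> carr (tens V) \<Longrightarrow> t \<in> carr (tens V) \<Longrightarrow> tmul V s t \<in> carr (tens V)"
  using linear_mapD(1)[OF bilinear_mapD(1)[OF tmul_bilinear]] .

lemma linear_tmul_left: "vspace V \<Longrightarrow> t \<in> carr (tens V) \<Longrightarrow> linear_map (tens V) (tens V) (\<lambda>s. tmul V s t)"
  by (rule bilinear_mapD(2)[OF tmul_bilinear])

lemma linear_tmul_right: "vspace V \<Longrightarrow> s \<in> carr (tens V) \<Longrightarrow> linear_map (tens V) (tens V) (tmul V s)"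
  by (rule bilinear_mapD(1)[OF tmul_bilinear])

lemma tmul_scale:
  assumes "vspace V" "s \<in> carr (tens V)" "t \<in> carr (tens V)"
  shows "tmul V (tscale c s) t = tscale c (tmul V s t)" "tmul V s (tscale c t) = tscale c (tmul V s t)"
  using linear_mapD(3)[OF linear_tmul_left[OF assms(1,3)], of s c]
    linear_mapD(3)[OF linear_tmul_right[OF assms(1,2)], of t c] assms by simp_all

lemma tmul_zero:
  assumes "vspace V" "s \<in> carr (tens V)"
  shows "tmul V 0 s = 0" "tmul V s 0 = 0"
  using linear_map_0[OF linear_tmul_left[OF assms] vspace_tens]
    linear_map_0[OF linear_tmul_right[OF assms] vspace_tens] by simp_all

lemma tmul_assoc:
  assumes V: "vspace V" and s: "s \<in> carr (tens V)" and t: "t \<in> carr (tens V)" and u: "u \<in> carr (tens V)"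
  shows "tmul V (tmul V s t) u = tmul V s (tmul V t u)"
proof (rule tens_eqI[OF _ _ _ s])
  show "linear_map (tens V) (tens V) (\<lambda>s. tmul V (tmul V s t) u)"
    by (rule linear_map_comp[OF linear_tmul_left[OF V t] linear_tmul_left[OF V u]])
  show "linear_map (tens V) (tens V) (\<lambda>s. tmul V s (tmul V t u))"
    by (rule linear_tmul_left[OF V tmul_tens[OF V t u]])
  fix xs assume xs: "xs \<in> words V"
  show "tmul V (tmul V (pten V xs) t) u = tmul V (pten V xs) (tmul V t u)"
  proof (rule tens_eqI[OF _ _ _ t])
    show "linear_map (tens V) (tens V) (\<lambda>t. tmul V (tmul V (pten V xs) t) u)"
      by (rule linear_map_comp[OF linear_tmul_right[OF V pten_tens[OF xs]] linear_tmul_left[OF V u]])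
    show "linear_map (tens V) (tens V) (\<lambda>t. tmul V (pten V xs) (tmul V t u))"
      by (rule linear_map_comp[OF linear_tmul_left[OF V u] linear_tmul_right[OF V pten_tens[OF xs]]])
    fix ys assume ys: "ys \<in> words V"
    show "tmul V (tmul V (pten V xs) (pten V ys)) u = tmul V (pten V xs) (tmul V (pten V ys) u)"
    proof (rule tens_eqI[OF _ _ _ u])
      show "linear_map (tens V) (tens V) (tmul V (tmul V (pten V xs) (pten V ys)))"
        using xs ys by (intro linear_tmul_right[OF V] tmul_tens[OF V] pten_tens)
      show "linear_map (tens V) (tens V) (\<lambda>u. tmul V (pten V xs) (tmul V (pten V ys) u))"
        using xs ys
        by (intro linear_map_comp[OF linear_tmul_right[OF V pten_tens] linear_tmul_right[OF V pten_tens]])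
    qed (use xs ys in \<open>simp add: tmul_pten[OF V]\<close>)
  qed
qed

lemma tmul_Nil_left:
  assumes V: "vspace V" and s: "s \<in> carr (tens V)" shows "tmul V (pten V []) s = s"
  by (rule tens_eqI[OF linear_tmul_right[OF V pten_tens] linear_map_id(2) _ s])
    (simp_all add: tmul_pten[OF V])

lemma tmul_Nil_right:
  assumes V: "vspace V" and s: "s \<in> carr (tens V)" shows "tmul V s (pten V []) = s"
  by (rule tens_eqI[OF linear_tmul_left[OF V pten_tens] linear_map_id(2) _ s])
    (simp_all add: tmul_pten[OF V])

lemma linear_tmul_tpow_left:
  assumes V: "vspace V" and t: "t \<in> pow V b"
  shows "linear_map (tpow V a) (tpow V (a + b)) (\<lambda>s. tmul V s t)"
  unfolding tpow_def[of V a]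
proof (rule linear_map_range)
  show "linear_map (tspan V (nwords V a)) (tens V) (\<lambda>s. tmul V s t)"
    using linear_map_from_tens[OF linear_tmul_left[OF V tpow_tens[OF t]], of a] by (simp add: tpow_def)
  fix xs assume xs: "xs \<in> nwords V a"
  have "linear_map (tpow V b) (tpow V (a + b)) (tmul V (pten V xs))"
    unfolding tpow_def[of V b]
  proof (rule linear_map_range)
    show "linear_map (tspan V (nwords V b)) (tens V) (tmul V (pten V xs))"
      using linear_map_from_tens[OF linear_tmul_right[OF V pten_tens[OF nwords_words[OF xs]]], of b]
      by (simp add: tpow_def)
    fix ys assume "ys \<in> nwords V b"
    then show "tmul V (pten V xs) (pten V ys) \<in> pow V (a + b)"
      using xs by (auto simp: nwords_def tmul_pten[OF V] intro: pten_tpow)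
  qed (simp_all add: vspace_tpow)
  from linear_mapD(1)[OF this t]
  show "tmul V (pten V xs) t \<in> pow V (a + b)" .
qed (simp_all add: vspace_tpow)

lemma tmul_tpow:
  "vspace V \<Longrightarrow> s \<in> pow V a \<Longrightarrow> t \<in> pow V b \<Longrightarrow> tmul V s t \<in> pow V (a + b)"
  by (rule linear_mapD(1)[OF linear_tmul_tpow_left])

lemma linear_tmul_tpow_right:
  assumes V: "vspace V" and s: "s \<in> pow V a"
  shows "linear_map (tpow V b) (tpow V (a + b)) (tmul V s)"
  using linear_map_from_tens[OF linear_tmul_right[OF V tpow_tens[OF s]], of b]
  by (auto simp: linear_map_def tmul_tpow[OF V s])

lemma tmul_bilinear_tpow:
  "vspace V \<Longrightarrow> bilinear_map (tpow V a) (tpow V b) (tpow V (a + b)) (tmul V)"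
  by (simp add: bilinear_map_def linear_tmul_tpow_left linear_tmul_tpow_right)

lemma nwords_split:
  assumes "vspace V" "xs \<in> nwords V (a + b)"
  shows "take a xs \<in> nwords V a" "drop a xs \<in> nwords V b"
    "pten V xs = tmul V (pten V (take a xs)) (pten V (drop a xs))"
proof -
  have "take a xs @ drop a xs \<in> words V" using assms(2) by (simp add: nwords_def)
  then have *: "take a xs \<in> words V" "drop a xs \<in> words V" by (simp_all only: words_append)
  then show "take a xs \<in> nwords V a" "drop a xs \<in> nwords V b"
    using assms(2) by (simp_all add: nwords_def)
  show "pten V xs = tmul V (pten V (take a xs)) (pten V (drop a xs))"
    by (simp add: tmul_pten assms *)
qed

lemma tpow_tmul_eqI:
  assumes V: "vspace V" and "linear_map (tpow V (a + b)) W f" "linear_map (tpow V (a + b)) W g"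
    "\<And>s t. s \<in> pow V a \<Longrightarrow> t \<in> pow V b \<Longrightarrow> f (tmul V s t) = g (tmul V s t)"
    "u \<in> pow V (a + b)"
  shows "f u = g u"
  using assms(2,3)
  by (rule tpow_eqI[OF _ _ _ assms(5)])
    (metis assms(4) nwords_split[OF V] pten_tpow)

lemma multilinear_bilinear:
  assumes V: "vspace V" and f: "bilinear_map (tpow V a) (tpow V b) W f"
  shows "multilinear V (nwords V (a + b)) W (\<lambda>ws. f (pten V (take a ws)) (pten V (drop a ws)))"
proof (rule multilinearI[OF V disjI2[OF HOL.refl]])
  fix us vs assume w: "\<And>x. x \<in> carr V \<Longrightarrow> us @ x # vs \<in> nwords V (a + b)"
  have 0: "us @ 0 # vs \<in> nwords V (a + b)" by (rule w[OF vspace_closed(1)[OF V]])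
  show "linear_map V W (\<lambda>x. f (pten V (take a (us @ x # vs))) (pten V (drop a (us @ x # vs))))"
  proof (cases "length us < a")
    case True
    then obtain k where k: "a = length us + Suc k" by (metis add_Suc_right less_imp_Suc_add)
    have "us @ x # take k vs \<in> nwords V a" if "x \<in> carr V" for x
      using nwords_split(1)[OF V w[OF that]] by (simp add: k)
    moreover have "pten V (drop k vs) \<in> pow V b"
      using nwords_split(2)[OF V 0] by (simp add: k pten_tpow)
    ultimately show ?thesis
      using linear_map_comp[OF linear_pten_tpow[OF V] bilinear_mapD(2)[OF f]] by (simp add: k)
  next
    case False
    have "drop a us @ x # vs \<in> nwords V b" if "x \<in> carr V" for x
      using nwords_split(2)[OF V w[OF that]] False by simp
    moreover have "pten V (take a us) \<in> pow V a"
      using nwords_split(1)[OF V 0] False by (simp add: pten_tpow)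
    ultimately show ?thesis
      using linear_map_comp[OF linear_pten_tpow[OF V] bilinear_mapD(1)[OF f]] False by simp
  qed
next
  fix xs assume "xs \<in> nwords V (a + b)"
  then show "f (pten V (take a xs)) (pten V (drop a xs)) \<in> carr W"
    by (intro linear_mapD(1)[OF bilinear_mapD(1)[OF f]] pten_tpow nwords_split[OF V])
qed

text \<open>
  The linear map on \<open>V\<^bsup>\<otimes>(a+b)\<^esup> = V\<^bsup>\<otimes>a\<^esup> \<otimes> V\<^bsup>\<otimes>b\<^esup>\<close> induced by a bilinear map.
\<close>

definition split_map where
  "split_map V a b W f = lin_ext V (nwords V (a + b)) W (\<lambda>ws. f (pten V (take a ws)) (pten V (drop a ws)))"

lemma split_map_linear:
  assumes V: "vspace V" and W: "vspace W" and f: "bilinear_map (tpow V a) (tpow V b) W f"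
  shows "linear_map (tpow V (a + b)) W (split_map V a b W f)"
  unfolding tpow_def split_map_def
  by (rule linear_map_lin_ext[OF V W disjI2[OF HOL.refl] multilinear_bilinear[OF V f]])

lemma split_map_tmul:
  assumes V: "vspace V" and W: "vspace W" and f: "bilinear_map (tpow V a) (tpow V b) W f"
    and s: "s \<in> pow V a" and t: "t \<in> pow V b"
  shows "split_map V a b W f (tmul V s t) = f s t"
proof -
  note lin = split_map_linear[OF V W f]
  show ?thesis
  proof (rule tpow_eqI[OF _ bilinear_mapD(2)[OF f t] _ s])
    show "linear_map (tpow V a) W (\<lambda>s. split_map V a b W f (tmul V s t))"
      by (rule linear_map_comp[OF linear_tmul_tpow_left[OF V t] lin])
    fix xs assume xs: "xs \<in> nwords V a"
    show "split_map V a b W f (tmul V (pten V xs) t) = f (pten V xs) t"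
    proof (rule tpow_eqI[OF _ bilinear_mapD(1)[OF f pten_tpow[OF xs]] _ t])
      show "linear_map (tpow V b) W (\<lambda>t. split_map V a b W f (tmul V (pten V xs) t))"
        by (rule linear_map_comp[OF linear_tmul_tpow_right[OF V pten_tpow[OF xs]] lin])
      fix ys assume ys: "ys \<in> nwords V b"
      have "xs @ ys \<in> nwords V (a + b)" using xs ys by (auto simp: nwords_def)
      from lin_ext_pten[OF V W disjI2[OF HOL.refl] multilinear_bilinear[OF V f] this]
      show "split_map V a b W f (tmul V (pten V xs) (pten V ys)) = f (pten V xs) (pten V ys)"
        using xs ys by (auto simp: split_map_def nwords_def tmul_pten[OF V])
    qed
  qed
qed

lemma op_tensor_split: "op_tensor V a b F G = split_map V a b (tens V) (\<lambda>s t. tmul V (F s) (G t))"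
  by (simp add: op_tensor_def split_map_def)

lemma op_tensor_bilinear:
  assumes "vspace V" "linear_map (tpow V a) (tpow V a') F" "linear_map (tpow V b) (tpow V b') G"
  shows "bilinear_map (tpow V a) (tpow V b) (tens V) (\<lambda>s t. tmul V (F s) (G t))"
  by (rule bilinear_map_comp[OF tmul_bilinear[OF assms(1)] assms(2,3)[THEN linear_map_into_tens]])

lemma op_tensor_tmul:
  assumes "vspace V" "linear_map (tpow V a) (tpow V a') F" "linear_map (tpow V b) (tpow V b') G"
    "s \<in> pow V a" "t \<in> pow V b"
  shows "op_tensor V a b F G (tmul V s t) = tmul V (F s) (G t)"
  unfolding op_tensor_split
  by (rule split_map_tmul[OF assms(1) vspace_tens op_tensor_bilinear[OF assms(1-3)] assms(4,5)])

lemma op_tensor_linear: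
  assumes V: "vspace V" and F: "linear_map (tpow V a) (tpow V a') F" and G: "linear_map (tpow V b) (tpow V b') G"
  shows "linear_map (tpow V (a + b)) (tpow V (a' + b')) (op_tensor V a b F G)"
  unfolding tpow_def[of V "a + b"]
proof (rule linear_map_range)
  show "linear_map (tspan V (nwords V (a + b))) (tens V) (op_tensor V a b F G)"
    using split_map_linear[OF V vspace_tens op_tensor_bilinear[OF assms]]
    by (simp add: op_tensor_split tpow_def)
  fix xs assume xs: "xs \<in> nwords V (a + b)"
  show "op_tensor V a b F G (pten V xs) \<in> pow V (a' + b')"
    unfolding nwords_split(3)[OF V xs]
    using xs by (subst op_tensor_tmul[OF V F G])
      (auto intro!: pten_tpow tmul_tpow[OF V] linear_mapD(1)[OF F] linear_mapD(1)[OF G] nwords_split[OF V])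
qed (simp_all add: vspace_tpow)

section \<open>The operators of braid words\<close>

lemma tpow_tmul3_eqI:
  assumes V: "vspace V" and f: "linear_map (tpow V (a + (b + c))) W f" and g: "linear_map (tpow V (a + (b + c))) W g"
    and eq: "\<And>s t u. s \<in> pow V a \<Longrightarrow> t \<in> pow V b \<Longrightarrow> u \<in> pow V c \<Longrightarrow>
      f (tmul V s (tmul V t u)) = g (tmul V s (tmul V t u))"
    and w: "w \<in> pow V (a + (b + c))"
  shows "f w = g w"
proof (rule tpow_tmul_eqI[OF V f g _ w])
  fix s v assume s: "s \<in> pow V a" and v: "v \<in> pow V (b + c)"
  show "f (tmul V s v) = g (tmul V s v)"
    by (rule tpow_tmul_eqI[OF V linear_map_comp[OF linear_tmul_tpow_right[OF V s] f]
          linear_map_comp[OF linear_tmul_tpow_right[OF V s] g] _ v])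
      (rule eq[OF s])
qed

text \<open>
  The locale will be used for \<open>R\<close> with \<open>q\<close> and for the inverse of \<open>R\<close> with \<open>inverse q\<close>, so that the
  operators of the inverse generators obey the same rules as those of the generators.
\<close>

locale square_op =
  fixes q :: "'k::field" and V :: "('k, 'v::ab_group_add) lspace"
    and R :: "('k, 'v) ten \<Rightarrow> ('k, 'v) ten"
  assumes V: "vspace V" and R: "linear_map (tpow V 2) (tpow V 2) R"
begin

lemma R_id_linear: "linear_map (tpow V (2 + m)) (tpow V (2 + m)) (op_tensor V 2 m R id)"
  by (rule op_tensor_linear[OF V R linear_map_id(1)])

lemma sigma_op_eq:
  "sigma_op q V R (i + (2 + m)) i u = tscale q (op_tensor V i (2 + m) id (op_tensor V 2 m R id) u)"
  by (simp add: sigma_op_def)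

lemma sigma_op_linear:
  assumes "i + 2 \<le> n"
  shows "linear_map (tpow V n) (tpow V n) (sigma_op q V R n i)"
proof -
  obtain m where n: "n = i + (2 + m)" using assms by (metis add.assoc le_Suc_ex)
  have "linear_map (tpow V n) (tpow V n) (op_tensor V i (2 + m) id (op_tensor V 2 m R id))"
    unfolding n by (rule op_tensor_linear[OF V linear_map_id(1) R_id_linear])
  moreover have "sigma_op q V R n i =
      (\<lambda>u. smul (tpow V n) q (op_tensor V i (2 + m) id (op_tensor V 2 m R id) u))"
    unfolding n by (rule ext) (simp only: sigma_op_eq smul_tspan)
  ultimately show ?thesis by (simp only: linear_map_scale vspace_tpow)
qed

lemma sigma_op_tmul:
  assumes "s \<in> pow V i" "t \<in> pow V 2" "u \<in> pow V m"
  shows "sigma_op q V R (i + (2 + m)) i (tmul V s (tmul V t u)) = tscale q (tmul V s (tmul V (R t) u))"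
  unfolding sigma_op_eq
    op_tensor_tmul[OF V linear_map_id(1) R_id_linear assms(1) tmul_tpow[OF V assms(2,3)]]
    op_tensor_tmul[OF V R linear_map_id(1) assms(2,3)] by simp

lemma sigma_op_ext:
  assumes "i + 2 \<le> n" and v: "v \<in> pow V m" and s: "s \<in> pow V n" and w: "w \<in> pow V l"
  shows "sigma_op q V R (m + n + l) (m + i) (tmul V v (tmul V s w)) = tmul V v (tmul V (sigma_op q V R n i s) w)"
proof -
  obtain k where n: "n = i + (2 + k)" using assms(1) by (metis add.assoc le_Suc_ex)
  have N: "m + n + l = m + i + (2 + (k + l))" by (simp add: n)
  have sw: "linear_map (tpow V n) (tpow V (m + n + l)) (\<lambda>s. tmul V v (tmul V s w))"
    using linear_map_comp[OF linear_tmul_tpow_left[OF V w] linear_tmul_tpow_right[OF V v]]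
    by (simp add: add.assoc)
  have 1: "linear_map (tpow V n) (tpow V (m + n + l))
      (\<lambda>s. sigma_op q V R (m + n + l) (m + i) (tmul V v (tmul V s w)))"
    by (rule linear_map_comp[OF sw sigma_op_linear]) (simp add: n)
  have 2: "linear_map (tpow V n) (tpow V (m + n + l)) (\<lambda>s. tmul V v (tmul V (sigma_op q V R n i s) w))"
    by (rule linear_map_comp[OF sigma_op_linear sw]) (simp add: n)
  show ?thesis
  proof (rule tpow_tmul3_eqI[OF V 1[unfolded n] 2[unfolded n] _ s[unfolded n], folded n])
    fix a b c assume abc: "a \<in> pow V i" "b \<in> pow V 2" "c \<in> pow V k"
    note T = abc[THEN tpow_tens] v[THEN tpow_tens] w[THEN tpow_tens] linear_mapD(1)[OF R abc(2), THEN tpow_tens]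
    have a: "tmul V v (tmul V (tmul V a (tmul V x c)) w) = tmul V (tmul V v a) (tmul V x (tmul V c w))"
      if "x \<in> carr (tens V)" for x
      using that by (simp add: tmul_assoc[OF V] tmul_tens[OF V] T)
    show "sigma_op q V R (m + n + l) (m + i) (tmul V v (tmul V (tmul V a (tmul V b c)) w)) =
        tmul V v (tmul V (sigma_op q V R n i (tmul V a (tmul V b c))) w)"
      unfolding a[OF T(2)] N sigma_op_tmul[OF tmul_tpow[OF V v abc(1)] abc(2) tmul_tpow[OF V abc(3) w]]
      unfolding n sigma_op_tmul[OF abc] a[OF T(6), symmetric]
      by (simp add: tmul_tens[OF V] tmul_scale[OF V] T)
  qed
qed

lemma pten_Nil: "pten V [] \<in> pow V 0"
  by (rule pten_tpow) (simp add: nwords_def)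

lemma sigma_op_ext_right:
  assumes "i + 2 \<le> n" and s: "s \<in> pow V n" and w: "w \<in> pow V m"
  shows "sigma_op q V R (n + m) i (tmul V s w) = tmul V (sigma_op q V R n i s) w"
  using sigma_op_ext[OF assms(1) pten_Nil s w] linear_mapD(1)[OF sigma_op_linear[OF assms(1)] s] s w
  by (simp add: tmul_Nil_left[OF V] tmul_tens[OF V] tpow_tens)

lemma sigma_op_ext_left:
  assumes "i + 2 \<le> n" and s: "s \<in> pow V n" and v: "v \<in> pow V m"
  shows "sigma_op q V R (m + n) (m + i) (tmul V v s) = tmul V v (sigma_op q V R n i s)"
  using sigma_op_ext[OF assms(1) v s pten_Nil] linear_mapD(1)[OF sigma_op_linear[OF assms(1)] s] s
  by (simp add: tmul_Nil_right[OF V] tpow_tens)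

end

lemma sigma_op_cancel:
  assumes "square_op V R" "square_op V R'" "\<And>u. u \<in> pow V 2 \<Longrightarrow> R (R' u) = u"
    "q * q' = 1" "i + 2 \<le> n" "u \<in> pow V n"
  shows "sigma_op q V R n i (sigma_op q' V R' n i u) = u"
proof -
  interpret A: square_op q V R by (rule assms)
  interpret B: square_op q' V R' by (rule assms)
  obtain m where n: "n = i + (2 + m)" using assms(5) by (metis add.assoc le_Suc_ex)
  have 1: "linear_map (tpow V (i + (2 + m))) (tpow V n) (\<lambda>u. sigma_op q V R n i (sigma_op q' V R' n i u))"
    unfolding n[symmetric]
    by (rule linear_map_comp[OF B.sigma_op_linear A.sigma_op_linear]) (use assms in auto)
  show ?thesis
  proof (rule tpow_tmul3_eqI[OF A.V 1 _ _ assms(6)[unfolded n]])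
    show "linear_map (tpow V (i + (2 + m))) (tpow V n) (\<lambda>u. u)" unfolding n by (rule linear_map_id)
    fix a b c assume abc: "a \<in> pow V i" "b \<in> pow V 2" "c \<in> pow V m"
    note Rb = linear_mapD(1)[OF B.R abc(2)]
    note RRb = linear_mapD(1)[OF A.R Rb]
    have x: "tmul V a (tmul V (R' b) c) \<in> pow V n"
      unfolding n by (intro tmul_tpow[OF A.V] abc Rb)
    have "sigma_op q V R n i (tscale q' (tmul V a (tmul V (R' b) c))) =
        tscale q' (sigma_op q V R n i (tmul V a (tmul V (R' b) c)))"
      using linear_mapD(3)[OF A.sigma_op_linear[OF assms(5)] x, of q'] by simp
    then show "sigma_op q V R n i (sigma_op q' V R' n i (tmul V a (tmul V b c))) = tmul V a (tmul V b c)"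
      using assms(3)[OF abc(2)] assms(4)
      unfolding n B.sigma_op_tmul[OF abc] A.sigma_op_tmul[OF abc(1) Rb abc(3)]
      by (simp add: mult.commute)
  qed
qed

locale braided_op =
  fixes q :: "'k::field" and V :: "('k, 'v::ab_group_add) lspace"
    and R :: "('k, 'v) ten \<Rightarrow> ('k, 'v) ten"
  assumes q: "q \<noteq> 0" and braided: "braided V R"
begin

sublocale square_op q V R
  using braided by unfold_locales (simp_all add: braided_def)

definition Ri where "Ri = inv_into (carr (tpow V 2)) R"

lemma R_bij: "bij_betw R (carr (tpow V 2)) (carr (tpow V 2))"
  using braided by (simp add: braided_def)

lemma Ri:
  assumes "u \<in> pow V 2"
  shows "R (Ri u) = u" "Ri (R u) = u" "Ri u \<in> pow V 2"
  using assms R_bij unfolding Ri_def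
  by (auto simp: bij_betw_inv_into_right bij_betw_inv_into_left bij_betw_def inv_into_into)

sublocale inverse_op: square_op "inverse q" V Ri
proof
  show "vspace V" by (rule V)
  show "linear_map (tpow V 2) (tpow V 2) Ri"
  proof (rule linear_mapI)
    fix x y assume xy: "x \<in> pow V 2" "y \<in> pow V 2"
    have "R (Ri x + Ri y) = x + y"
      using linear_mapD(2)[OF R Ri(3)[OF xy(1)] Ri(3)[OF xy(2)]] Ri(1) xy by simp
    then show "Ri (x + y) = Ri x + Ri y"
      using Ri(2)[OF tpow_closed(2)[OF Ri(3)[OF xy(1)] Ri(3)[OF xy(2)]]] by simp
  next
    fix c x assume x: "x \<in> pow V 2"
    have "R (tscale c (Ri x)) = tscale c x"
      using linear_mapD(3)[OF R Ri(3)[OF x], of c] Ri(1) x by simp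
    then show "Ri (smul (tpow V 2) c x) = smul (tpow V 2) c (Ri x)"
      using Ri(2)[OF tpow_closed(3)[OF Ri(3)[OF x]], of c] by simp
  qed (rule Ri(3))
qed

abbreviation sig where "sig \<equiv> sigma_op q V R"
abbreviation sig' where "sig' \<equiv> sigma_op (inverse q) V Ri"
abbreviation letter where "letter \<equiv> letter_op q V R"

lemma sig_inverse:
  assumes "i + 2 \<le> n" "u \<in> pow V n"
  shows "sig n i (sig' n i u) = u" "sig' n i (sig n i u) = u"
proof -
  note A = square_op_axioms and B = inverse_op.square_op_axioms
  show "sig n i (sig' n i u) = u"
    by (rule sigma_op_cancel[OF A B _ _ assms]) (simp_all add: q Ri)
  show "sig' n i (sig n i u) = u"
    by (rule sigma_op_cancel[OF B A _ _ assms]) (simp_all add: q Ri)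
qed

lemma letter_True: "letter n (i, True) = sig n i"
  by (simp add: letter_op_def)

lemma letter_False:
  assumes "i + 2 \<le> n" "u \<in> pow V n"
  shows "letter n (i, False) u = sig' n i u"
proof -
  note u' = linear_mapD(1)[OF inverse_op.sigma_op_linear[OF assms(1)] assms(2)]
  have "inj_on (sig n i) (carr (tpow V n))"
    by (rule inj_on_inverseI[of _ "sig' n i"]) (rule sig_inverse[OF assms(1)])
  from inv_into_f_f[OF this u'] show ?thesis
    by (simp add: letter_op_def sig_inverse[OF assms])
qed

lemma letter_linear:
  assumes "fst l + 2 \<le> n" shows "linear_map (tpow V n) (tpow V n) (letter n l)"
proof (cases l)
  case (Pair i b)
  show ?thesis
  proof (cases b)
    case True
    then show ?thesis using sigma_op_linear assms Pair by (simp add: letter_True)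
  next
    case False
    show ?thesis
      by (rule linear_map_cong[OF inverse_op.sigma_op_linear[of i n] _ vspace_tpow])
        (use letter_False assms Pair False in auto)
  qed
qed

lemma letter_ext_right:
  assumes "fst l + 2 \<le> n" "s \<in> pow V n" "v \<in> pow V m"
  shows "letter (n + m) l (tmul V s v) = tmul V (letter n l s) v"
proof (cases l)
  case (Pair i b)
  show ?thesis
    using assms tmul_tpow[OF V assms(2,3)]
    by (cases b) (auto simp: Pair letter_True letter_False sigma_op_ext_right inverse_op.sigma_op_ext_right)
qed

lemma letter_ext_left:
  assumes "fst l + 2 \<le> n" "s \<in> pow V n" "v \<in> pow V m"
  shows "letter (m + n) (m + fst l, snd l) (tmul V v s) = tmul V v (letter n l s)"
proof (cases l)
  case (Pair i b)
  show ?thesis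
    using assms tmul_tpow[OF V assms(3,2)]
    by (cases b) (auto simp: Pair letter_True letter_False sigma_op_ext_left inverse_op.sigma_op_ext_left)
qed

definition act where "act n w = foldr (\<lambda>l F. letter n l \<circ> F) w id"

lemma act_Nil [simp]: "act n [] u = u" and act_Cons [simp]: "act n (l # w) u = letter n l (act n w u)"
  by (simp_all add: act_def)

lemma act_append: "act n (v @ w) u = act n v (act n w u)"
  by (induction v) simp_all

lemma strand_words_simps [simp]:
  "[] \<in> strand_words n" "l # w \<in> strand_words n \<longleftrightarrow> fst l + 2 \<le> n \<and> w \<in> strand_words n"
  "v @ w \<in> strand_words n \<longleftrightarrow> v \<in> strand_words n \<and> w \<in> strand_words n"
  by (auto simp: strand_words_def)

lemma act_linear: "w \<in> strand_words n \<Longrightarrow> linear_map (tpow V n) (tpow V n) (act n w)"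
proof (induction w)
  case Nil
  then show ?case using linear_map_id(2) by (simp add: linear_map_def)
next
  case (Cons l w)
  have "act n (l # w) = (\<lambda>u. letter n l (act n w u))" by (rule ext) simp
  with Cons show ?case using linear_map_comp[OF Cons.IH letter_linear] by simp
qed

lemma act_ext_right:
  assumes "w \<in> strand_words n" "s \<in> pow V n" "v \<in> pow V m"
  shows "act (n + m) w (tmul V s v) = tmul V (act n w s) v"
  using assms(1)
  by (induction w) (use assms(2,3) in \<open>auto simp: letter_ext_right linear_mapD(1)[OF act_linear]\<close>)

lemma act_ext_left:
  assumes "w \<in> strand_words n" "s \<in> pow V n" "v \<in> pow V m"
  shows "act (m + n) (map (\<lambda>(i, b). (i + m, b)) w) (tmul V v s) = tmul V v (act n w s)"
  using assms(1)
proof (induction w)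
  case (Cons l w)
  then have "letter (m + n) (m + fst l, snd l) (tmul V v (act n w s)) = tmul V v (letter n l (act n w s))"
    using assms by (intro letter_ext_left linear_mapD(1)[OF act_linear]) auto
  with Cons show ?case by (simp add: case_prod_unfold add.commute)
qed simp

lemma sig_far:
  assumes "i + 2 \<le> j" "j + 2 \<le> n" "u \<in> pow V n"
  shows "sig n i (sig n j u) = sig n j (sig n i u)"
proof -
  obtain k where j: "j = (i + 2) + k" using assms(1) le_Suc_ex by blast
  obtain m where n: "n = (i + 2) + (k + (2 + m))" using assms(2) j by (metis add.assoc le_Suc_ex)
  let ?a = "i + 2" and ?b = "k + (2 + m)"
  have s: "linear_map (tpow V (?a + ?b)) (tpow V n) (sig n i)" "linear_map (tpow V (?a + ?b)) (tpow V n) (sig n j)"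
    unfolding n[symmetric] using assms by (auto intro: sigma_op_linear)
  note s' = s[unfolded n[symmetric]]
  show ?thesis
  proof (rule tpow_tmul_eqI[OF V linear_map_comp[OF s(2) s'(1)] linear_map_comp[OF s(1) s'(2)] _ assms(3)[unfolded n]])
    fix s t assume st: "s \<in> carr (tpow V ?a)" "t \<in> carr (tpow V ?b)"
    have si: "sig ?a i s \<in> carr (tpow V ?a)" by (rule linear_mapD(1)[OF sigma_op_linear st(1)]) simp
    have tk: "sig ?b k t \<in> carr (tpow V ?b)" by (rule linear_mapD(1)[OF sigma_op_linear st(2)]) simp
    have r: "sig n i (tmul V x y) = tmul V (sig ?a i x) y"
      if "x \<in> carr (tpow V ?a)" "y \<in> carr (tpow V ?b)" for x y
      unfolding n by (rule sigma_op_ext_right[OF _ that]) simp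
    have l: "sig n j (tmul V x y) = tmul V x (sig ?b k y)"
      if "x \<in> carr (tpow V ?a)" "y \<in> carr (tpow V ?b)" for x y
      unfolding n j by (rule sigma_op_ext_left[OF _ that(2,1)]) simp
    show "sig n i (sig n j (tmul V s t)) = sig n j (sig n i (tmul V s t))"
      using st si tk by (simp add: r l)
  qed
qed

lemma sig_3_0: "u \<in> pow V 3 \<Longrightarrow> sig 3 0 u = tscale q (op_tensor V 2 1 R id u)"
proof -
  assume u: "u \<in> pow V 3"
  have Rid: "linear_map (tpow V 3) (tpow V 3) (op_tensor V 2 1 R id)" using R_id_linear[of 1] by simp
  have "sig 3 0 (tmul V (pten V []) u) = tscale q (tmul V (pten V []) (op_tensor V 2 1 R id u))"
    using op_tensor_tmul[OF V linear_map_id(1) Rid pten_Nil u] by (simp add: sigma_op_def)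
  then show ?thesis
    using u linear_mapD(1)[OF Rid u] by (simp add: tmul_Nil_left[OF V] tpow_tens)
qed

lemma sig_3_1: "u \<in> pow V 3 \<Longrightarrow> sig 3 1 u = tscale q (op_tensor V 1 2 id R u)"
proof -
  assume u: "u \<in> pow V 3"
  have Rid: "op_tensor V 2 0 R id v = R v" if "v \<in> pow V 2" for v
    using op_tensor_tmul[OF V R linear_map_id(1) that pten_Nil] that linear_mapD(1)[OF R that]
    by (simp add: tmul_Nil_right[OF V] tpow_tens)
  have lin: "linear_map (tpow V 2) (tpow V 2) (op_tensor V 2 0 R id)" using R_id_linear[of 0] by simp
  have u': "u \<in> pow V (1 + 2)" using u by (simp del: One_nat_def)
  have "op_tensor V 1 2 id (op_tensor V 2 0 R id) u = op_tensor V 1 2 id R u"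
    by (rule tpow_tmul_eqI[OF V op_tensor_linear[OF V linear_map_id(1) lin] op_tensor_linear[OF V linear_map_id(1) R] _ u'])
      (auto simp: op_tensor_tmul[OF V linear_map_id(1) lin] op_tensor_tmul[OF V linear_map_id(1) R] Rid)
  then show ?thesis by (simp add: sigma_op_def numeral_eq_Suc)
qed

lemma sig_3_braid:
  assumes u: "u \<in> pow V 3"
  shows "sig 3 0 (sig 3 1 (sig 3 0 u)) = sig 3 1 (sig 3 0 (sig 3 1 u))"
proof -
  define A B where "A = op_tensor V 2 1 R id" and "B = op_tensor V 1 2 id R"
  have A: "linear_map (tpow V 3) (tpow V 3) A" and B: "linear_map (tpow V 3) (tpow V 3) B"
    using R_id_linear[of 1] op_tensor_linear[OF V linear_map_id(1) R, of 1]
    by (simp_all add: A_def B_def del: One_nat_def)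
  note c = linear_mapD(1)[OF A] linear_mapD(1)[OF B] tpow_closed(3)
  have AB: "A (tscale x v) = tscale x (A v)" "B (tscale x v) = tscale x (B v)"
    if "v \<in> pow V 3" for x v
    using linear_mapD(3)[OF A that, of x] linear_mapD(3)[OF B that, of x] by simp_all
  have "A (B (A u)) = B (A (B u))"
    using braided u by (simp add: braided_def yang_baxter_def Let_def A_def B_def)
  moreover have "sig 3 0 v = tscale q (A v)" "sig 3 1 v = tscale q (B v)" if "v \<in> pow V 3" for v
    using sig_3_0[OF that] sig_3_1[OF that] by (simp_all only: A_def B_def)
  ultimately show ?thesis using u by (simp add: c AB del: One_nat_def)
qed

lemma sig_braid:
  assumes "i + 3 \<le> n" and u: "u \<in> pow V n"
  shows "sig n i (sig n (Suc i) (sig n i u)) = sig n (Suc i) (sig n i (sig n (Suc i) u))"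
proof -
  obtain m where n: "n = i + (3 + m)" using assms(1) by (metis add.assoc le_Suc_ex)
  have s: "linear_map (tpow V (i + (3 + m))) (tpow V n) (sig n i)"
     "linear_map (tpow V (i + (3 + m))) (tpow V n) (sig n (Suc i))"
    unfolding n[symmetric] using assms by (auto intro: sigma_op_linear)
  note s' = s[unfolded n[symmetric]]
  show ?thesis
  proof (rule tpow_tmul3_eqI[OF V linear_map_comp[OF linear_map_comp[OF s(1) s'(2)] s'(1)]
      linear_map_comp[OF linear_map_comp[OF s(2) s'(1)] s'(2)] _ u[unfolded n]])
    fix a b c assume abc: "a \<in> pow V i" "b \<in> pow V 3" "c \<in> pow V m"
    have e: "sig n (i + k) (tmul V a (tmul V x c)) = tmul V a (tmul V (sig 3 k x) c)"
      if "k + 2 \<le> 3" "x \<in> pow V 3" for k x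
      unfolding n sigma_op_ext_right[OF that abc(3), symmetric]
      by (rule sigma_op_ext_left[OF _ tmul_tpow[OF V that(2) abc(3)] abc(1)]) (use that in simp)
    have e0: "sig n i (tmul V a (tmul V x c)) = tmul V a (tmul V (sig 3 0 x) c)"
      and e1: "sig n (Suc i) (tmul V a (tmul V x c)) = tmul V a (tmul V (sig 3 1 x) c)"
      and c0: "sig 3 0 x \<in> pow V 3" and c1: "sig 3 1 x \<in> pow V 3"
      if "x \<in> pow V 3" for x
      using e[of 0 x] e[of 1 x] linear_mapD(1)[OF sigma_op_linear that] that by simp_all
    show "sig n i (sig n (Suc i) (sig n i (tmul V a (tmul V b c)))) =
        sig n (Suc i) (sig n i (sig n (Suc i) (tmul V a (tmul V b c))))"
      using sig_3_braid[OF abc(2)] abc(2) by (simp add: e0 e1[simplified] c0 c1[simplified])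
  qed
qed

lemma strand_words_large: "\<exists>N. \<forall>n\<ge>N. w \<in> strand_words n"
proof (induction w)
  case (Cons l w)
  then obtain N where "\<forall>n\<ge>N. w \<in> strand_words n" by blast
  then have "\<forall>n\<ge>max N (fst l + 2). l # w \<in> strand_words n" by simp
  then show ?case by blast
qed simp

text \<open>
  A derivation of equality in the braid group may use generators on arbitrarily many strands, so it
  can be followed by operators only if \<open>n\<close> is large.
\<close>

lemma act_braid_eq_large:
  "braid_eq v w \<Longrightarrow> \<exists>N. \<forall>n\<ge>N. \<forall>u\<in>pow V n. act n v u = act n w u"
proof (induction rule: braid_eq.induct)
  case (sym u v)
  then show ?case by metis
next
  case (trans u v w)
  then obtain N N' where
    "\<forall>n\<ge>N. \<forall>x\<in>pow V n. act n u x = act n v x"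
    "\<forall>n\<ge>N'. \<forall>x\<in>pow V n. act n v x = act n w x" by blast
  then show ?case by (intro exI[of _ "max N N'"]) simp
next
  case (append u v u' v')
  then obtain N N' where
    "\<forall>n\<ge>N. \<forall>x\<in>pow V n. act n u x = act n v x"
    "\<forall>n\<ge>N'. \<forall>x\<in>pow V n. act n u' x = act n v' x" by blast
  moreover obtain M where "\<forall>n\<ge>M. v' \<in> strand_words n" using strand_words_large by blast
  ultimately show ?case
    by (intro exI[of _ "max (max N N') M"]) (simp add: act_append linear_mapD(1)[OF act_linear])
next
  case (cancel i b)
  show ?case
    by (intro exI[of _ "i + 2"] allI impI ballI; cases b)
      (simp_all add: letter_True letter_False sig_inverse linear_mapD(1)[OF sigma_op_linear])
next
  case (braid j i)
  then show ?case
    by (intro exI[of _ "i + j + 3"] allI impI ballI) (auto simp: letter_True sig_braid)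
next
  case (comm i j)
  then show ?case
    by (intro exI[of _ "i + j + 3"] allI impI ballI)
      (use sig_far[of i j] sig_far[of j i] in \<open>auto simp: letter_True\<close>)
qed auto

end

section \<open>The local representation\<close>

lemma pten_zero_letter:
  assumes V: "vspace V" and "0 \<in> set xs" "xs \<in> words V"
  shows "pten V xs = 0"
proof -
  obtain us vs where xs: "xs = us @ 0 # vs" using assms(2) by (meson split_list)
  interpret V: vector_space "smul V" using V by (simp add: vspace_def)
  have "smul V 0 0 = 0" by simp
  moreover have "pten V (us @ smul V 0 0 # vs) = smul (tspan V (words V)) 0 (pten V (us @ 0 # vs))"
    using multilinear_pten[OF V disjI1[OF HOL.refl]] assms(3) vspace_closed(1)[OF V]
    unfolding multilinear_def xs by blast
  ultimately have "pten V (us @ 0 # vs) = 0" by simp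
  then show ?thesis by (simp add: xs)
qed

text \<open>
  A linear form that is 1 at \<open>x\<close>, applied to each of the last \<open>m\<close> factors, is a left inverse of
  multiplication by \<open>x\<^bsup>\<otimes>m\<^esup>\<close>.
\<close>

lemma tmul_right_cancel:
  fixes V :: "('k::field, 'v::ab_group_add) lspace"
  assumes V: "vspace V" and x: "x \<in> carr V" "x \<noteq> 0"
    and s: "s \<in> pow V n" "s' \<in> pow V n"
    and eq: "tmul V s (pten V (replicate m x)) = tmul V s' (pten V (replicate m x))"
  shows "s = s'"
proof -
  interpret V: vector_space "smul V" using V by (simp add: vspace_def)
  interpret K: vector_space "(*) :: 'k \<Rightarrow> 'k \<Rightarrow> 'k"
    by unfold_locales (auto simp: algebra_simps)
  interpret VK: vector_space_pair "smul V" "(*) :: 'k \<Rightarrow> 'k \<Rightarrow> 'k" ..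
  have "V.independent {x}" using x by simp
  from VK.linear_independent_extend[OF this, of "\<lambda>_. 1"]
  obtain h where h: "Vector_Spaces.linear (smul V) (*) h" and hx: "h x = 1" by auto
  interpret h: Vector_Spaces.linear "smul V" "(*)" h by (rule h)
  define g where "g ys = tscale (prod_list (map h ys)) (pten V [])" for ys
  define G where "G = lin_ext V (nwords V m) (tens V) g"
  have g: "multilinear V (nwords V m) (tens V) g"
  proof (rule multilinearI[OF V disjI2[OF HOL.refl]])
    fix us vs
    show "linear_map V (tens V) (\<lambda>x. g (us @ x # vs))"
      unfolding g_def map_append list.map prod_list.append prod_list.Cons
      by (intro linear_mapI)
        (simp_all only: tens_closed pten_tens words_Nil h.add h.scale distrib_left distrib_right
          ten.scale_left_distrib smul_tspan ten.scale_scale mult.assoc mult.left_commute[of _ "_ :: 'k"])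
  qed (simp add: g_def tens_closed pten_tens)
  have G: "linear_map (tpow V m) (tpow V 0) G"
    unfolding tpow_def[of V m]
  proof (rule linear_map_range)
    show "linear_map (tspan V (nwords V m)) (tens V) G"
      unfolding G_def by (rule linear_map_lin_ext[OF V vspace_tens disjI2[OF HOL.refl] g])
    fix ys assume "ys \<in> nwords V m"
    from lin_ext_pten[OF V vspace_tens disjI2[OF HOL.refl] g this]
    show "G (pten V ys) \<in> pow V 0"
      by (auto simp: G_def g_def nwords_def intro!: tpow_closed pten_tpow)
  qed (simp_all add: vspace_tpow)
  have rep: "replicate m x \<in> nwords V m" using x by (auto simp: nwords_def words_def)
  have "G (pten V (replicate m x)) = pten V []"
    using lin_ext_pten[OF V vspace_tens disjI2[OF HOL.refl] g rep] by (simp add: G_def g_def hx)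
  then have "op_tensor V n m id G (tmul V s (pten V (replicate m x))) = s"
    if "s \<in> pow V n" for s
    using op_tensor_tmul[OF V linear_map_id(1) G that pten_tpow[OF rep]] that
    by (simp add: tmul_Nil_right[OF V] tpow_tens)
  with s eq show ?thesis by metis
qed

context braided_op
begin

text \<open>
  If \<open>V\<close> contains a vector \<open>x \<noteq> 0\<close>, tensoring with \<open>x\<^bsup>\<otimes>m\<^esup>\<close> reduces the claim to large \<open>n\<close>, because
  words on \<open>n\<close> strands do not touch the additional factors.  If \<open>V = 0\<close>, then \<open>V\<^bsup>\<otimes>n\<^esup> = 0\<close> for \<open>n > 0\<close>,
  and for \<open>n = 0\<close> there is only the empty word.
\<close>

lemma act_braid_eq:
  assumes vw: "v \<in> strand_words n" "w \<in> strand_words n" "braid_eq v w" and u: "u \<in> pow V n"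
  shows "act n v u = act n w u"
proof (cases "\<exists>x\<in>carr V. x \<noteq> 0")
  case True
  then obtain x where x: "x \<in> carr V" "x \<noteq> 0" by blast
  from act_braid_eq_large[OF vw(3)] obtain m where
    m: "\<And>n u. m \<le> n \<Longrightarrow> u \<in> pow V n \<Longrightarrow> act n v u = act n w u" by blast
  have rep: "pten V (replicate m x) \<in> pow V m"
    by (rule pten_tpow) (use x in \<open>auto simp: nwords_def words_def\<close>)
  have "act (n + m) v (tmul V u (pten V (replicate m x))) = act (n + m) w (tmul V u (pten V (replicate m x)))"
    by (rule m[OF _ tmul_tpow[OF V u rep]]) simp
  then have "tmul V (act n v u) (pten V (replicate m x)) = tmul V (act n w u) (pten V (replicate m x))"
    by (simp only: act_ext_right[OF vw(1) u rep] act_ext_right[OF vw(2) u rep])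
  then show ?thesis
    by (rule tmul_right_cancel[OF V x linear_mapD(1)[OF act_linear u] linear_mapD(1)[OF act_linear u], OF vw(1,2)])
next
  case False
  show ?thesis
  proof (cases n)
    case 0
    then have "v = []" "w = []" using vw by (cases v; cases w; simp)+
    then show ?thesis by simp
  next
    case (Suc n')
    have "u = 0" using u
    proof (induction rule: tpow_induct)
      case (pten xs)
      then have "xs \<in> words V" "xs \<noteq> []" by (auto simp: nwords_def Suc)
      then have "0 \<in> set xs" using False by (cases xs) (auto simp: words_def)
      then show ?case using \<open>xs \<in> words V\<close> by (intro pten_zero_letter V)
    next
      case (add s t)
      then show ?case by (simp only: add_0_left)
    next
      case (scale c s)
      then show ?case by (simp only: ten.scale_zero_right)
    qed (rule HOL.refl)
    then show ?thesis
      using linear_map_0[OF act_linear[OF vw(1)] vspace_tpow] linear_map_0[OF act_linear[OF vw(2)] vspace_tpow]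
      by simp
  qed
qed

lemma braid_op_word:
  assumes w: "w \<in> strand_words n" and u: "u \<in> pow V n"
  shows "braid_op q V R n (braid_of_word w) u = act n w u"
proof -
  define w' where "w' = (SOME w'. w' \<in> strand_words n \<and> braid_of_word w' = braid_of_word w)"
  have "w' \<in> strand_words n \<and> braid_of_word w' = braid_of_word w"
    unfolding w'_def by (rule someI) (use w in simp)
  then have "act n w' u = act n w u"
    by (intro act_braid_eq w u) (auto simp: braid.abs_eq_iff)
  then show ?thesis by (simp add: braid_op_def act_def w'_def)
qed

end

definition strand_braids :: "nat \<Rightarrow> braid set" where
  "strand_braids n = braid_of_word ` strand_words n"

lemma strand_braids_closed:
  "0 \<in> strand_braids n"
  "g \<in> strand_braids n \<Longrightarrow> h \<in> strand_braids n \<Longrightarrow> g + h \<in> strand_braids n"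
  "1 \<le> i \<Longrightarrow> i < n \<Longrightarrow> braid_of_word [(i - 1, True)] \<in> strand_braids n"
proof -
  show "0 \<in> strand_braids n"
    unfolding strand_braids_def
    by (rule image_eqI[of _ _ "[]"]) (simp_all add: zero_braid_def strand_words_def)
  show "g + h \<in> strand_braids n" if gh: "g \<in> strand_braids n" "h \<in> strand_braids n" for g h
  proof -
    obtain v w where "v \<in> strand_words n" "g = braid_of_word v" "w \<in> strand_words n" "h = braid_of_word w"
      using gh by (auto simp: strand_braids_def)
    then have "g + h = braid_of_word (v @ w)" "v @ w \<in> strand_words n"
      by (auto simp: plus_braid.abs_eq strand_words_def)
    then show ?thesis by (simp add: strand_braids_def)
  qed
  show "braid_of_word [(i - 1, True)] \<in> strand_braids n" if "1 \<le> i" "i < n" for i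
    unfolding strand_braids_def by (rule imageI) (use that in \<open>auto simp: strand_words_def\<close>)
qed

lemma balg_keys: "a \<in> balg n \<Longrightarrow> Poly_Mapping.keys a \<subseteq> strand_braids n"
proof (induction rule: balg.induct)
  case (add a b)
  then show ?case using Poly_Mapping.keys_add[of a b] by blast
next
  case (mult a b)
  then show ?case using keys_mult[of a b] strand_braids_closed(2) by blast
qed (auto simp: scalar_def sigma_def strand_braids_closed strand_braids_closed(3)[simplified])

lemma braid_alg_expand: "a = (\<Sum>g\<in>Poly_Mapping.keys a. Poly_Mapping.single g (Poly_Mapping.lookup a g))"
  by (rule poly_mapping_eqI) (auto simp: lookup_sum lookup_single when_def in_keys_iff)

context braided_op
begin

abbreviation rep where "rep n \<equiv> local_rep q V R n"
abbreviation bop where "bop n \<equiv> braid_op q V R n"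

lemma bop_linear: "g \<in> strand_braids n \<Longrightarrow> linear_map (tpow V n) (tpow V n) (bop n g)"
proof -
  assume "g \<in> strand_braids n"
  then obtain w where w: "w \<in> strand_words n" "g = braid_of_word w" by (auto simp: strand_braids_def)
  show ?thesis
    by (rule linear_map_cong[OF act_linear[OF w(1)] _ vspace_tpow]) (simp add: w braid_op_word)
qed

lemma bop_add:
  assumes "g \<in> strand_braids n" "h \<in> strand_braids n" "u \<in> pow V n"
  shows "bop n (g + h) u = bop n g (bop n h u)"
proof -
  obtain v w where vw: "v \<in> strand_words n" "g = braid_of_word v" "w \<in> strand_words n" "h = braid_of_word w"
    using assms by (auto simp: strand_braids_def)
  show ?thesis
    using vw assms by (simp add: plus_braid.abs_eq braid_op_word act_append linear_mapD(1)[OF act_linear])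
qed

lemma bop_ext_right:
  assumes "g \<in> strand_braids n" "s \<in> pow V n" "t \<in> pow V m"
  shows "bop (n + m) g (tmul V s t) = tmul V (bop n g s) t"
proof -
  obtain w where w: "w \<in> strand_words n" "g = braid_of_word w" using assms by (auto simp: strand_braids_def)
  have "w \<in> strand_words (n + m)" using w by (auto simp: strand_words_def)
  then show ?thesis
    using w assms by (simp add: braid_op_word tmul_tpow[OF V] act_ext_right)
qed

lemma bop_ext_left:
  assumes "g \<in> strand_braids n" "s \<in> pow V n" "t \<in> pow V m"
  shows "bop (m + n) (braid_shift m g) (tmul V t s) = tmul V t (bop n g s)"
proof -
  obtain w where w: "w \<in> strand_words n" "g = braid_of_word w" using assms by (auto simp: strand_braids_def)
  have "map (\<lambda>(i, b). (i + m, b)) w \<in> strand_words (m + n)" using w by (force simp: strand_words_def)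
  then show ?thesis
    using w assms by (simp add: braid_op_word tmul_tpow[OF V] act_ext_left braid_shift.abs_eq)
qed

lemma rep_superset:
  assumes "finite X" "Poly_Mapping.keys a \<subseteq> X"
  shows "rep n a u = (\<Sum>g\<in>X. tscale (Poly_Mapping.lookup a g) (bop n g u))"
  unfolding local_rep_def using assms
  by (intro sum.mono_neutral_left) (auto simp: in_keys_iff)

lemma rep_add: "rep n (a + b) u = rep n a u + rep n b u"
proof -
  let ?X = "Poly_Mapping.keys a \<union> Poly_Mapping.keys b"
  show ?thesis
    using Poly_Mapping.keys_add[of a b]
    by (simp add: rep_superset[of ?X] lookup_add ten.scale_left_distrib sum.distrib)
qed

lemma rep_zero [simp]: "rep n 0 u = 0"
  by (simp add: local_rep_def)

lemma rep_sum: "rep n (sum f A) u = (\<Sum>x\<in>A. rep n (f x) u)"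
  by (induction A rule: infinite_finite_induct) (auto simp: rep_add)

lemma rep_single: "rep n (Poly_Mapping.single g c) u = tscale c (bop n g u)"
  by (simp add: rep_superset[of "{g}"])

lemma rep_linear: "a \<in> balg n \<Longrightarrow> linear_map (tpow V n) (tpow V n) (rep n a)"
proof -
  assume a: "a \<in> balg n"
  have "linear_map (tpow V n) (tpow V n)
     (\<lambda>u. \<Sum>g\<in>Poly_Mapping.keys a. smul (tpow V n) (Poly_Mapping.lookup a g) (bop n g u))"
    using balg_keys[OF a]
    by (intro linear_map_sum_fun linear_map_scale bop_linear vspace_tpow) auto
  then show ?thesis by (simp add: local_rep_def[abs_def])
qed

lemma rep_mult:
  assumes "a \<in> balg n" "b \<in> balg n" "u \<in> pow V n"
  shows "rep n (a * b) u = rep n a (rep n b u)"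
proof -
  let ?a = "Poly_Mapping.lookup a" and ?b = "Poly_Mapping.lookup b"
  have k: "g \<in> strand_braids n" if "g \<in> Poly_Mapping.keys a \<or> g \<in> Poly_Mapping.keys b" for g
    using that balg_keys[OF assms(1)] balg_keys[OF assms(2)] by blast
  have "a * b = (\<Sum>g\<in>Poly_Mapping.keys a. \<Sum>h\<in>Poly_Mapping.keys b. Poly_Mapping.single (g + h) (?a g * ?b h))"
    by (subst braid_alg_expand[of a], subst braid_alg_expand[of b])
      (simp add: sum_product mult_single)
  then have "rep n (a * b) u = (\<Sum>g\<in>Poly_Mapping.keys a. \<Sum>h\<in>Poly_Mapping.keys b.
      tscale (?a g * ?b h) (bop n (g + h) u))"
    by (simp add: rep_sum rep_single)
  also have "\<dots> = (\<Sum>g\<in>Poly_Mapping.keys a. tscale (?a g) (bop n g (rep n b u)))"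
  proof (rule sum.cong[OF HOL.refl])
    fix g assume g: "g \<in> Poly_Mapping.keys a"
    note lin = bop_linear[OF k[OF disjI1[OF g]]]
    have h: "bop n h u \<in> pow V n" if "h \<in> Poly_Mapping.keys b" for h
      using linear_mapD(1)[OF bop_linear[OF k] assms(3)] that by blast
    have "bop n g (rep n b u) = (\<Sum>h\<in>Poly_Mapping.keys b. bop n g (tscale (?b h) (bop n h u)))"
      unfolding local_rep_def by (rule linear_map_sum[OF lin vspace_tpow]) (intro tpow_closed h)
    also have "\<dots> = (\<Sum>h\<in>Poly_Mapping.keys b. tscale (?b h) (bop n (g + h) u))"
    proof (rule sum.cong[OF HOL.refl])
      fix x assume x: "x \<in> Poly_Mapping.keys b"
      show "bop n g (tscale (?b x) (bop n x u)) = tscale (?b x) (bop n (g + x) u)"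
        using linear_mapD(3)[OF lin h[OF x], of "?b x"] bop_add[OF k k assms(3), of g x] g x by simp
    qed
    finally show "(\<Sum>h\<in>Poly_Mapping.keys b. tscale (?a g * ?b h) (bop n (g + h) u)) =
      tscale (?a g) (bop n g (rep n b u))"
      by (simp add: ten.scale_sum_right)
  qed
  finally show ?thesis by (simp add: local_rep_def)
qed

lemma rep_ext_right:
  assumes a: "a \<in> balg n" and s: "s \<in> pow V n" and t: "t \<in> pow V m"
  shows "rep (n + m) a (tmul V s t) = tmul V (rep n a s) t"
proof -
  have k: "g \<in> strand_braids n" if "g \<in> Poly_Mapping.keys a" for g
    using that balg_keys[OF a] by blast
  have c: "bop n g s \<in> pow V n" if "g \<in> Poly_Mapping.keys a" for g
    by (rule linear_mapD(1)[OF bop_linear[OF k[OF that]] s])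
  have "tmul V (rep n a s) t = (\<Sum>g\<in>Poly_Mapping.keys a. tmul V (tscale (Poly_Mapping.lookup a g) (bop n g s)) t)"
    unfolding local_rep_def
    by (rule linear_map_sum[OF linear_tmul_tpow_left[OF V t] vspace_tpow]) (rule tpow_closed(3)[OF c])
  also have "\<dots> = (\<Sum>g\<in>Poly_Mapping.keys a. tscale (Poly_Mapping.lookup a g) (bop (n + m) g (tmul V s t)))"
  proof (intro sum.cong HOL.refl)
    fix g assume g: "g \<in> Poly_Mapping.keys a"
    show "tmul V (tscale (Poly_Mapping.lookup a g) (bop n g s)) t =
        tscale (Poly_Mapping.lookup a g) (bop (n + m) g (tmul V s t))"
      using tmul_scale(1)[OF V tpow_tens[OF c[OF g]] tpow_tens[OF t]] bop_ext_right[OF k[OF g] s t] by simp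
  qed
  finally show ?thesis by (simp add: local_rep_def)
qed

lemma rep_ext_left:
  assumes a: "a \<in> balg n" and s: "s \<in> pow V n" and t: "t \<in> pow V m"
  shows "rep (m + n) (shift m a) (tmul V t s) = tmul V t (rep n a s)"
proof -
  have k: "g \<in> strand_braids n" if "g \<in> Poly_Mapping.keys a" for g
    using that balg_keys[OF a] by blast
  have c: "bop n g s \<in> pow V n" if "g \<in> Poly_Mapping.keys a" for g
    by (rule linear_mapD(1)[OF bop_linear[OF k[OF that]] s])
  have "tmul V t (rep n a s) = (\<Sum>g\<in>Poly_Mapping.keys a. tmul V t (tscale (Poly_Mapping.lookup a g) (bop n g s)))"
    unfolding local_rep_def
    by (rule linear_map_sum[OF linear_tmul_tpow_right[OF V t] vspace_tpow]) (rule tpow_closed(3)[OF c])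
  also have "\<dots> = (\<Sum>g\<in>Poly_Mapping.keys a. tscale (Poly_Mapping.lookup a g) (bop (m + n) (braid_shift m g) (tmul V t s)))"
  proof (intro sum.cong HOL.refl)
    fix g assume g: "g \<in> Poly_Mapping.keys a"
    show "tmul V t (tscale (Poly_Mapping.lookup a g) (bop n g s)) =
        tscale (Poly_Mapping.lookup a g) (bop (m + n) (braid_shift m g) (tmul V t s))"
      using tmul_scale(2)[OF V tpow_tens[OF t] tpow_tens[OF c[OF g]]] bop_ext_left[OF k[OF g] s t] by simp
  qed
  finally show ?thesis by (simp add: alg_shift_def rep_sum rep_single)
qed

end

section \<open>Components of the operator T(R)\<close>

lemma linear_pten_1: "vspace V \<Longrightarrow> linear_map V (tpow V 1) (\<lambda>x. pten V [x])"
  using linear_pten_tpow[of V "[]" "[]" 1] by (simp add: nwords_def)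

lemma bilinear_pten_2: "vspace V \<Longrightarrow> bilinear_map V V (tpow V 2) (\<lambda>x y. pten V [x, y])"
  using linear_pten_tpow[of V "[]" "[y]" 2 for y] linear_pten_tpow[of V "[x]" "[]" 2 for x]
  by (simp add: bilinear_map_def nwords_def)

text \<open>
  Tensor powers of \<open>T(V)\<close> are spanned by tensor products of pure tensors: the factors are expanded one
  after the other, \<open>xss\<close> being those that are pure already.
\<close>

lemma tpow_tens_induct [consumes 1, case_names pten zero add scale]:
  fixes V :: "('k::field, 'v::ab_group_add) lspace"
  assumes u: "u \<in> pow (tens V) n"
    and pten: "\<And>xss. xss \<in> lists (words V) \<Longrightarrow> length xss = n \<Longrightarrow> P (pten (tens V) (map (pten V) xss))"
    and zero: "P 0"
    and add: "\<And>s t. s \<in> pow (tens V) n \<Longrightarrow> t \<in> pow (tens V) n \<Longrightarrow> P s \<Longrightarrow> P t \<Longrightarrow> P (s + t)"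
    and scale: "\<And>c s. s \<in> pow (tens V) n \<Longrightarrow> P s \<Longrightarrow> P (tscale c s)"
  shows "P u"
  using u
proof (induction rule: tpow_induct)
  case (pten ys)
  have "P (pten (tens V) (map (pten V) xss @ ys))"
    if "ys \<in> words (tens V)" "xss \<in> lists (words V)" "length xss + length ys = n" for ys xss
    using that
  proof (induction ys arbitrary: xss)
    case Nil
    then show ?case using assms(2)[of xss] by simp
  next
    case (Cons y ys)
    have y: "y \<in> carr (tens V)" and ys: "ys \<in> words (tens V)" using Cons.prems by simp_all
    have xss: "map (pten V) xss \<in> words (tens V)"
      using Cons.prems(2) by (auto simp: words_def intro!: pten_tens)
    have lin: "linear_map (tens V) (tpow (tens V) n) (\<lambda>y. pten (tens V) (map (pten V) xss @ y # ys))"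
      by (rule linear_pten_tpow[OF vspace_tens]) (use Cons.prems xss ys in \<open>simp add: nwords_def\<close>)
    show ?case using y
    proof (induction rule: tens_induct)
      case (pten xs)
      then show ?case using Cons.IH[OF ys, of "xss @ [xs]"] Cons.prems by simp
    next
      case zero
      show ?case unfolding linear_map_0[OF lin vspace_tens] by (rule assms(3))
    next
      case (add s t)
      then show ?case
        unfolding linear_mapD(2)[OF lin add(1,2)] by (intro assms(4) linear_mapD(1)[OF lin])
    next
      case (scale c s)
      then show ?case
        using linear_mapD(3)[OF lin scale(1), of c] assms(5)[OF linear_mapD(1)[OF lin scale(1)]] by simp
    qed
  qed
  from this[of ys "[]"] pten show ?case by (simp add: nwords_def)
qed (use assms in blast)+

lemma tpow_tens_eqI:
  assumes f: "linear_map (tpow (tens V) n) W f" and g: "linear_map (tpow (tens V) n) W g"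
    and eq: "\<And>xss. xss \<in> lists (words V) \<Longrightarrow> length xss = n \<Longrightarrow>
      f (pten (tens V) (map (pten V) xss)) = g (pten (tens V) (map (pten V) xss))"
    and u: "u \<in> pow (tens V) n"
  shows "f u = g u"
  using u
proof (induction rule: tpow_tens_induct)
  case zero
  show ?case by (simp only: linear_map_0[OF f vspace_tpow] linear_map_0[OF g vspace_tpow])
next
  case (add s t)
  then show ?case by (simp only: linear_mapD(2)[OF f] linear_mapD(2)[OF g])
next
  case (scale c s)
  then show ?case using linear_mapD(3)[OF f, of s c] linear_mapD(3)[OF g, of s c] by simp
qed (rule eq)

lemma multilinear_pair:
  assumes V: "vspace V" and B: "bilinear_map V V W B"
  shows "multilinear V (nwords V 2) W (\<lambda>xs. B (xs ! 0) (xs ! 1))"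
proof (rule multilinearI[OF V disjI2[OF HOL.refl]])
  fix us vs assume "\<And>x. x \<in> carr V \<Longrightarrow> us @ x # vs \<in> nwords V 2"
  from this[OF vspace_closed(1)[OF V]]
  have "(\<exists>v\<in>carr V. us = [] \<and> vs = [v]) \<or> (\<exists>u\<in>carr V. us = [u] \<and> vs = [])"
    by (cases us; cases vs) (auto simp: nwords_def)
  then show "linear_map V W (\<lambda>x. B ((us @ x # vs) ! 0) ((us @ x # vs) ! 1))"
    using bilinear_mapD[OF B] by auto
next
  fix xs assume "xs \<in> nwords V 2"
  then show "B (xs ! 0) (xs ! 1) \<in> carr W"
    using linear_mapD(1)[OF bilinear_mapD(1)[OF B]]
    by (auto simp: nwords_def numeral_2_eq_2 length_Suc_conv)
qed

lemma hom_part_multilinear: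
  assumes V: "vspace V"
  shows "multilinear V (words V) (tens V) (\<lambda>xs. if length xs = k then pten V xs else 0)"
proof (rule multilinearI[OF V disjI1[OF HOL.refl]])
  fix us vs assume w: "\<And>x. x \<in> carr V \<Longrightarrow> us @ x # vs \<in> words V"
  show "linear_map V (tens V) (\<lambda>x. if length (us @ x # vs) = k then pten V (us @ x # vs) else 0)"
    using linear_pten_tens[OF V w] linear_map_zero[OF vspace_tens]
    by (cases "Suc (length us + length vs) = k") simp_all
qed (simp add: pten_tens tens_closed)

lemma hom_part_pten:
  "vspace V \<Longrightarrow> xs \<in> words V \<Longrightarrow> hom_part V k (pten V xs) = (if length xs = k then pten V xs else 0)"
  unfolding hom_part_def
  by (rule lin_ext_pten[OF _ vspace_tens disjI1[OF HOL.refl] hom_part_multilinear])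

lemma hom_part_linear:
  assumes V: "vspace V" shows "linear_map (tens V) (tpow V k) (hom_part V k)"
  unfolding tens_def
proof (rule linear_map_range)
  show "linear_map (tspan V (words V)) (tens V) (hom_part V k)"
    unfolding hom_part_def
    by (rule linear_map_lin_ext[OF V vspace_tens disjI1[OF HOL.refl] hom_part_multilinear[OF V]])
  show "hom_part V k (pten V xs) \<in> pow V k" if "xs \<in> words V" for xs
    using that by (auto simp: hom_part_pten[OF V] nwords_def intro!: pten_tpow tpow_closed)
qed (simp_all add: vspace_tpow)

lemma bi_part_bilinear:
  assumes V: "vspace V"
  shows "bilinear_map (tens V) (tens V) (tpow V (k + l)) (\<lambda>s t. tmul V (hom_part V k s) (hom_part V l t))"
  by (rule bilinear_map_comp[OF tmul_bilinear_tpow hom_part_linear hom_part_linear]) (rule V)+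

lemma bilinear_map_into_tens: "bilinear_map A B (tpow V n) f \<Longrightarrow> bilinear_map A B (tens V) f"
  by (auto simp: bilinear_map_def intro: linear_map_into_tens)

lemma bi_part_pair:
  assumes V: "vspace V" and st: "s \<in> carr (tens V)" "t \<in> carr (tens V)"
  shows "bi_part V k l (pten (tens V) [s, t]) = tmul V (hom_part V k s) (hom_part V l t)"
proof -
  have "[s, t] \<in> nwords (tens V) 2" using st by (simp add: nwords_def)
  from lin_ext_pten[OF vspace_tens vspace_tens disjI2[OF HOL.refl]
      multilinear_pair[OF vspace_tens bilinear_map_into_tens[OF bi_part_bilinear[OF V]]] this]
  show ?thesis by (simp add: bi_part_def)
qed

lemma bi_part_linear:
  assumes V: "vspace V" shows "linear_map (tpow (tens V) 2) (tpow V (k + l)) (bi_part V k l)"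
  unfolding tpow_def[of "tens V"]
proof (rule linear_map_range)
  show "linear_map (tspan (tens V) (nwords (tens V) 2)) (tens V) (bi_part V k l)"
    unfolding bi_part_def
    by (rule linear_map_lin_ext[OF vspace_tens vspace_tens disjI2[OF HOL.refl]
        multilinear_pair[OF vspace_tens bilinear_map_into_tens[OF bi_part_bilinear[OF V]]]])
  fix xs assume "xs \<in> nwords (tens V) 2"
  then obtain s t where "xs = [s, t]" "s \<in> carr (tens V)" "t \<in> carr (tens V)"
    by (auto simp: nwords_def numeral_2_eq_2 length_Suc_conv)
  then show "bi_part V k l (pten (tens V) xs) \<in> pow V (k + l)"
    by (simp add: bi_part_pair[OF V] tmul_tpow[OF V] linear_mapD(1)[OF hom_part_linear[OF V]])
qed (simp_all add: vspace_tpow)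

lemma bi_part_pten:
  assumes V: "vspace V" "xs \<in> words V" "ys \<in> words V"
  shows "bi_part V k l (pten (tens V) [pten V xs, pten V ys]) =
    (if length xs = k \<and> length ys = l then pten V (xs @ ys) else 0)"
  using assms
  by (simp add: bi_part_pair pten_tens hom_part_pten tmul_pten tmul_zero tens_closed)

lemma bi_incl_split: "bi_incl V b c = split_map V b c (tpow (tens V) 2) (\<lambda>s t. pten (tens V) [s, t])"
  by (simp add: bi_incl_def split_map_def)

lemma bi_incl_bilinear:
  "bilinear_map (tpow V b) (tpow V c) (tpow (tens V) 2) (\<lambda>s t. pten (tens V) [s, t])"
  using bilinear_pten_2[OF vspace_tens[of V]]
  by (auto simp: bilinear_map_def tpow_tens intro: linear_map_from_tens)

lemma bi_incl_linear: "vspace V \<Longrightarrow> linear_map (tpow V (b + c)) (tpow (tens V) 2) (bi_incl V b c)"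
  unfolding bi_incl_split by (rule split_map_linear[OF _ vspace_tpow bi_incl_bilinear])

lemma bi_incl_tmul:
  "vspace V \<Longrightarrow> s \<in> pow V b \<Longrightarrow> t \<in> pow V c \<Longrightarrow>
    bi_incl V b c (tmul V s t) = pten (tens V) [s, t]"
  unfolding bi_incl_split by (rule split_map_tmul[OF _ vspace_tpow bi_incl_bilinear])

lemma pair_bi_incl:
  assumes "vspace V" "xs \<in> words V" "ys \<in> words V"
  shows "pten (tens V) [pten V xs, pten V ys] = bi_incl V (length xs) (length ys) (pten V (xs @ ys))"
  using bi_incl_tmul[OF assms(1) pten_tpow pten_tpow, of xs "length xs" ys "length ys"] assms
  by (simp add: tmul_pten nwords_def)

context braided_op
begin

text \<open>
  The component of \<open>T(R) u\<close> in bidegree \<open>(b, c)\<close>.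
\<close>

definition T_part where
  "T_part b c u = bi_incl V b c (\<Sum>k\<le>c. rep (b + c) (exch_coeff q b c k) (bi_part V k (b + c - k) u))"

lemma T_part_linear: "linear_map (tpow (tens V) 2) (tpow (tens V) 2) (T_part b c)"
proof -
  have "linear_map (tpow (tens V) 2) (tpow V (b + c))
      (\<lambda>u. rep (b + c) (exch_coeff q b c k) (bi_part V k (b + c - k) u))" if "k \<le> c" for k
    using linear_map_comp[OF bi_part_linear[OF V, of k "b + c - k"], of "tpow V (b + c)"]
      rep_linear[OF exch_coeff_balg[OF that]] that by simp
  then have "linear_map (tpow (tens V) 2) (tpow V (b + c))
      (\<lambda>u. \<Sum>k\<le>c. rep (b + c) (exch_coeff q b c k) (bi_part V k (b + c - k) u))"
    by (intro linear_map_sum_fun vspace_tpow) auto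
  from linear_map_comp[OF this bi_incl_linear[OF V]] show ?thesis
    by (simp add: T_part_def[abs_def])
qed

lemma T_part_pten:
  assumes "xs \<in> words V" "ys \<in> words V"
  shows "T_part b c (pten (tens V) [pten V xs, pten V ys]) =
    (if length xs \<le> c \<and> b + c = length xs + length ys
     then bi_incl V b c (rep (b + c) (exch_coeff q b c (length xs)) (pten V (xs @ ys))) else 0)"
proof -
  have r0: "rep (b + c) (exch_coeff q b c k) 0 = 0" if "k \<le> c" for k
    by (rule linear_map_0[OF rep_linear[OF exch_coeff_balg[OF that]] vspace_tpow])
  have b0: "bi_incl V b c 0 = 0" by (rule linear_map_0[OF bi_incl_linear[OF V] vspace_tpow])
  have "(\<Sum>k\<le>c. rep (b + c) (exch_coeff q b c k)
      (bi_part V k (b + c - k) (pten (tens V) [pten V xs, pten V ys]))) =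
    (\<Sum>k\<le>c. if k = length xs then (if b + c = length xs + length ys
      then rep (b + c) (exch_coeff q b c (length xs)) (pten V (xs @ ys)) else 0) else 0)"
    by (rule sum.cong[OF HOL.refl]) (auto simp: bi_part_pten[OF V assms] r0)
  then show ?thesis by (simp add: T_part_def b0)
qed

text \<open>
  Elements of \<open>T(V) \<otimes> T(V)\<close> have bounded degree and \<open>T(R)\<close> preserves the degree, so only
  finitely many bidegrees contribute to \<open>T(R) u\<close>.
\<close>

lemma T_part_bounded:
  assumes "u \<in> pow (tens V) 2"
  shows "\<exists>D. \<forall>b c. D < b + c \<longrightarrow> T_part b c u = 0"
  using assms
proof (induction rule: tpow_tens_induct)
  case (pten xss)
  then obtain xs ys where "xss = [xs, ys]" "xs \<in> words V" "ys \<in> words V"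
    by (auto simp: numeral_2_eq_2 length_Suc_conv)
  then show ?case by (intro exI[of _ "length xs + length ys"]) (simp add: T_part_pten)
next
  case zero
  show ?case using linear_map_0[OF T_part_linear vspace_tpow] by blast
next
  case (add s t)
  then obtain D D' where "\<forall>b c. D < b + c \<longrightarrow> T_part b c s = 0" "\<forall>b c. D' < b + c \<longrightarrow> T_part b c t = 0"
    by blast
  then show ?case
    by (intro exI[of _ "max D D'"]) (simp only: linear_mapD(2)[OF T_part_linear add(1,2)], simp)
next
  case (scale c s)
  then obtain D where D: "\<And>b c. D < b + c \<Longrightarrow> T_part b c s = 0" by blast
  show ?case
  proof (intro exI[of _ D] allI impI)
    fix a b assume "D < a + b"
    then show "T_part a b (tscale c s) = 0"
      using linear_mapD(3)[OF T_part_linear scale(1), of a b c] D[of a b] by simp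
  qed
qed

lemma finite_degree: "finite {(b, c). b + c \<le> (D::nat)}"
  by (rule finite_subset[of _ "{..D} \<times> {..D}"]) auto

lemma T_op_eq:
  assumes "\<And>b c. D < b + c \<Longrightarrow> T_part b c u = 0"
  shows "T_op q V R u = (\<Sum>(b, c)\<in>{(b, c). b + c \<le> D}. T_part b c u)"
proof -
  have "T_op q V R u = Sum_any (\<lambda>(b, c). T_part b c u)" by (simp add: T_op_def T_part_def)
  also have "\<dots> = (\<Sum>(b, c)\<in>{(b, c). b + c \<le> D}. T_part b c u)"
    by (rule Sum_any.expand_superset[OF finite_degree]) (use assms not_less in fastforce)
  finally show ?thesis .
qed

lemma T_op_linear: "linear_map (tpow (tens V) 2) (tpow (tens V) 2) (T_op q V R)"
proof (rule linear_mapI)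
  fix u assume u: "u \<in> pow (tens V) 2"
  then obtain D where D: "\<And>b c. D < b + c \<Longrightarrow> T_part b c u = 0" using T_part_bounded by blast
  have T: "T_op q V R u = (\<Sum>(b, c)\<in>{(b, c). b + c \<le> D}. T_part b c u)"
    by (rule T_op_eq) (rule D)
  show "T_op q V R u \<in> pow (tens V) 2"
    unfolding T by (intro tpow_closed(4)) (auto intro: linear_mapD(1)[OF T_part_linear u])
  fix c
  have D': "T_part b c' (tscale c u) = 0" if "D < b + c'" for b c'
    using linear_mapD(3)[OF T_part_linear u, of b c' c] D[OF that] by simp
  have T': "T_op q V R (tscale c u) = (\<Sum>(b, c')\<in>{(b, c). b + c \<le> D}. T_part b c' (tscale c u))"
    by (rule T_op_eq) (rule D')
  show "T_op q V R (smul (tpow (tens V) 2) c u) = smul (tpow (tens V) 2) c (T_op q V R u)"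
    using linear_mapD(3)[OF T_part_linear u, of _ _ c]
    by (simp add: T T' ten.scale_sum_right case_prod_unfold)
next
  fix u v assume u: "u \<in> pow (tens V) 2" and v: "v \<in> pow (tens V) 2"
  obtain D D' where "\<And>b c. D < b + c \<Longrightarrow> T_part b c u = 0" "\<And>b c. D' < b + c \<Longrightarrow> T_part b c v = 0"
    using T_part_bounded[OF u] T_part_bounded[OF v] by blast
  then have D: "T_part b c u = 0" "T_part b c v = 0" "T_part b c (u + v) = 0" if "max D D' < b + c" for b c
    using that by (simp_all only: linear_mapD(2)[OF T_part_linear u v], simp_all)
  have T: "T_op q V R x = (\<Sum>(b, c)\<in>{(b, c). b + c \<le> max D D'}. T_part b c x)"
    if "x = u \<or> x = v \<or> x = u + v" for x
    by (rule T_op_eq) (use that D in blast)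
  show "T_op q V R (u + v) = T_op q V R u + T_op q V R v"
    unfolding T[of u, simplified] T[of v, simplified] T[of "u + v", simplified]
    by (simp only: linear_mapD(2)[OF T_part_linear u v] case_prod_unfold sum.distrib)
qed

lemma T_op_bi_incl:
  assumes w: "w \<in> pow V (i + j)"
  shows "T_op q V R (bi_incl V i j w) =
    (\<Sum>c\<in>{i..i + j}. bi_incl V (i + j - c) c (rep (i + j) (exch_coeff q (i + j - c) c i) w))"
proof (rule tpow_eqI[OF linear_map_comp[OF bi_incl_linear[OF V] T_op_linear] _ _ w])
  have "linear_map (tpow V (i + j)) (tpow (tens V) 2)
      (\<lambda>w. bi_incl V (i + j - c) c (rep (i + j) (exch_coeff q (i + j - c) c i) w))"
    if "c \<in> {i..i + j}" for c
    using linear_map_comp[OF rep_linear[OF exch_coeff_balg[of i c q "i + j - c"]] bi_incl_linear[OF V, of "i + j - c" c]] that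
    by simp
  then show "linear_map (tpow V (i + j)) (tpow (tens V) 2) (\<lambda>w. \<Sum>c\<in>{i..i + j}.
      bi_incl V (i + j - c) c (rep (i + j) (exch_coeff q (i + j - c) c i) w))"
    by (rule linear_map_sum_fun[OF _ vspace_tpow])
  fix ws assume ws: "ws \<in> nwords V (i + j)"
  let ?f = "\<lambda>b c. bi_incl V b c (rep (i + j) (exch_coeff q b c i) (pten V ws))"
  define xs ys where "xs = take i ws" and "ys = drop i ws"
  have xy: "xs \<in> words V" "ys \<in> words V" "length xs = i" "length ys = j" "xs @ ys = ws"
    using nwords_split[OF V ws] ws by (auto simp: xs_def ys_def nwords_def)
  have e: "bi_incl V i j (pten V ws) = pten (tens V) [pten V xs, pten V ys]"
    using pair_bi_incl[OF V xy(1,2)] xy by simp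
  have part: "T_part b c (bi_incl V i j (pten V ws)) = (if i \<le> c \<and> b + c = i + j then ?f b c else 0)" for b c
    unfolding e T_part_pten[OF xy(1,2)] by (simp add: xy)
  have "T_op q V R (bi_incl V i j (pten V ws)) =
    (\<Sum>(b, c)\<in>{(b, c). b + c \<le> i + j}. T_part b c (bi_incl V i j (pten V ws)))"
    by (rule T_op_eq) (simp add: part)
  also have "\<dots> = (\<Sum>(b, c)\<in>{(b, c). i \<le> c \<and> b + c = i + j}. ?f b c)"
    unfolding part by (rule sum.mono_neutral_cong_right[OF finite_degree]) auto
  also have "\<dots> = (\<Sum>c\<in>{i..i + j}. ?f (i + j - c) c)"
    by (rule sum.reindex_bij_witness[of _ "\<lambda>c. (i + j - c, c)" "\<lambda>(b, c). c"])
      (auto, metis add_diff_cancel_right')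
  finally show "T_op q V R (bi_incl V i j (pten V ws)) = (\<Sum>c\<in>{i..i + j}. ?f (i + j - c) c)" .
qed

end

section \<open>The Yang--Baxter equation for T(R)\<close>

text \<open>
  The inclusion of \<open>V\<^bsup>\<otimes>(a+b+c)\<^esup>\<close> as the component \<open>(a, b, c)\<close> of \<open>T(V)\<^bsup>\<otimes>3\<^esup>\<close>.
\<close>

definition tri_incl where
  "tri_incl V a b c = split_map V a (b + c) (tens (tens V))
     (\<lambda>s v. tmul (tens V) (pten (tens V) [s]) (bi_incl V b c v))"

lemma linear_single: "linear_map (tpow V a) (tpow (tens V) 1) (\<lambda>s. pten (tens V) [s])"
  by (rule linear_map_from_tens[OF linear_pten_1[OF vspace_tens]])

lemma tri_bilinear:
  assumes V: "vspace V"
  shows "bilinear_map (tpow V a) (tpow V (b + c)) (tpow (tens V) 3)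
    (\<lambda>s v. tmul (tens V) (pten (tens V) [s]) (bi_incl V b c v))"
  using bilinear_map_comp[OF tmul_bilinear_tpow[OF vspace_tens] linear_single bi_incl_linear[OF V]]
  by (simp del: One_nat_def)

lemma tri_tmul:
  assumes V: "vspace V" and "s \<in> pow V a" "v \<in> pow V (b + c)"
  shows "tri_incl V a b c (tmul V s v) = tmul (tens V) (pten (tens V) [s]) (bi_incl V b c v)"
  unfolding tri_incl_def
  by (rule split_map_tmul[OF V vspace_tens bilinear_map_into_tens[OF tri_bilinear[OF V]] assms(2,3)])

lemma tri_linear:
  assumes V: "vspace V"
  shows "linear_map (tpow V (a + (b + c))) (tpow (tens V) 3) (tri_incl V a b c)"
  unfolding tpow_def[of V "a + (b + c)"]
proof (rule linear_map_range)
  show "linear_map (tspan V (nwords V (a + (b + c)))) (tens (tens V)) (tri_incl V a b c)"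
    unfolding tri_incl_def tpow_def[symmetric]
    by (rule split_map_linear[OF V vspace_tens bilinear_map_into_tens[OF tri_bilinear[OF V]]])
  fix xs assume xs: "xs \<in> nwords V (a + (b + c))"
  note m = nwords_split[OF V xs]
  show "tri_incl V a b c (pten V xs) \<in> pow (tens V) 3"
    unfolding m(3) tri_tmul[OF V pten_tpow[OF m(1)] pten_tpow[OF m(2)]]
    by (rule linear_mapD(1)[OF bilinear_mapD(1)[OF tri_bilinear[OF V] pten_tpow[OF m(1)]] pten_tpow[OF m(2)]])
qed (simp_all add: vspace_tpow)

lemma tri_tmul3:
  assumes V: "vspace V" and stu: "s \<in> pow V a" "t \<in> pow V b" "u \<in> pow V c"
  shows "tri_incl V a b c (tmul V s (tmul V t u)) = pten (tens V) [s, t, u]"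
  unfolding tri_tmul[OF V stu(1) tmul_tpow[OF V stu(2,3)]] bi_incl_tmul[OF V stu(2,3)]
  using stu by (subst tmul_pten[OF vspace_tens]) (auto simp: tpow_tens)

lemma tri_right:
  assumes V: "vspace V" and x: "x \<in> pow V (a + b)" and u: "u \<in> pow V c"
  shows "tri_incl V a b c (tmul V x u) = tmul (tens V) (bi_incl V a b x) (pten (tens V) [u])"
proof (rule tpow_tmul_eqI[OF V _ _ _ x])
  have "linear_map (tpow V (a + b)) (tpow V (a + (b + c))) (\<lambda>x. tmul V x u)"
    using linear_tmul_tpow_left[OF V u, of "a + b"] by (simp add: add.assoc)
  from linear_map_comp[OF this tri_linear[OF V]]
  show "linear_map (tpow V (a + b)) (tens (tens V)) (\<lambda>x. tri_incl V a b c (tmul V x u))"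
    by (rule linear_map_into_tens)
  have "pten (tens V) [u] \<in> carr (tens (tens V))" by (rule pten_tens) (simp add: tpow_tens[OF u])
  from linear_map_comp[OF linear_map_into_tens[OF bi_incl_linear[OF V]] linear_tmul_left[OF vspace_tens this]]
  show "linear_map (tpow V (a + b)) (tens (tens V)) (\<lambda>x. tmul (tens V) (bi_incl V a b x) (pten (tens V) [u]))" .
  fix s t assume st: "s \<in> pow V a" "t \<in> pow V b"
  have "tri_incl V a b c (tmul V (tmul V s t) u) = pten (tens V) [s, t, u]"
    using tri_tmul3[OF V st u] st u by (simp add: tmul_assoc[OF V] tpow_tens)
  also have "\<dots> = tmul (tens V) (pten (tens V) [s, t]) (pten (tens V) [u])"
    using st u by (subst tmul_pten[OF vspace_tens]) (auto simp: tpow_tens)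
  finally show "tri_incl V a b c (tmul V (tmul V s t) u) =
      tmul (tens V) (bi_incl V a b (tmul V s t)) (pten (tens V) [u])"
    by (simp add: bi_incl_tmul[OF V st])
qed

context braided_op
begin

abbreviation T where "T \<equiv> T_op q V R"
abbreviation T1 where "T1 \<equiv> op_tensor (tens V) 2 1 T id"
abbreviation T2 where "T2 \<equiv> op_tensor (tens V) 1 2 id T"

lemma T1_linear: "linear_map (tpow (tens V) 3) (tpow (tens V) 3) T1"
  using op_tensor_linear[OF vspace_tens T_op_linear linear_map_id(1), of 1] by (simp del: One_nat_def)

lemma T2_linear: "linear_map (tpow (tens V) 3) (tpow (tens V) 3) T2"
  using op_tensor_linear[OF vspace_tens linear_map_id(1) T_op_linear, of 1] by (simp del: One_nat_def)

lemma balg_rep_linear: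
  "a \<in> balg m \<Longrightarrow> m \<le> n \<Longrightarrow> linear_map (tpow V n) (tpow V n) (rep n a)"
  by (rule rep_linear[OF balg_mono])

lemma tri_linear': "a + (b + c) = n \<Longrightarrow> linear_map (tpow V n) (tpow (tens V) 3) (tri_incl V a b c)"
  using tri_linear[OF V] by blast

text \<open>
  The coefficient \<open>A(i+j-c,c;i)\<close> lives on the first \<open>i + j\<close> strands, hence commutes with appending the
  third word.
\<close>

lemma T1_tri:
  assumes n: "i + (j + l) = n" and w: "w \<in> pow V n"
  shows "T1 (tri_incl V i j l w) =
    (\<Sum>c\<in>{i..i + j}. tri_incl V (i + j - c) c l (rep n (exch_coeff q (i + j - c) c i) w))"
proof -
  let ?e = "\<lambda>c. exch_coeff q (i + j - c) c i"
  let ?r = "\<lambda>c. rep (i + j) (?e c)"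
  have n': "(i + j) + l = n" using n by simp
  have b: "?e c \<in> balg (i + j)" if "c \<in> {i..i + j}" for c
    using exch_coeff_balg[of i c q "i + j - c"] that by simp
  have 1: "linear_map (tpow V ((i + j) + l)) (tpow (tens V) 3) (\<lambda>w. T1 (tri_incl V i j l w))"
    unfolding n' by (rule linear_map_comp[OF tri_linear'[OF n] T1_linear])
  have 2: "linear_map (tpow V ((i + j) + l)) (tpow (tens V) 3)
      (\<lambda>w. \<Sum>c\<in>{i..i + j}. tri_incl V (i + j - c) c l (rep n (?e c) w))"
    unfolding n'
  proof (intro linear_map_sum_fun vspace_tpow)
    fix c assume c: "c \<in> {i..i + j}"
    show "linear_map (tpow V n) (tpow (tens V) 3)
        (\<lambda>w. tri_incl V (i + j - c) c l (rep n (?e c) w))"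
      by (rule linear_map_comp[OF balg_rep_linear[OF b[OF c]] tri_linear']) (use n c in auto)
  qed
  show ?thesis
  proof (rule tpow_tmul_eqI[OF V 1 2 _ w[folded n']])
    fix x u assume x: "x \<in> pow V (i + j)" and u: "u \<in> pow V l"
    let ?f = "\<lambda>c. bi_incl V (i + j - c) c (?r c x)"
    have bi: "bi_incl V i j x \<in> pow (tens V) 2" by (rule linear_mapD(1)[OF bi_incl_linear[OF V] x])
    have u1: "pten (tens V) [u] \<in> pow (tens V) 1" by (rule linear_mapD(1)[OF linear_single u])
    have r: "?r c x \<in> pow V (i + j)" if "c \<in> {i..i + j}" for c
      by (rule linear_mapD(1)[OF rep_linear[OF b[OF that]] x])
    have f: "?f c \<in> pow (tens V) 2" if c: "c \<in> {i..i + j}" for c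
      using linear_mapD(1)[OF bi_incl_linear[OF V, of "i + j - c" c], of "?r c x"]
        r[OF c] c by simp
    have "T1 (tri_incl V i j l (tmul V x u)) = tmul (tens V) (T (bi_incl V i j x)) (pten (tens V) [u])"
      unfolding tri_right[OF V x u] op_tensor_tmul[OF vspace_tens T_op_linear linear_map_id(1) bi u1] by simp
    also have "\<dots> = (\<Sum>c\<in>{i..i + j}. tmul (tens V) (?f c) (pten (tens V) [u]))"
      unfolding T_op_bi_incl[OF x]
      by (rule linear_map_sum[OF linear_tmul_tpow_left[OF vspace_tens u1] vspace_tpow]) (rule f)
    also have "\<dots> = (\<Sum>c\<in>{i..i + j}. tri_incl V (i + j - c) c l (rep n (?e c) (tmul V x u)))"
    proof (rule sum.cong[OF HOL.refl])
      fix c assume c: "c \<in> {i..i + j}"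
      have "tri_incl V (i + j - c) c l (tmul V (?r c x) u) =
          tmul (tens V) (?f c) (pten (tens V) [u])"
        by (rule tri_right[OF V _ u]) (use r[OF c] c in simp)
      then show "tmul (tens V) (?f c) (pten (tens V) [u]) =
          tri_incl V (i + j - c) c l (rep n (?e c) (tmul V x u))"
        using rep_ext_right[OF b[OF c] x u] by (simp add: n'[symmetric])
    qed
    finally show "T1 (tri_incl V i j l (tmul V x u)) =
      (\<Sum>c\<in>{i..i + j}. tri_incl V (i + j - c) c l (rep n (?e c) (tmul V x u)))" .
  qed
qed

lemma T2_tri:
  assumes n: "i + (j + l) = n" and w: "w \<in> pow V n"
  shows "T2 (tri_incl V i j l w) =
    (\<Sum>c\<in>{j..j + l}. tri_incl V i (j + l - c) c (rep n (shift i (exch_coeff q (j + l - c) c j)) w))"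
proof -
  let ?e = "\<lambda>c. exch_coeff q (j + l - c) c j"
  let ?r = "\<lambda>c. rep (j + l) (?e c)"
  have b: "?e c \<in> balg (j + l)" if "c \<in> {j..j + l}" for c
    using exch_coeff_balg[of j c q "j + l - c"] that by simp
  have b': "shift i (?e c) \<in> balg n" if "c \<in> {j..j + l}" for c
    by (rule balg_shift[OF b[OF that]]) (simp add: n)
  have 1: "linear_map (tpow V (i + (j + l))) (tpow (tens V) 3) (\<lambda>w. T2 (tri_incl V i j l w))"
    unfolding n by (rule linear_map_comp[OF tri_linear'[OF n] T2_linear])
  have 2: "linear_map (tpow V (i + (j + l))) (tpow (tens V) 3)
      (\<lambda>w. \<Sum>c\<in>{j..j + l}. tri_incl V i (j + l - c) c (rep n (shift i (?e c)) w))"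
    unfolding n
    by (intro linear_map_sum_fun vspace_tpow linear_map_comp[OF rep_linear tri_linear'] b')
      (use n in auto)
  show ?thesis
  proof (rule tpow_tmul_eqI[OF V 1 2 _ w[folded n]])
    fix s v assume s: "s \<in> pow V i" and v: "v \<in> pow V (j + l)"
    let ?f = "\<lambda>c. bi_incl V (j + l - c) c (?r c v)"
    have bi: "bi_incl V j l v \<in> pow (tens V) 2" by (rule linear_mapD(1)[OF bi_incl_linear[OF V] v])
    have s1: "pten (tens V) [s] \<in> pow (tens V) 1" by (rule linear_mapD(1)[OF linear_single s])
    have r: "?r c v \<in> pow V (j + l)" if "c \<in> {j..j + l}" for c
      by (rule linear_mapD(1)[OF rep_linear[OF b[OF that]] v])
    have f: "?f c \<in> pow (tens V) 2" if c: "c \<in> {j..j + l}" for c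
      using linear_mapD(1)[OF bi_incl_linear[OF V, of "j + l - c" c], of "?r c v"]
        r[OF c] c by simp
    have "T2 (tri_incl V i j l (tmul V s v)) = tmul (tens V) (pten (tens V) [s]) (T (bi_incl V j l v))"
      unfolding tri_tmul[OF V s v] op_tensor_tmul[OF vspace_tens linear_map_id(1) T_op_linear s1 bi] by simp
    also have "\<dots> = (\<Sum>c\<in>{j..j + l}. tmul (tens V) (pten (tens V) [s]) (?f c))"
      unfolding T_op_bi_incl[OF v]
      by (rule linear_map_sum[OF linear_tmul_tpow_right[OF vspace_tens s1] vspace_tpow]) (rule f)
    also have "\<dots> = (\<Sum>c\<in>{j..j + l}. tri_incl V i (j + l - c) c
        (rep n (shift i (?e c)) (tmul V s v)))"
    proof (rule sum.cong[OF HOL.refl])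
      fix c assume c: "c \<in> {j..j + l}"
      have "tri_incl V i (j + l - c) c (tmul V s (?r c v)) =
          tmul (tens V) (pten (tens V) [s]) (?f c)"
        by (rule tri_tmul[OF V s]) (use r[OF c] c in simp)
      then show "tmul (tens V) (pten (tens V) [s]) (?f c) = tri_incl V i (j + l - c) c
          (rep n (shift i (?e c)) (tmul V s v))"
        using rep_ext_left[OF b[OF c] v s] by (simp add: n[symmetric])
    qed
    finally show "T2 (tri_incl V i j l (tmul V s v)) =
      (\<Sum>c\<in>{j..j + l}. tri_incl V i (j + l - c) c (rep n (shift i (?e c)) (tmul V s v)))" .
  qed
qed

lemma rep_closed: "a \<in> balg n \<Longrightarrow> w \<in> pow V n \<Longrightarrow> rep n a w \<in> pow V n"
  by (rule linear_mapD(1)[OF rep_linear])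

lemma exch_in: "c \<le> b \<Longrightarrow> a + b \<le> n \<Longrightarrow> exch_coeff q a b c \<in> balg n"
  by (rule balg_mono[OF exch_coeff_balg])

lemma exch_shift_in: "c \<le> b \<Longrightarrow> l + (a + b) \<le> n \<Longrightarrow> shift l (exch_coeff q a b c) \<in> balg n"
  by (rule balg_shift[OF exch_coeff_balg])

lemma tri_closed: "a + (b + c) = n \<Longrightarrow> w \<in> pow V n \<Longrightarrow> tri_incl V a b c w \<in> pow (tens V) 3"
  by (rule linear_mapD(1)[OF tri_linear'])

lemma rep_sum_tri:
  assumes "a + (b + c) = n" "w \<in> pow V n" "\<And>x. x \<in> A \<Longrightarrow> f x \<in> balg n"
  shows "tri_incl V a b c (rep n (sum f A) w) = (\<Sum>x\<in>A. tri_incl V a b c (rep n (f x) w))"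
  unfolding rep_sum
  by (rule linear_map_sum[OF tri_linear'[OF assms(1)] vspace_tpow]) (intro rep_closed assms(2,3))

text \<open>
  Each side is a triple sum.  Sorting the terms by the degrees \<open>(n - b - c, b, c)\<close> of the component in
  which they lie leaves one free index, and for every component the coefficients agree by
  \<open>exch_coeff_ybe\<close>.
\<close>

lemma T_ybe_tri:
  assumes n: "i + (j + l) = n" and w: "w \<in> pow V n"
  shows "T1 (T2 (T1 (tri_incl V i j l w))) = T2 (T1 (T2 (tri_incl V i j l w)))"
proof -
  define L where "L a b c m = exch_coeff q a b (i + j - m) *
      shift (i + j - m) (exch_coeff q (a + b - (i + j - m)) c m) * exch_coeff q (i + j - m) m i" for a b c m
  define M where "M a b c k = shift a (exch_coeff q b c k) * exch_coeff q a k i *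
      shift i (exch_coeff q (a + k - i) (b + c - k) j)" for a b c k
  define A where "A b c = {m. i \<le> m \<and> m \<le> c \<and> m \<le> i + j \<and> i + j \<le> m + b}" for b c
  define B where "B b c = {k. i \<le> k \<and> k \<le> c \<and> j + k \<le> b + c}" for b c
  let ?L = "\<lambda>b c m. tri_incl V (n - b - c) b c (rep n (L (n - b - c) b c m) w)"
    and ?M = "\<lambda>b c k. tri_incl V (n - b - c) b c (rep n (M (n - b - c) b c k) w)"
  let ?D = "{(b, c). b + c \<le> n}"
  have LM: "(\<Sum>m\<in>A b c. L a b c m) = (\<Sum>k\<in>B b c. M a b c k)" for a b c
    unfolding L_def M_def A_def B_def by (rule exch_coeff_ybe[OF q])
  note lin1 = linear_map_sum[OF T1_linear vspace_tpow] and lin2 = linear_map_sum[OF T2_linear vspace_tpow]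
  have left: "T1 (T2 (T1 (tri_incl V i j l w))) = (\<Sum>(b, c)\<in>?D. tri_incl V (n - b - c) b c (rep n (\<Sum>m\<in>A b c. L (n - b - c) b c m) w))"
  proof -
    define w1 where "w1 m = rep n (exch_coeff q (i + j - m) m i) w" for m
    define w2 where "w2 m c = rep n (shift (i + j - m) (exch_coeff q (m + l - c) c m)) (w1 m)" for m c
    define k where "k m = i + j - m" for m
    have w1: "w1 m \<in> pow V n" if "m \<in> {i..i + j}" for m
      unfolding w1_def using that n by (intro rep_closed exch_in w) auto
    have w2: "w2 m c \<in> pow V n" if "m \<in> {i..i + j}" "c \<in> {m..m + l}" for m c
      unfolding w2_def using that n by (intro rep_closed exch_shift_in w1) auto
    have "T1 (tri_incl V i j l w) = (\<Sum>m\<in>{i..i + j}. tri_incl V (k m) m l (w1 m))"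
      unfolding T1_tri[OF n w] w1_def k_def ..
    then have "T2 (T1 (tri_incl V i j l w)) = (\<Sum>m\<in>{i..i + j}. T2 (tri_incl V (k m) m l (w1 m)))"
      by (simp only:) (rule lin2, rule tri_closed[OF _ w1], use n in \<open>auto simp: k_def\<close>)
    also have "\<dots> = (\<Sum>m\<in>{i..i + j}. \<Sum>c\<in>{m..m + l}. tri_incl V (k m) (m + l - c) c (w2 m c))"
    proof (rule sum.cong[OF HOL.refl])
      fix m assume m: "m \<in> {i..i + j}"
      show "T2 (tri_incl V (k m) m l (w1 m)) = (\<Sum>c\<in>{m..m + l}. tri_incl V (k m) (m + l - c) c (w2 m c))"
        unfolding w2_def k_def by (rule T2_tri[OF _ w1[OF m]]) (use m n in auto)
    qed
    finally have "T1 (T2 (T1 (tri_incl V i j l w))) =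
        (\<Sum>m\<in>{i..i + j}. T1 (\<Sum>c\<in>{m..m + l}. tri_incl V (k m) (m + l - c) c (w2 m c)))"
      by (simp only:) (rule lin1, intro tpow_closed(4) tri_closed[OF _ w2], use n in \<open>auto simp: k_def\<close>)
    also have "\<dots> = (\<Sum>m\<in>{i..i + j}. \<Sum>c\<in>{m..m + l}. T1 (tri_incl V (k m) (m + l - c) c (w2 m c)))"
    proof (rule sum.cong[OF HOL.refl])
      fix m assume m: "m \<in> {i..i + j}"
      show "T1 (\<Sum>c\<in>{m..m + l}. tri_incl V (k m) (m + l - c) c (w2 m c)) =
        (\<Sum>c\<in>{m..m + l}. T1 (tri_incl V (k m) (m + l - c) c (w2 m c)))"
        by (rule lin1, rule tri_closed[OF _ w2[OF m]]) (use m n in \<open>auto simp: k_def\<close>)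
    qed
    also have "\<dots> = (\<Sum>m\<in>{i..i + j}. \<Sum>c\<in>{m..m + l}. \<Sum>b\<in>{k m..n - c}.
        ?L b c m)"
    proof (rule sum.cong[OF HOL.refl], rule sum.cong[OF HOL.refl])
      fix m c assume m: "m \<in> {i..i + j}" and c: "c \<in> {m..m + l}"
      have e: "k m + (m + l - c) = n - c" "k m + ((m + l - c) + c) = n" using m c n by (auto simp: k_def)
      have "T1 (tri_incl V (k m) (m + l - c) c (w2 m c)) =
        (\<Sum>b\<in>{k m..n - c}. tri_incl V (n - c - b) b c (rep n (exch_coeff q (n - c - b) b (k m)) (w2 m c)))"
        using T1_tri[OF e(2) w2[OF m c]] unfolding e(1) .
      also have "\<dots> = (\<Sum>b\<in>{k m..n - c}. ?L b c m)"
      proof (rule sum.cong[OF HOL.refl])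
        fix b assume b: "b \<in> {k m..n - c}"
        have e': "n - b - c = n - c - b" "n - c - b + b - (i + j - m) = m + l - c"
          using b m c n by (auto simp: k_def)
        have 1: "exch_coeff q (n - c - b) b (k m) \<in> balg n" using b m c n by (intro exch_in) auto
        have 2: "shift (i + j - m) (exch_coeff q (m + l - c) c m) \<in> balg n"
          using b m c n by (intro exch_shift_in) auto
        have 3: "exch_coeff q (i + j - m) m i \<in> balg n" using m n by (intro exch_in) auto
        have "rep n (L (n - b - c) b c m) w = rep n (exch_coeff q (n - c - b) b (k m)) (w2 m c)"
          unfolding L_def e'(1) unfolding e'(2) w2_def w1_def k_def by (simp only: rep_mult rep_closed balg.mult 1[unfolded k_def] 2 3 w)
        then show "tri_incl V (n - c - b) b c (rep n (exch_coeff q (n - c - b) b (k m)) (w2 m c)) =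
            ?L b c m" by (simp only: e'(1))
      qed
      finally show "T1 (tri_incl V (k m) (m + l - c) c (w2 m c)) =
        (\<Sum>b\<in>{k m..n - c}. ?L b c m)" .
    qed
    also have "\<dots> = (\<Sum>(m, c, b)\<in>(SIGMA m:{i..i + j}. SIGMA c:{m..m + l}. {k m..n - c}).
        ?L b c m)"
      by (simp add: sum.Sigma)
    also have "\<dots> = (\<Sum>(p, m)\<in>(SIGMA p:?D. A (fst p) (snd p)).
        ?L (fst p) (snd p) m)"
      by (rule sum.reindex_bij_witness[of _ "\<lambda>((b, c), m). (m, c, b)" "\<lambda>(m, c, b). ((b, c), m)"])
        (use n in \<open>auto simp: A_def k_def\<close>)
    also have "\<dots> = (\<Sum>p\<in>?D. \<Sum>m\<in>A (fst p) (snd p).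
        ?L (fst p) (snd p) m)"
      by (rule sum.Sigma[symmetric, OF finite_degree]) (simp add: A_def)
    also have "\<dots> = (\<Sum>(b, c)\<in>?D. \<Sum>m\<in>A b c. ?L b c m)"
      by (simp only: case_prod_unfold)
    also have "\<dots> = (\<Sum>(b, c)\<in>?D. tri_incl V (n - b - c) b c (rep n (\<Sum>m\<in>A b c. L (n - b - c) b c m) w))"
    proof (rule sum.cong[OF HOL.refl], clarify, rule rep_sum_tri[OF _ w, symmetric])
      fix b c m assume bc: "b + c \<le> n" and m: "m \<in> A b c"
      show "L (n - b - c) b c m \<in> balg n"
        unfolding L_def using m bc n
        by (intro balg.mult exch_in exch_shift_in) (auto simp: A_def)
    qed auto
    finally show ?thesis .
  qed
  have right: "T2 (T1 (T2 (tri_incl V i j l w))) = (\<Sum>(b, c)\<in>?D. tri_incl V (n - b - c) b c (rep n (\<Sum>k\<in>B b c. M (n - b - c) b c k) w))"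
  proof -
    define w1 where "w1 d = rep n (shift i (exch_coeff q (j + l - d) d j)) w" for d
    define w2 where "w2 d k = rep n (exch_coeff q (n - d - k) k i) (w1 d)" for d k
    have w1: "w1 d \<in> pow V n" if "d \<in> {j..j + l}" for d
      unfolding w1_def using that n by (intro rep_closed exch_shift_in w) auto
    have w2: "w2 d k \<in> pow V n" if "d \<in> {j..j + l}" "k \<in> {i..n - d}" for d k
      unfolding w2_def using that n by (intro rep_closed exch_in w1) auto
    have "T2 (tri_incl V i j l w) = (\<Sum>d\<in>{j..j + l}. tri_incl V i (j + l - d) d (w1 d))"
      unfolding T2_tri[OF n w] w1_def ..
    then have "T1 (T2 (tri_incl V i j l w)) = (\<Sum>d\<in>{j..j + l}. T1 (tri_incl V i (j + l - d) d (w1 d)))"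
      by (simp only:) (rule lin1, rule tri_closed[OF _ w1], use n in auto)
    also have "\<dots> = (\<Sum>d\<in>{j..j + l}. \<Sum>k\<in>{i..n - d}. tri_incl V (n - d - k) k d (w2 d k))"
    proof (rule sum.cong[OF HOL.refl])
      fix d assume d: "d \<in> {j..j + l}"
      have e: "i + (j + l - d) = n - d" "i + ((j + l - d) + d) = n" using d n by auto
      show "T1 (tri_incl V i (j + l - d) d (w1 d)) = (\<Sum>k\<in>{i..n - d}. tri_incl V (n - d - k) k d (w2 d k))"
        using T1_tri[OF e(2) w1[OF d]] unfolding e(1) w2_def .
    qed
    finally have "T2 (T1 (T2 (tri_incl V i j l w))) =
        (\<Sum>d\<in>{j..j + l}. T2 (\<Sum>k\<in>{i..n - d}. tri_incl V (n - d - k) k d (w2 d k)))"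
      by (simp only:) (rule lin2, intro tpow_closed(4) tri_closed[OF _ w2], use n in auto)
    also have "\<dots> = (\<Sum>d\<in>{j..j + l}. \<Sum>k\<in>{i..n - d}. T2 (tri_incl V (n - d - k) k d (w2 d k)))"
    proof (rule sum.cong[OF HOL.refl])
      fix d assume d: "d \<in> {j..j + l}"
      show "T2 (\<Sum>k\<in>{i..n - d}. tri_incl V (n - d - k) k d (w2 d k)) =
        (\<Sum>k\<in>{i..n - d}. T2 (tri_incl V (n - d - k) k d (w2 d k)))"
        by (rule lin2, rule tri_closed[OF _ w2[OF d]]) (use d n in auto)
    qed
    also have "\<dots> = (\<Sum>d\<in>{j..j + l}. \<Sum>k\<in>{i..n - d}. \<Sum>c\<in>{k..k + d}.
        tri_incl V (n - d - k) (k + d - c) c (rep n (M (n - d - k) (k + d - c) c k) w))"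
    proof (rule sum.cong[OF HOL.refl], rule sum.cong[OF HOL.refl])
      fix d k assume d: "d \<in> {j..j + l}" and k: "k \<in> {i..n - d}"
      have e: "n - d - k + (k + d) = n" using d k n by auto
      have "T2 (tri_incl V (n - d - k) k d (w2 d k)) = (\<Sum>c\<in>{k..k + d}. tri_incl V (n - d - k) (k + d - c) c
          (rep n (shift (n - d - k) (exch_coeff q (k + d - c) c k)) (w2 d k)))"
        by (rule T2_tri[OF e w2[OF d k]])
      also have "\<dots> = (\<Sum>c\<in>{k..k + d}.
          tri_incl V (n - d - k) (k + d - c) c (rep n (M (n - d - k) (k + d - c) c k) w))"
      proof (rule sum.cong[OF HOL.refl])
        fix c assume c: "c \<in> {k..k + d}"
        have e': "n - d - k + k - i = j + l - d" "k + d - c + c - k = d"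
          using d k c n by auto
        have 1: "shift (n - d - k) (exch_coeff q (k + d - c) c k) \<in> balg n"
          using d k c n by (intro exch_shift_in) auto
        have 2: "exch_coeff q (n - d - k) k i \<in> balg n" using d k n by (intro exch_in) auto
        have 3: "shift i (exch_coeff q (j + l - d) d j) \<in> balg n"
          using d k n by (intro exch_shift_in) auto
        have "rep n (M (n - d - k) (k + d - c) c k) w =
            rep n (shift (n - d - k) (exch_coeff q (k + d - c) c k)) (w2 d k)"
          unfolding M_def e' w2_def w1_def by (simp only: rep_mult rep_closed balg.mult 1 2 3 w)
        then show "tri_incl V (n - d - k) (k + d - c) c
            (rep n (shift (n - d - k) (exch_coeff q (k + d - c) c k)) (w2 d k)) =
          tri_incl V (n - d - k) (k + d - c) c (rep n (M (n - d - k) (k + d - c) c k) w)" by (simp only:)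
      qed
      finally show "T2 (tri_incl V (n - d - k) k d (w2 d k)) = (\<Sum>c\<in>{k..k + d}.
          tri_incl V (n - d - k) (k + d - c) c (rep n (M (n - d - k) (k + d - c) c k) w))" .
    qed
    also have "\<dots> = (\<Sum>(d, k, c)\<in>(SIGMA d:{j..j + l}. SIGMA k:{i..n - d}. {k..k + d}).
        tri_incl V (n - d - k) (k + d - c) c (rep n (M (n - d - k) (k + d - c) c k) w))"
      by (simp add: sum.Sigma)
    also have "\<dots> = (\<Sum>(p, k)\<in>(SIGMA p:?D. B (fst p) (snd p)).
        ?M (fst p) (snd p) k)"
    proof (rule sum.reindex_bij_witness[of _ "\<lambda>((b, c), k). (b + c - k, k, c)" "\<lambda>(d, k, c). ((k + d - c, c), k)"])
      fix x assume "x \<in> (SIGMA d:{j..j + l}. SIGMA k:{i..n - d}. {k..k + d})"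
      then obtain d k c where x: "x = (d, k, c)" and dkc: "j \<le> d" "d \<le> j + l" "i \<le> k" "k \<le> n - d" "k \<le> c" "c \<le> k + d"
        by auto
      have "n - (k + d - c) - c = n - d - k" using dkc n by auto
      then show "(case case x of (d, k, c) \<Rightarrow> ((k + d - c, c), k) of
            (p, k) \<Rightarrow> tri_incl V (n - fst p - snd p) (fst p) (snd p)
              (rep n (M (n - fst p - snd p) (fst p) (snd p) k) w)) =
          (case x of (d, k, c) \<Rightarrow> tri_incl V (n - d - k) (k + d - c) c (rep n (M (n - d - k) (k + d - c) c k) w))"
        by (simp only: x case_prod_conv fst_conv snd_conv)
    qed (use n in \<open>auto simp: B_def\<close>)
    also have "\<dots> = (\<Sum>p\<in>?D. \<Sum>k\<in>B (fst p) (snd p).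
        ?M (fst p) (snd p) k)"
      by (rule sum.Sigma[symmetric, OF finite_degree]) (simp add: B_def)
    also have "\<dots> = (\<Sum>(b, c)\<in>?D. \<Sum>k\<in>B b c. ?M b c k)"
      by (simp only: case_prod_unfold)
    also have "\<dots> = (\<Sum>(b, c)\<in>?D. tri_incl V (n - b - c) b c (rep n (\<Sum>k\<in>B b c. M (n - b - c) b c k) w))"
    proof (rule sum.cong[OF HOL.refl], clarify, rule rep_sum_tri[OF _ w, symmetric])
      fix b c k assume bc: "b + c \<le> n" and k: "k \<in> B b c"
      show "M (n - b - c) b c k \<in> balg n"
      proof (cases "i \<le> n - b - c + k")
        case True
        then show ?thesis
          unfolding M_def using k bc n
          by (intro balg.mult exch_in exch_shift_in) (auto simp: B_def)
      qed (use k in \<open>auto simp: B_def\<close>)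
    qed auto
    finally show ?thesis .
  qed
  show ?thesis unfolding left right LM ..
qed

theorem T_op_yang_baxter: "yang_baxter (tens V) T"
  unfolding yang_baxter_def Let_def
proof
  fix u assume u: "u \<in> pow (tens V) 3"
  show "T1 (T2 (T1 u)) = T2 (T1 (T2 u))"
  proof (rule tpow_tens_eqI[OF _ _ _ u, where f = "\<lambda>u. T1 (T2 (T1 u))" and g = "\<lambda>u. T2 (T1 (T2 u))"])
    show "linear_map (tpow (tens V) 3) (tpow (tens V) 3) (\<lambda>u. T1 (T2 (T1 u)))"
      by (intro linear_map_comp[OF _ T1_linear] linear_map_comp[OF _ T2_linear] T1_linear)
    show "linear_map (tpow (tens V) 3) (tpow (tens V) 3) (\<lambda>u. T2 (T1 (T2 u)))"
      by (intro linear_map_comp[OF _ T1_linear] linear_map_comp[OF _ T2_linear] T2_linear)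
    fix xss assume "xss \<in> lists (words V)" "length xss = 3"
    then obtain xs ys zs where xss: "xss = [xs, ys, zs]" "xs \<in> words V" "ys \<in> words V" "zs \<in> words V"
      by (auto simp: numeral_3_eq_3 length_Suc_conv)
    define i j l where "i = length xs" and "j = length ys" and "l = length zs"
    have p: "pten V xs \<in> pow V i" "pten V ys \<in> pow V j" "pten V zs \<in> pow V l"
      using xss by (auto intro!: pten_tpow simp: nwords_def i_def j_def l_def)
    have "pten (tens V) (map (pten V) xss) = tri_incl V i j l (tmul V (pten V xs) (tmul V (pten V ys) (pten V zs)))"
      by (simp add: xss tri_tmul3[OF V p])
    then show "T1 (T2 (T1 (pten (tens V) (map (pten V) xss)))) = T2 (T1 (T2 (pten (tens V) (map (pten V) xss))))"
      using T_ybe_tri[OF HOL.refl tmul_tpow[OF V p(1) tmul_tpow[OF V p(2,3)]]] by simp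
  qed
qed

end

section \<open>Functoriality\<close>

lemma tens_map_multilinear:
  assumes V: "vspace V" and W: "vspace W" and f: "linear_map V W f"
  shows "multilinear V (words V) (tens W) (\<lambda>xs. pten W (map f xs))"
proof (rule multilinearI[OF V disjI1[OF HOL.refl]])
  have w: "map f xs \<in> words W" if "xs \<in> words V" for xs
    using that linear_mapD(1)[OF f] by (auto simp: words_def)
  then show "pten W (map f xs) \<in> carr (tens W)" if "xs \<in> words V" for xs
    using that by (intro pten_tens)
  fix us vs assume "\<And>x. x \<in> carr V \<Longrightarrow> us @ x # vs \<in> words V"
  from this[OF vspace_closed(1)[OF V]] have "map f us \<in> words W" "map f vs \<in> words W" by (auto intro: w)
  then have "linear_map W (tens W) (\<lambda>x. pten W (map f us @ x # map f vs))"
    by (intro linear_pten_tens[OF W]) simp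
  from linear_map_comp[OF f this] show "linear_map V (tens W) (\<lambda>x. pten W (map f (us @ x # vs)))" by simp
qed

lemma tens_map_pten:
  "vspace V \<Longrightarrow> vspace W \<Longrightarrow> linear_map V W f \<Longrightarrow> xs \<in> words V \<Longrightarrow>
    tens_map V W f (pten V xs) = pten W (map f xs)"
  unfolding tens_map_def
  by (rule lin_ext_pten[OF _ vspace_tens disjI1[OF HOL.refl] tens_map_multilinear])

lemma tens_map_linear:
  "vspace V \<Longrightarrow> vspace W \<Longrightarrow> linear_map V W f \<Longrightarrow> linear_map (tens V) (tens W) (tens_map V W f)"
  using linear_map_lin_ext[OF _ vspace_tens disjI1[OF HOL.refl] tens_map_multilinear, of V W f]
  by (simp add: tens_map_def tens_def)

lemma map_nwords: "linear_map V W f \<Longrightarrow> xs \<in> nwords V n \<Longrightarrow> map f xs \<in> nwords W n"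
  using linear_mapD(1)[of V W f] by (auto simp: nwords_def words_def)

lemma tens_map_tpow_linear:
  assumes V: "vspace V" and W: "vspace W" and f: "linear_map V W f"
  shows "linear_map (tpow V n) (tpow W n) (tens_map V W f)"
  unfolding tpow_def[of V]
proof (rule linear_map_range)
  show "linear_map (tspan V (nwords V n)) (tens W) (tens_map V W f)"
    using linear_map_from_tens[OF tens_map_linear[OF assms], of n] by (simp add: tpow_def)
  show "tens_map V W f (pten V xs) \<in> pow W n" if "xs \<in> nwords V n" for xs
    using that by (simp add: tens_map_pten[OF assms] nwords_words pten_tpow map_nwords[OF f])
qed (simp_all add: vspace_tpow)

lemma tpow_map_multilinear:
  assumes "vspace V" "vspace W" "linear_map V W f"
  shows "multilinear V (nwords V n) (tpow W n) (\<lambda>xs. pten W (map f xs))"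
  using tens_map_multilinear[OF assms] pten_tpow[OF map_nwords[OF assms(3)]]
  by (auto simp: multilinear_def nwords_def)

lemma tpow_map_linear:
  "vspace V \<Longrightarrow> vspace W \<Longrightarrow> linear_map V W f \<Longrightarrow> linear_map (tpow V n) (tpow W n) (tpow_map V W n f)"
  unfolding tpow_map_def
  by (subst tpow_def, rule linear_map_lin_ext[OF _ vspace_tpow disjI2[OF HOL.refl] tpow_map_multilinear])

lemma tpow_map_pten:
  "vspace V \<Longrightarrow> vspace W \<Longrightarrow> linear_map V W f \<Longrightarrow> xs \<in> nwords V n \<Longrightarrow>
    tpow_map V W n f (pten V xs) = pten W (map f xs)"
  unfolding tpow_map_def
  by (rule lin_ext_pten[OF _ vspace_tpow disjI2[OF HOL.refl] tpow_map_multilinear])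

lemma tpow_map_tens_map:
  assumes "vspace V" "vspace W" "linear_map V W f" "u \<in> pow V n"
  shows "tpow_map V W n f u = tens_map V W f u"
  by (rule tpow_eqI[OF tpow_map_linear[OF assms(1-3)] tens_map_tpow_linear[OF assms(1-3)] _ assms(4)])
    (simp add: tpow_map_pten[OF assms(1-3)] tens_map_pten[OF assms(1-3)] nwords_words)

lemma tens_map_tmul:
  assumes V: "vspace V" and W: "vspace W" and f: "linear_map V W f"
    and s: "s \<in> carr (tens V)" and t: "t \<in> carr (tens V)"
  shows "tens_map V W f (tmul V s t) = tmul W (tens_map V W f s) (tens_map V W f t)"
proof -
  let ?F = "tens_map V W f"
  note lin = tens_map_linear[OF V W f]
  have w: "map f xs \<in> words W" if "xs \<in> words V" for xs
    using that linear_mapD(1)[OF f] by (auto simp: words_def)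
  show ?thesis
  proof (rule tens_eqI[OF linear_map_comp[OF linear_tmul_left[OF V t] lin]
        linear_map_comp[OF lin linear_tmul_left[OF W linear_mapD(1)[OF lin t]]] _ s])
    fix xs assume xs: "xs \<in> words V"
    note px = pten_tens[OF xs]
    show "?F (tmul V (pten V xs) t) = tmul W (?F (pten V xs)) (?F t)"
      by (rule tens_eqI[OF linear_map_comp[OF linear_tmul_right[OF V px] lin]
          linear_map_comp[OF lin linear_tmul_right[OF W linear_mapD(1)[OF lin px]]] _ t])
        (use xs in \<open>simp add: tmul_pten V W tens_map_pten[OF V W f] w\<close>)
  qed
qed

text \<open>
  Throughout, \<open>f\<^bsup>\<otimes>n\<^esup>\<close> is replaced by \<open>T(f)\<close>, with which it agrees on \<open>V\<^bsup>\<otimes>n\<^esup>\<close>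
  (\<open>tpow_map_tens_map\<close>).
\<close>

locale braided_hom = A: braided_op q V R + B: braided_op q W S
  for q :: "'k::field" and V :: "('k, 'v::ab_group_add) lspace" and R
    and W :: "('k, 'w::ab_group_add) lspace" and S +
  fixes f :: "'v \<Rightarrow> 'w"
  assumes f: "linear_map V W f"
    and comm: "u \<in> pow V 2 \<Longrightarrow> tpow_map V W 2 f (R u) = S (tpow_map V W 2 f u)"
begin

abbreviation F where "F \<equiv> tens_map V W f"

lemmas F_linear = tens_map_tpow_linear[OF A.V B.V f]
lemmas F_tmul = tens_map_tmul[OF A.V B.V f]

lemma F_R: "u \<in> pow V 2 \<Longrightarrow> F (R u) = S (F u)"
  using comm[of u] linear_mapD(1)[OF A.R, of u] by (simp add: tpow_map_tens_map[OF A.V B.V f])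

lemma F_sig:
  assumes i: "i + 2 \<le> n" and u: "u \<in> pow V n"
  shows "F (sigma_op q V R n i u) = sigma_op q W S n i (F u)"
proof -
  obtain m where n: "n = i + (2 + m)" using i by (metis add.assoc le_Suc_ex)
  have 1: "linear_map (tpow V (i + (2 + m))) (tpow W n) (\<lambda>u. F (sigma_op q V R n i u))"
    and 2: "linear_map (tpow V (i + (2 + m))) (tpow W n) (\<lambda>u. sigma_op q W S n i (F u))"
    unfolding n[symmetric]
    by (rule linear_map_comp[OF A.sigma_op_linear[OF i] F_linear]
        linear_map_comp[OF F_linear B.sigma_op_linear[OF i]])+
  show ?thesis
  proof (rule tpow_tmul3_eqI[OF A.V 1 2 _ u[unfolded n]])
    fix s t v assume stv: "s \<in> pow V i" "t \<in> pow V 2" "v \<in> pow V m"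
    note c = stv[THEN tpow_tens] linear_mapD(1)[OF A.R stv(2), THEN tpow_tens]
    have x: "tmul V s (tmul V (R t) v) \<in> pow V n"
      unfolding n by (intro tmul_tpow[OF A.V] stv linear_mapD(1)[OF A.R])
    have Fx: "F (tscale q (tmul V s (tmul V (R t) v))) = tscale q (F (tmul V s (tmul V (R t) v)))"
      using linear_mapD(3)[OF F_linear x, of q] by simp
    show "F (sigma_op q V R n i (tmul V s (tmul V t v))) = sigma_op q W S n i (F (tmul V s (tmul V t v)))"
    proof -
      have e: "F (tmul V s (tmul V x v)) = tmul W (F s) (tmul W (F x) (F v))" if "x \<in> carr (tens V)" for x
        using that c by (simp add: F_tmul tmul_tens[OF A.V])
      show ?thesis
        unfolding n A.sigma_op_tmul[OF stv] e[OF c(2)] B.sigma_op_tmul[OF stv[THEN linear_mapD(1)[OF F_linear]]]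
        unfolding Fx e[OF c(4)] F_R[OF stv(2)] ..
    qed
  qed
qed

lemma F_letter:
  assumes "fst l + 2 \<le> n" and u: "u \<in> pow V n"
  shows "F (A.letter n l u) = B.letter n l (F u)"
proof (cases l)
  case (Pair i b)
  then have i: "i + 2 \<le> n" using assms by simp
  show ?thesis
  proof (cases b)
    case True
    then show ?thesis using F_sig[OF i u] by (simp add: Pair A.letter_True B.letter_True)
  next
    case False
    note Fu = linear_mapD(1)[OF F_linear u]
    note su = linear_mapD(1)[OF A.inverse_op.sigma_op_linear[OF i] u]
    have "F u = B.sig n i (F (A.sig' n i u))"
      using F_sig[OF i su] A.sig_inverse(1)[OF i u] by simp
    then have "B.sig' n i (F u) = F (A.sig' n i u)"
      using B.sig_inverse(2)[OF i linear_mapD(1)[OF F_linear su]] by simp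
    then show ?thesis
      using False by (simp add: Pair A.letter_False[OF i u] B.letter_False[OF i Fu])
  qed
qed

lemma F_act:
  assumes "w \<in> strand_words n" and u: "u \<in> pow V n"
  shows "F (A.act n w u) = B.act n w (F u)"
  using assms(1)
  by (induction w) (auto simp: F_letter u linear_mapD(1)[OF A.act_linear])

lemma F_rep:
  assumes a: "a \<in> balg n" and u: "u \<in> pow V n"
  shows "F (A.rep n a u) = B.rep n a (F u)"
proof -
  have k: "g \<in> strand_braids n" if "g \<in> Poly_Mapping.keys a" for g
    using that balg_keys[OF a] by blast
  have c: "A.bop n g u \<in> pow V n" if "g \<in> Poly_Mapping.keys a" for g
    by (rule linear_mapD(1)[OF A.bop_linear[OF k[OF that]] u])
  have "F (A.rep n a u) = (\<Sum>g\<in>Poly_Mapping.keys a. F (tscale (Poly_Mapping.lookup a g) (A.bop n g u)))"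
    unfolding local_rep_def
    by (rule linear_map_sum[OF F_linear vspace_tpow]) (rule tpow_closed(3)[OF c])
  also have "\<dots> = (\<Sum>g\<in>Poly_Mapping.keys a. tscale (Poly_Mapping.lookup a g) (B.bop n g (F u)))"
  proof (rule sum.cong[OF HOL.refl])
    fix g assume g: "g \<in> Poly_Mapping.keys a"
    obtain w where w: "w \<in> strand_words n" "g = braid_of_word w"
      using k[OF g] by (auto simp: strand_braids_def)
    have "F (A.bop n g u) = B.bop n g (F u)"
      using F_act[OF w(1) u] by (simp add: w A.braid_op_word B.braid_op_word u linear_mapD(1)[OF F_linear])
    then show "F (tscale (Poly_Mapping.lookup a g) (A.bop n g u)) =
        tscale (Poly_Mapping.lookup a g) (B.bop n g (F u))"
      using linear_mapD(3)[OF F_linear c[OF g]] by simp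
  qed
  finally show ?thesis by (simp add: local_rep_def)
qed

abbreviation FF where "FF \<equiv> tpow_map (tens V) (tens W) 2 F"

lemmas F_tens_linear = tens_map_linear[OF A.V B.V f]
lemmas FF_linear = tpow_map_linear[OF vspace_tens vspace_tens F_tens_linear, of 2]

lemma FF_pair:
  "s \<in> carr (tens V) \<Longrightarrow> t \<in> carr (tens V) \<Longrightarrow> FF (pten (tens V) [s, t]) = pten (tens W) [F s, F t]"
  by (subst tpow_map_pten[OF vspace_tens vspace_tens F_tens_linear]) (auto simp: nwords_def)

lemma FF_bi_incl:
  assumes w: "w \<in> pow V (b + c)"
  shows "FF (bi_incl V b c w) = bi_incl W b c (F w)"
proof (rule tpow_tmul_eqI[OF A.V linear_map_comp[OF bi_incl_linear[OF A.V] FF_linear]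
      linear_map_comp[OF F_linear bi_incl_linear[OF B.V]] _ w])
  fix s t assume st: "s \<in> pow V b" "t \<in> pow V c"
  show "FF (bi_incl V b c (tmul V s t)) = bi_incl W b c (F (tmul V s t))"
    using st by (simp add: bi_incl_tmul A.V B.V FF_pair tpow_tens F_tmul linear_mapD(1)[OF F_linear])
qed

theorem T_op_natural:
  assumes u: "u \<in> pow (tens V) 2"
  shows "FF (T_op q V R u) = T_op q W S (FF u)"
proof (rule tpow_tens_eqI[OF linear_map_comp[OF A.T_op_linear FF_linear]
      linear_map_comp[OF FF_linear B.T_op_linear] _ u])
  fix xss assume "xss \<in> lists (words V)" "length xss = 2"
  then obtain xs ys where xss: "xss = [xs, ys]" "xs \<in> words V" "ys \<in> words V"
    by (auto simp: numeral_2_eq_2 length_Suc_conv)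
  define i j w where "i = length xs" and "j = length ys" and "w = pten V (xs @ ys)"
  have w: "w \<in> pow V (i + j)"
    unfolding w_def by (rule pten_tpow) (use xss in \<open>simp add: nwords_def i_def j_def\<close>)
  let ?x = "\<lambda>c. exch_coeff q (i + j - c) c i"
  have e: "pten (tens V) (map (pten V) xss) = bi_incl V i j w"
    using pair_bi_incl[OF A.V xss(2,3)] by (simp add: xss(1) i_def j_def w_def)
  have x: "?x c \<in> balg (i + j)" if "c \<in> {i..i + j}" for c
    using exch_coeff_balg[of i c q "i + j - c"] that by simp
  have r: "A.rep (i + j) (?x c) w \<in> pow V (i + j - c + c)" if "c \<in> {i..i + j}" for c
    using linear_mapD(1)[OF A.rep_linear[OF x[OF that]] w] that by simp
  have "FF (T_op q V R (bi_incl V i j w)) =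
      (\<Sum>c\<in>{i..i + j}. FF (bi_incl V (i + j - c) c (A.rep (i + j) (?x c) w)))"
    unfolding A.T_op_bi_incl[OF w]
    by (rule linear_map_sum[OF FF_linear vspace_tpow])
      (rule linear_mapD(1)[OF bi_incl_linear[OF A.V] r])
  also have "\<dots> = (\<Sum>c\<in>{i..i + j}. bi_incl W (i + j - c) c (B.rep (i + j) (?x c) (F w)))"
    by (intro sum.cong HOL.refl) (simp only: FF_bi_incl[OF r] F_rep[OF x w])
  also have "\<dots> = T_op q W S (FF (bi_incl V i j w))"
    unfolding FF_bi_incl[OF w] B.T_op_bi_incl[OF linear_mapD(1)[OF F_linear w]] ..
  finally show "FF (T_op q V R (pten (tens V) (map (pten V) xss))) =
      T_op q W S (FF (pten (tens V) (map (pten V) xss)))" unfolding e .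
qed

end

section \<open>The theorem\<close>

theorem mainTheorem2:
  fixes q :: "'k::field"
    and V :: "('k, 'v::ab_group_add) lspace"
    and V' :: "('k, 'w::ab_group_add) lspace"
  assumes "q \<noteq> 0"
  shows "(\<forall>R. braided V R \<longrightarrow>
            linear_map (tpow (tens V) 2) (tpow (tens V) 2) (T_op q V R) \<and>
            yang_baxter (tens V) (T_op q V R)) \<and>
         (\<forall>R R' f. braided V R \<longrightarrow> braided V' R' \<longrightarrow> linear_map V V' f \<longrightarrow>
            (\<forall>u\<in>carr (tpow V 2). tpow_map V V' 2 f (R u) = R' (tpow_map V V' 2 f u)) \<longrightarrow>
            (\<forall>u\<in>carr (tpow (tens V) 2).
               tpow_map (tens V) (tens V') 2 (tens_map V V' f) (T_op q V R u) =
               T_op q V' R' (tpow_map (tens V) (tens V') 2 (tens_map V V' f) u)))"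
proof (intro conjI allI impI)
  fix R assume R: "braided V R"
  interpret braided_op q V R using assms R by unfold_locales
  show "linear_map (tpow (tens V) 2) (tpow (tens V) 2) (T_op q V R)" by (rule T_op_linear)
  show "yang_baxter (tens V) (T_op q V R)" by (rule T_op_yang_baxter)
next
  fix R R' f
  assume R: "braided V R" and R': "braided V' R'" and f: "linear_map V V' f"
    and comm: "\<forall>u\<in>carr (tpow V 2). tpow_map V V' 2 f (R u) = R' (tpow_map V V' 2 f u)"
  interpret braided_hom q V R V' R' f using assms R R' f comm by unfold_locales auto
  show "\<forall>u\<in>carr (tpow (tens V) 2). tpow_map (tens V) (tens V') 2 (tens_map V V' f) (T_op q V R u) =
      T_op q V' R' (tpow_map (tens V) (tens V') 2 (tens_map V V' f) u)"
    by (intro ballI T_op_natural)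
qed

end
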